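(* Let $\mathcal{A}$ be a commutative $C^*$-algebra generated by its projections and let $\tau=(\{D_t\}_{t\in\mathbb{F}},\{\tau_t\}_{t\in\mathbb{F}})$ be a semi-saturated, orthogonal ($C^*$-algebraic) partial action of a free group $\mathbb{F}$ on $\mathcal{A}$ such that for every generator $\alpha$ of $\mathbb{F}$ we have $\mathcal{A}=D_\alpha\oplus C_\alpha$ for some ideal $C_\alpha$ of $\mathcal{A}$. Then there exists a Boolean dynamical system $(\mathcal{B},\mathcal{L},\theta)$ such that $\mathcal{A}\rtimes_\tau\mathbb{F}\cong C^*(\mathcal{B},\mathcal{L},\theta)$.
   Context: Partial actions on $C^*$-algebras. A partial action of a group $G$ on a $C^*$-algebra $\mathcal{A}$ is a pair $(\{D_t\}_{t\in G},\{\tau_t\}_{t\in G})$ of closed two-sided ideals $D_t$ of $\mathcal{A}$ and $*$-isomorphisms $\tau_t:D_{t^{-1}}\to D_t$ with $D_e=\mathcal{A}$, $\tau_e=\mathrm{id}$; $\tau_s(D_{s^{-1}}\cap D_t)=D_s\cap D_{st}$; and $\tau_s(\tau_t(x))=\tau_{st}(x)$ for $x\in D_{t^{-1}}\cap D_{(st)^{-1}}$. For $G=\mathbb{F}$ a free group on a set of generators, with word length $|\cdot|$, it is semi-saturated if $\tau_s\circ\tau_t=\tau_{st}$ (as partially defined maps) whenever $|st|=|s|+|t|$, and orthogonal if $D_a\cap D_b=\{0\}$ for distinct generators $a,b$. The partial crossed product $\mathcal{A}\rtimes_\tau\mathbb{F}$ is the completion in the universal (maximal) $C^*$-norm of the $*$-algebra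 of finite formal sums $\sum_t a_t\delta_t$, $a_t\in D_t$, with $(a\delta_s)(b\delta_t)=\tau_s(\tau_{s^{-1}}(a)b)\delta_{st}$ and $(a\delta_s)^*=\tau_{s^{-1}}(a^* )\delta_{s^{-1}}$. "Ideal" means closed two-sided ideal. Boolean dynamical systems. A Boolean algebra is a set $\mathcal{B}$ with an element $\emptyset$ and operations $\cap,\cup,\setminus$ such that $(\mathcal{B},\cap,\cup)$ is a distributive lattice, $A\cap\emptyset=\emptyset$, $(A\cap B)\cup(A\setminus B)=A$ and $(A\cap B)\cap(A\setminus B)=\emptyset$ (no unit is required); $A\subseteq B$ means $A\cap B=A$. A Boolean dynamical system $(\mathcal{B},\mathcal{L},\theta)$ consists of a Boolean algebra $\mathcal{B}$, a set $\mathcal{L}$, and for each $\alpha\in\mathcal{L}$ a map $\theta_\alpha:\mathcal{B}\to\mathcal{B}$ preserving $\cap,\cup,\setminus$ and $\emptyset$. Put $\mathcal{R}_\alpha=\{A\in\mathcal{B}:A\subseteq\theta_\alpha(B)\text{ for some }B\in\mathcal{B}\}$ and $\Delta_A=\{\alpha\in\mathcal{L}:\theta_\alpha(A)\ne\emptyset\}$. $A\in\mathcal{B}$ is regular if $0<|\Delta_B|<\infty$ for every $\emptyset\ne B\subseteq A$; $\mathcal{B}_{reg}$ is the set of regular elements. $C^*(\mathcal{B},\mathcal{L},\theta)$ is the universal $C^*$-algebra generated by projections $\{p_A\}_{A\in\mathcal{B}}$ and partial isometries $\{s_{\alpha,B}:\alpha\in\mathcal{L},B\in\mathcal{R}_\alpha\}$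 subject to: (i) $p_\emptyset=0$, $p_{A\cap A'}=p_Ap_{A'}$, $p_{A\cup A'}=p_A+p_{A'}-p_{A\cap A'}$; (ii) $p_As_{\alpha,B}=s_{\alpha,B}p_{\theta_\alpha(A)}$; (iii) $s_{\alpha,B}^*s_{\alpha',B'}=\delta_{\alpha,\alpha'}p_{B\cap B'}$; (iv) $p_A=\sum_{\alpha\in\Delta_A}s_{\alpha,\theta_\alpha(A)}s_{\alpha,\theta_\alpha(A)}^*$ for $A\in\mathcal{B}_{reg}$. *)

theory Defs
  imports "HOL-Analysis.Analysis" "HOL-Algebra.Group"
begin

section \<open>C*-algebras as a type class\<close>

text \<open>Complex C*-algebras, not necessarily unital.  The algebra structure and the norm come from
  the library classes; \<open>cscale\<close> extends the real scalar multiplication to the complex numbers.\<close>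

class cstar_algebra = real_normed_algebra + banach +
  fixes cscale :: "complex \<Rightarrow> 'a \<Rightarrow> 'a"
    and adj :: "'a \<Rightarrow> 'a"
  assumes cscale_of_real: "cscale (complex_of_real r) x = r *\<^sub>R x"
    and cscale_add_right: "cscale c (x + y) = cscale c x + cscale c y"
    and cscale_add_left: "cscale (c + d) x = cscale c x + cscale d x"
    and cscale_cscale: "cscale c (cscale d x) = cscale (c * d) x"
    and mult_cscale_left: "cscale c x * y = cscale c (x * y)"
    and mult_cscale_right: "x * cscale c y = cscale c (x * y)"
    and norm_cscale: "norm (cscale c x) = cmod c * norm x"
    and adj_add: "adj (x + y) = adj x + adj y"
    and adj_cscale: "adj (cscale c x) = cscale (cnj c) (adj x)"
    and adj_mult: "adj (x * y) = adj y * adj x"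
    and adj_adj: "adj (adj x) = x"
    and norm_adj_mult: "norm (adj x * x) = (norm x)\<^sup>2"

instantiation complex :: cstar_algebra
begin

definition cscale_complex :: "complex \<Rightarrow> complex \<Rightarrow> complex"
  where "cscale_complex c x = c * x"

definition adj_complex :: "complex \<Rightarrow> complex"
  where "adj_complex = cnj"

instance
  by standard
    (auto simp: cscale_complex_def adj_complex_def algebra_simps norm_mult
      scaleR_conv_of_real power2_eq_square)

end

definition is_projection :: "'a::cstar_algebra \<Rightarrow> bool"
  where "is_projection p \<longleftrightarrow> p * p = p \<and> adj p = p"

definition cstar_subalgebra :: "'a::cstar_algebra set \<Rightarrow> bool"
  where "cstar_subalgebra S \<longleftrightarrow> closed S \<and> 0 \<in> S \<and>
    (\<forall>x\<in>S. \<forall>y\<in>S. x + y \<in> S \<and> x * y \<in> S) \<and>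
    (\<forall>x\<in>S. adj x \<in> S \<and> (\<forall>c. cscale c x \<in> S))"

text \<open>Ideals are closed and two-sided.\<close>

definition cstar_ideal :: "'a::cstar_algebra set \<Rightarrow> bool"
  where "cstar_ideal I \<longleftrightarrow> closed I \<and> 0 \<in> I \<and>
    (\<forall>x\<in>I. \<forall>y\<in>I. x + y \<in> I) \<and> (\<forall>x\<in>I. \<forall>c. cscale c x \<in> I) \<and>
    (\<forall>x\<in>I. \<forall>a. a * x \<in> I \<and> x * a \<in> I)"

definition ideal_direct_sum :: "'a::cstar_algebra set \<Rightarrow> 'a set \<Rightarrow> bool"
  where "ideal_direct_sum I J \<longleftrightarrow> I \<inter> J = {0} \<and> (\<forall>x. \<exists>d\<in>I. \<exists>c\<in>J. x = d + c)"

definition star_iso_on :: "('a::cstar_algebra \<Rightarrow> 'a) \<Rightarrow> 'a set \<Rightarrow> 'a set \<Rightarrow> bool"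
  where "star_iso_on f I J \<longleftrightarrow> bij_betw f I J \<and>
    (\<forall>x\<in>I. \<forall>y\<in>I. f (x + y) = f x + f y \<and> f (x * y) = f x * f y) \<and>
    (\<forall>x\<in>I. f (adj x) = adj (f x) \<and> (\<forall>c. f (cscale c x) = cscale c (f x)))"

section \<open>Free groups\<close>

text \<open>Elements of the free group on \<open>X\<close> are the reduced words in letters \<open>(x, True)\<close>,
  standing for the generator \<open>x\<close>, and \<open>(x, False)\<close>, standing for its inverse.
  The word length is \<^const>\<open>length\<close>.\<close>

definition inv_letter :: "'g \<times> bool \<Rightarrow> 'g \<times> bool"
  where "inv_letter a = (fst a, \<not> snd a)"

definition reduced_word :: "('g \<times> bool) list \<Rightarrow> bool"
  where "reduced_word w \<longleftrightarrow> successively (\<lambda>a b. b \<noteq> inv_letter a) w"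

definition push_letter :: "'g \<times> bool \<Rightarrow> ('g \<times> bool) list \<Rightarrow> ('g \<times> bool) list"
  where "push_letter a w =
    (case w of [] \<Rightarrow> [a] | b # v \<Rightarrow> if b = inv_letter a then v else a # w)"

definition free_group :: "'g set \<Rightarrow> ('g \<times> bool) list monoid"
  where "free_group X =
    \<lparr>carrier = {w. reduced_word w \<and> fst ` set w \<subseteq> X},
     mult = (\<lambda>u v. foldr push_letter u v),
     one = []\<rparr>"

abbreviation free_generator :: "'g \<Rightarrow> ('g \<times> bool) list"
  where "free_generator a \<equiv> [(a, True)]"

lemma inv_letter_inv_letter [simp]: "inv_letter (inv_letter a) = a"
  by (simp add: inv_letter_def)

lemma fst_inv_letter [simp]: "fst (inv_letter a) = fst a"
  by (simp add: inv_letter_def)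

lemma inv_letter_neq: "a \<noteq> inv_letter a"
  by (simp add: inv_letter_def prod_eq_iff)

lemma push_letter_Nil: "push_letter a [] = [a]"
  by (simp add: push_letter_def)

lemma push_letter_Cons:
  "push_letter a (b # v) = (if b = inv_letter a then v else a # b # v)"
  by (simp add: push_letter_def)

lemma reduced_word_Cons:
  "reduced_word (a # w) \<longleftrightarrow> (w = [] \<or> hd w \<noteq> inv_letter a) \<and> reduced_word w"
  by (auto simp add: reduced_word_def successively_Cons)

lemma reduced_word_push: "reduced_word w \<Longrightarrow> reduced_word (push_letter a w)"
  by (cases w) (simp_all add: push_letter_Nil push_letter_Cons reduced_word_Cons)

lemma reduced_word_foldr_push: "reduced_word w \<Longrightarrow> reduced_word (foldr push_letter u w)"
  by (induction u) (simp_all add: reduced_word_push)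

lemma fst_push_letter: "fst ` set (push_letter a w) \<subseteq> insert (fst a) (fst ` set w)"
  by (cases w) (auto simp add: push_letter_Nil push_letter_Cons)

lemma fst_foldr_push: "fst ` set (foldr push_letter u w) \<subseteq> fst ` set u \<union> fst ` set w"
proof (induction u)
  case (Cons a u)
  have "fst ` set (foldr push_letter (a # u) w) \<subseteq>
      insert (fst a) (fst ` set (foldr push_letter u w))"
    using fst_push_letter[of a "foldr push_letter u w"] by simp
  also have "\<dots> \<subseteq> insert (fst a) (fst ` set u \<union> fst ` set w)"
    using Cons.IH by (rule insert_mono)
  finally show ?case by simp
qed simp

lemma push_inv_push:
  assumes "reduced_word w"
  shows "push_letter (inv_letter a) (push_letter a w) = w"
proof (cases w)
  case Nil
  then show ?thesis by (simp add: push_letter_Nil push_letter_Cons)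
next
  case (Cons b v)
  with assms show ?thesis
    by (cases v) (auto simp add: push_letter_Nil push_letter_Cons reduced_word_Cons)
qed

lemma foldr_push_push:
  assumes "reduced_word w"
  shows "foldr push_letter (push_letter a u) w = push_letter a (foldr push_letter u w)"
proof (cases u)
  case (Cons b v)
  have "push_letter a (push_letter (inv_letter a) (foldr push_letter v w)) = foldr push_letter v w"
    using push_inv_push[OF reduced_word_foldr_push[OF assms], of "inv_letter a" v] by simp
  with Cons show ?thesis by (simp add: push_letter_Cons)
qed (simp add: push_letter_Nil)

lemma foldr_push_assoc:
  assumes "reduced_word w"
  shows "foldr push_letter (foldr push_letter u v) w = foldr push_letter u (foldr push_letter v w)"
  by (induction u) (simp_all add: foldr_push_push[OF assms])

lemma foldr_push_Nil: "reduced_word u \<Longrightarrow> foldr push_letter u [] = u"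
proof (induction u)
  case (Cons a u)
  then have "foldr push_letter u [] = u" "u = [] \<or> hd u \<noteq> inv_letter a"
    by (simp_all add: reduced_word_Cons)
  then show ?case
    by (cases u) (simp_all add: push_letter_Nil push_letter_Cons)
qed simp

lemma foldr_push_inverse: "foldr push_letter (rev (map inv_letter w)) w = []"
proof (induction w)
  case (Cons a w)
  then show ?case by (simp add: push_letter_Cons)
qed simp

lemma reduced_word_inverse:
  assumes "reduced_word w"
  shows "reduced_word (rev (map inv_letter w))"
proof -
  have "inv_letter x \<noteq> y" if "y \<noteq> inv_letter x" for x y :: "'a \<times> bool"
    using that by simp
  with assms show ?thesis
    unfolding reduced_word_def successively_rev successively_map
    by (auto elim!: successively_mono)
qed

lemma group_free_group: "group (free_group X)"
proof (rule groupI)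
  fix u v assume "u \<in> carrier (free_group X)" "v \<in> carrier (free_group X)"
  then show "u \<otimes>\<^bsub>free_group X\<^esub> v \<in> carrier (free_group X)"
    using subset_trans[OF fst_foldr_push[of u v], of X] reduced_word_foldr_push[of v u]
    by (simp add: free_group_def)
next
  fix u v w
  assume "u \<in> carrier (free_group X)" "v \<in> carrier (free_group X)" "w \<in> carrier (free_group X)"
  then show "u \<otimes>\<^bsub>free_group X\<^esub> v \<otimes>\<^bsub>free_group X\<^esub> w =
      u \<otimes>\<^bsub>free_group X\<^esub> (v \<otimes>\<^bsub>free_group X\<^esub> w)"
    by (simp add: free_group_def foldr_push_assoc)
next
  fix u assume u: "u \<in> carrier (free_group X)"
  have "rev (map inv_letter u) \<in> carrier (free_group X)"
    using u reduced_word_inverse[of u] by (simp add: free_group_def image_image)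
  moreover have "rev (map inv_letter u) \<otimes>\<^bsub>free_group X\<^esub> u = \<one>\<^bsub>free_group X\<^esub>"
    by (simp add: free_group_def foldr_push_inverse)
  ultimately show "\<exists>v\<in>carrier (free_group X). v \<otimes>\<^bsub>free_group X\<^esub> u = \<one>\<^bsub>free_group X\<^esub>"
    by blast
qed (simp_all add: free_group_def reduced_word_def)

section \<open>Partial actions\<close>

text \<open>\<open>\<tau> t\<close> is a total function of which only the values on \<open>D (inv t)\<close> matter.\<close>

locale partial_action = group G for G :: "('t, 'm) monoid_scheme" (structure) +
  fixes D :: "'t \<Rightarrow> 'a::cstar_algebra set"
    and \<tau> :: "'t \<Rightarrow> 'a \<Rightarrow> 'a"
  assumes ideal_D: "t \<in> carrier G \<Longrightarrow> cstar_ideal (D t)"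
    and iso_\<tau>: "t \<in> carrier G \<Longrightarrow> star_iso_on (\<tau> t) (D (inv t)) (D t)"
    and D_one: "D \<one> = UNIV"
    and \<tau>_one: "\<tau> \<one> x = x"
    and image_\<tau>: "s \<in> carrier G \<Longrightarrow> t \<in> carrier G \<Longrightarrow>
      \<tau> s ` (D (inv s) \<inter> D t) = D s \<inter> D (s \<otimes> t)"
    and \<tau>_\<tau>: "s \<in> carrier G \<Longrightarrow> t \<in> carrier G \<Longrightarrow>
      x \<in> D (inv t) \<inter> D (inv (s \<otimes> t)) \<Longrightarrow> \<tau> s (\<tau> t x) = \<tau> (s \<otimes> t) x"

definition partial_map ::
    "('t, 'm) monoid_scheme \<Rightarrow> ('t \<Rightarrow> 'a set) \<Rightarrow> ('t \<Rightarrow> 'a \<Rightarrow> 'a) \<Rightarrow> 't \<Rightarrow> 'a \<rightharpoonup> 'a"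
  where "partial_map G D \<tau> t x = (if x \<in> D (inv\<^bsub>G\<^esub> t) then Some (\<tau> t x) else None)"

definition semi_saturated ::
    "'g set \<Rightarrow> (('g \<times> bool) list \<Rightarrow> 'a set) \<Rightarrow> (('g \<times> bool) list \<Rightarrow> 'a \<Rightarrow> 'a) \<Rightarrow> bool"
  where "semi_saturated X D \<tau> \<longleftrightarrow>
    (\<forall>s\<in>carrier (free_group X). \<forall>t\<in>carrier (free_group X).
      length (s \<otimes>\<^bsub>free_group X\<^esub> t) = length s + length t \<longrightarrow>
      partial_map (free_group X) D \<tau> s \<circ>\<^sub>m partial_map (free_group X) D \<tau> t =
        partial_map (free_group X) D \<tau> (s \<otimes>\<^bsub>free_group X\<^esub> t))"

definition orthogonal_partial_action ::
    "'g set \<Rightarrow> (('g \<times> bool) list \<Rightarrow> 'a::cstar_algebra set) \<Rightarrow> bool"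
  where "orthogonal_partial_action X D \<longleftrightarrow>
    (\<forall>a\<in>X. \<forall>b\<in>X. a \<noteq> b \<longrightarrow> D (free_generator a) \<inter> D (free_generator b) = {0})"

section \<open>Star-algebras with explicit carrier and their C*-completions\<close>

text \<open>The carriers of the algebras below depend on parameters such as a partial action, so they
  are given by records instead of types.\<close>

record 'x star_alg = "'x partial_object" +
  szero :: 'x
  sadd :: "'x \<Rightarrow> 'x \<Rightarrow> 'x"
  sscale :: "complex \<Rightarrow> 'x \<Rightarrow> 'x"
  smult :: "'x \<Rightarrow> 'x \<Rightarrow> 'x"
  sadj :: "'x \<Rightarrow> 'x"

record 'x normed_star_alg = "'x star_alg" +
  snorm :: "'x \<Rightarrow> real"

definition sdiff :: "('x, 'm) star_alg_scheme \<Rightarrow> 'x \<Rightarrow> 'x \<Rightarrow> 'x"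
  where "sdiff S x y = sadd S x (sscale S (-1) y)"

text \<open>A \<open>*\<close>-isomorphism of C*-algebras is automatically isometric; the last clause records it.\<close>

definition cstar_isomorphic ::
    "('x, 'm) normed_star_alg_scheme \<Rightarrow> ('y, 'n) normed_star_alg_scheme \<Rightarrow> bool"
  where "cstar_isomorphic S T \<longleftrightarrow> (\<exists>\<phi>. bij_betw \<phi> (carrier S) (carrier T) \<and>
    (\<forall>x\<in>carrier S. \<forall>y\<in>carrier S.
      \<phi> (sadd S x y) = sadd T (\<phi> x) (\<phi> y) \<and> \<phi> (smult S x y) = smult T (\<phi> x) (\<phi> y)) \<and>
    (\<forall>x\<in>carrier S. \<forall>c. \<phi> (sscale S c x) = sscale T c (\<phi> x)) \<and>
    (\<forall>x\<in>carrier S. \<phi> (sadj S x) = sadj T (\<phi> x)) \<and>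
    (\<forall>x\<in>carrier S. snorm T (\<phi> x) = snorm S x))"

definition cstar_seminorm :: "('x, 'm) star_alg_scheme \<Rightarrow> ('x \<Rightarrow> real) \<Rightarrow> bool"
  where "cstar_seminorm S p \<longleftrightarrow>
    (\<forall>x\<in>carrier S. 0 \<le> p x) \<and>
    (\<forall>x\<in>carrier S. \<forall>y\<in>carrier S. p (sadd S x y) \<le> p x + p y) \<and>
    (\<forall>x\<in>carrier S. \<forall>c. p (sscale S c x) = cmod c * p x) \<and>
    (\<forall>x\<in>carrier S. \<forall>y\<in>carrier S. p (smult S x y) \<le> p x * p y) \<and>
    (\<forall>x\<in>carrier S. p (sadj S x) = p x) \<and>
    (\<forall>x\<in>carrier S. p (smult S (sadj S x) x) = (p x)\<^sup>2)"

text \<open>The Hausdorff completion of \<open>S\<close> for a seminorm \<open>N\<close>: Cauchy sequences in \<open>S\<close> modulo null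
  sequences.\<close>

definition cauchy_seqs :: "('x, 'm) star_alg_scheme \<Rightarrow> ('x \<Rightarrow> real) \<Rightarrow> (nat \<Rightarrow> 'x) set"
  where "cauchy_seqs S N = {u. (\<forall>n. u n \<in> carrier S) \<and>
    (\<forall>\<epsilon>>0. \<exists>M. \<forall>m\<ge>M. \<forall>n\<ge>M. N (sdiff S (u m) (u n)) < \<epsilon>)}"

definition cauchy_class ::
    "('x, 'm) star_alg_scheme \<Rightarrow> ('x \<Rightarrow> real) \<Rightarrow> (nat \<Rightarrow> 'x) \<Rightarrow> (nat \<Rightarrow> 'x) set"
  where "cauchy_class S N u =
    {v \<in> cauchy_seqs S N. (\<lambda>n. N (sdiff S (u n) (v n))) \<longlonglongrightarrow> 0}"

definition hausdorff_completion ::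
    "('x, 'm) star_alg_scheme \<Rightarrow> ('x \<Rightarrow> real) \<Rightarrow> (nat \<Rightarrow> 'x) set normed_star_alg"
  where "hausdorff_completion S N =
    \<lparr>carrier = cauchy_class S N ` cauchy_seqs S N,
     szero = cauchy_class S N (\<lambda>_. szero S),
     sadd = (\<lambda>U V. \<Union>u\<in>U. \<Union>v\<in>V. cauchy_class S N (\<lambda>n. sadd S (u n) (v n))),
     sscale = (\<lambda>c U. \<Union>u\<in>U. cauchy_class S N (\<lambda>n. sscale S c (u n))),
     smult = (\<lambda>U V. \<Union>u\<in>U. \<Union>v\<in>V. cauchy_class S N (\<lambda>n. smult S (u n) (v n))),
     sadj = (\<lambda>U. \<Union>u\<in>U. cauchy_class S N (\<lambda>n. sadj S (u n))),
     snorm = (\<lambda>U. the_elem ((\<lambda>u. lim (\<lambda>n. N (u n))) ` U))\<rparr>"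

text \<open>The C*-algebra universal for the \<open>*\<close>-algebra \<open>S\<close> subject to the equations \<open>l = r\<close> for
  \<open>(l, r) \<in> R\<close>: the completion of \<open>S\<close> in the largest C*-seminorm compatible with these equations.
  The C*-seminorms on \<open>S\<close> are the functions \<open>x \<mapsto> \<parallel>\<pi> x\<parallel>\<close> for \<open>*\<close>-homomorphisms \<open>\<pi>\<close> from \<open>S\<close> to
  C*-algebras, so the supremum is the usual one over all representations.  The set of seminorms
  contains the zero seminorm; that the supremum is finite depends on \<open>S\<close> and \<open>R\<close>
  and holds in the two applications below, where each C*-seminorm is bounded
  by \<open>\<Sum>t. norm (f t)\<close>, respectively by 1 on each generator.\<close>

definition maximal_cstar_seminorm ::
    "('x, 'm) star_alg_scheme \<Rightarrow> ('x \<times> 'x) set \<Rightarrow> 'x \<Rightarrow> real"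
  where "maximal_cstar_seminorm S R x =
    (SUP p\<in>{p. cstar_seminorm S p \<and> (\<forall>(l, r)\<in>R. p (sdiff S l r) = 0)}. p x)"

definition universal_cstar ::
    "('x, 'm) star_alg_scheme \<Rightarrow> ('x \<times> 'x) set \<Rightarrow> (nat \<Rightarrow> 'x) set normed_star_alg"
  where "universal_cstar S R = hausdorff_completion S (maximal_cstar_seminorm S R)"

section \<open>Partial crossed products\<close>

text \<open>The finite formal sum of the \<open>f t \<delta>\<^sub>t\<close> is represented by the finitely supported function
  \<open>f\<close>.\<close>

definition algebraic_crossed_product ::
    "('t, 'm) monoid_scheme \<Rightarrow> ('t \<Rightarrow> 'a::cstar_algebra set) \<Rightarrow> ('t \<Rightarrow> 'a \<Rightarrow> 'a) \<Rightarrow>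
      ('t \<Rightarrow> 'a) star_alg"
  where "algebraic_crossed_product G D \<tau> =
    \<lparr>carrier = {f. finite {t. f t \<noteq> 0} \<and>
       (\<forall>t\<in>carrier G. f t \<in> D t) \<and> (\<forall>t. t \<notin> carrier G \<longrightarrow> f t = 0)},
     szero = (\<lambda>_. 0),
     sadd = (\<lambda>f g t. f t + g t),
     sscale = (\<lambda>c f t. cscale c (f t)),
     smult = (\<lambda>f g r. \<Sum>(s, t) | f s \<noteq> 0 \<and> g t \<noteq> 0 \<and> s \<otimes>\<^bsub>G\<^esub> t = r.
       \<tau> s (\<tau> (inv\<^bsub>G\<^esub> s) (f s) * g t)),
     sadj = (\<lambda>f t. if t \<in> carrier G then \<tau> t (adj (f (inv\<^bsub>G\<^esub> t))) else 0)\<rparr>"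

definition crossed_product ::
    "('t, 'm) monoid_scheme \<Rightarrow> ('t \<Rightarrow> 'a::cstar_algebra set) \<Rightarrow> ('t \<Rightarrow> 'a \<Rightarrow> 'a) \<Rightarrow>
      (nat \<Rightarrow> 't \<Rightarrow> 'a) set normed_star_alg"
  where "crossed_product G D \<tau> = universal_cstar (algebraic_crossed_product G D \<tau>) {}"

section \<open>Free star-algebras\<close>

text \<open>Noncommutative polynomials without constant term in letters \<open>(x, False)\<close>, standing for the
  generator \<open>x\<close>, and \<open>(x, True)\<close>, standing for its adjoint; a polynomial is given by its
  coefficient function on words.  Here \<^const>\<open>inv_letter\<close> exchanges a generator and its adjoint.\<close>

type_synonym 'x ncpoly = "('x \<times> bool) list \<Rightarrow> complex"

definition nc_letter :: "'x \<Rightarrow> 'x ncpoly"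
  where "nc_letter x = (\<lambda>w. if w = [(x, False)] then 1 else 0)"

definition nc_mult :: "'x ncpoly \<Rightarrow> 'x ncpoly \<Rightarrow> 'x ncpoly"  (infixl "\<odot>" 70)
  where "f \<odot> g = (\<lambda>w. \<Sum>i\<le>length w. f (take i w) * g (drop i w))"

definition nc_adj :: "'x ncpoly \<Rightarrow> 'x ncpoly"
  where "nc_adj f = (\<lambda>w. cnj (f (rev (map inv_letter w))))"

definition free_star_algebra :: "'x set \<Rightarrow> 'x ncpoly star_alg"
  where "free_star_algebra X =
    \<lparr>carrier = {f. finite {w. f w \<noteq> 0} \<and> (\<forall>w. f w \<noteq> 0 \<longrightarrow> w \<noteq> [] \<and> fst ` set w \<subseteq> X)},
     szero = (\<lambda>_. 0),
     sadd = (\<lambda>f g w. f w + g w),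
     sscale = (\<lambda>c f w. c * f w),
     smult = (\<odot>),
     sadj = nc_adj\<rparr>"

section \<open>Boolean dynamical systems\<close>

record 'b boolean_ops = "'b partial_object" +
  bempty :: 'b  (\<open>\<emptyset>\<index>\<close>)
  bcap :: "'b \<Rightarrow> 'b \<Rightarrow> 'b"  (infixl \<open>\<curlywedge>\<index>\<close> 70)
  bcup :: "'b \<Rightarrow> 'b \<Rightarrow> 'b"  (infixl \<open>\<curlyvee>\<index>\<close> 65)
  bminus :: "'b \<Rightarrow> 'b \<Rightarrow> 'b"  (infixl \<open>\<setminus>\<index>\<close> 65)

locale gen_boolean_algebra =
  fixes \<B> :: "('b, 'm) boolean_ops_scheme" (structure)
  assumes empty_closed: "\<emptyset> \<in> carrier \<B>"
    and ops_closed: "A \<in> carrier \<B> \<Longrightarrow> B \<in> carrier \<B> \<Longrightarrow>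
      A \<curlywedge> B \<in> carrier \<B> \<and> A \<curlyvee> B \<in> carrier \<B> \<and> A \<setminus> B \<in> carrier \<B>"
    and commute: "A \<in> carrier \<B> \<Longrightarrow> B \<in> carrier \<B> \<Longrightarrow> A \<curlywedge> B = B \<curlywedge> A \<and> A \<curlyvee> B = B \<curlyvee> A"
    and assoc: "A \<in> carrier \<B> \<Longrightarrow> B \<in> carrier \<B> \<Longrightarrow> C \<in> carrier \<B> \<Longrightarrow>
      (A \<curlywedge> B) \<curlywedge> C = A \<curlywedge> (B \<curlywedge> C) \<and> (A \<curlyvee> B) \<curlyvee> C = A \<curlyvee> (B \<curlyvee> C)"
    and absorb: "A \<in> carrier \<B> \<Longrightarrow> B \<in> carrier \<B> \<Longrightarrow> A \<curlywedge> (A \<curlyvee> B) = A \<and> A \<curlyvee> (A \<curlywedge> B) = A"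
    and distrib: "A \<in> carrier \<B> \<Longrightarrow> B \<in> carrier \<B> \<Longrightarrow> C \<in> carrier \<B> \<Longrightarrow>
      A \<curlywedge> (B \<curlyvee> C) = (A \<curlywedge> B) \<curlyvee> (A \<curlywedge> C)"
    and cap_empty: "A \<in> carrier \<B> \<Longrightarrow> A \<curlywedge> \<emptyset> = \<emptyset>"
    and cap_cup_minus: "A \<in> carrier \<B> \<Longrightarrow> B \<in> carrier \<B> \<Longrightarrow> (A \<curlywedge> B) \<curlyvee> (A \<setminus> B) = A"
    and cap_cap_minus: "A \<in> carrier \<B> \<Longrightarrow> B \<in> carrier \<B> \<Longrightarrow> (A \<curlywedge> B) \<curlywedge> (A \<setminus> B) = \<emptyset>"

locale boolean_dynamical_system = gen_boolean_algebra \<B>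
  for \<B> :: "('b, 'm) boolean_ops_scheme" (structure) +
  fixes L :: "'l set"
    and \<theta> :: "'l \<Rightarrow> 'b \<Rightarrow> 'b"
  assumes \<theta>_closed: "\<alpha> \<in> L \<Longrightarrow> A \<in> carrier \<B> \<Longrightarrow> \<theta> \<alpha> A \<in> carrier \<B>"
    and \<theta>_empty: "\<alpha> \<in> L \<Longrightarrow> \<theta> \<alpha> \<emptyset> = \<emptyset>"
    and \<theta>_ops: "\<alpha> \<in> L \<Longrightarrow> A \<in> carrier \<B> \<Longrightarrow> B \<in> carrier \<B> \<Longrightarrow>
      \<theta> \<alpha> (A \<curlywedge> B) = \<theta> \<alpha> A \<curlywedge> \<theta> \<alpha> B \<and>
      \<theta> \<alpha> (A \<curlyvee> B) = \<theta> \<alpha> A \<curlyvee> \<theta> \<alpha> B \<and>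
      \<theta> \<alpha> (A \<setminus> B) = \<theta> \<alpha> A \<setminus> \<theta> \<alpha> B"

definition bsubset :: "('b, 'm) boolean_ops_scheme \<Rightarrow> 'b \<Rightarrow> 'b \<Rightarrow> bool"
  where "bsubset \<B> A B \<longleftrightarrow> A \<curlywedge>\<^bsub>\<B>\<^esub> B = A"

definition bds_range :: "('b, 'm) boolean_ops_scheme \<Rightarrow> ('l \<Rightarrow> 'b \<Rightarrow> 'b) \<Rightarrow> 'l \<Rightarrow> 'b set"
  where "bds_range \<B> \<theta> \<alpha> = {A \<in> carrier \<B>. \<exists>B\<in>carrier \<B>. bsubset \<B> A (\<theta> \<alpha> B)}"

definition bds_labels ::
    "('b, 'm) boolean_ops_scheme \<Rightarrow> 'l set \<Rightarrow> ('l \<Rightarrow> 'b \<Rightarrow> 'b) \<Rightarrow> 'b \<Rightarrow> 'l set"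
  where "bds_labels \<B> L \<theta> A = {\<alpha> \<in> L. \<theta> \<alpha> A \<noteq> \<emptyset>\<^bsub>\<B>\<^esub>}"

definition bds_regular ::
    "('b, 'm) boolean_ops_scheme \<Rightarrow> 'l set \<Rightarrow> ('l \<Rightarrow> 'b \<Rightarrow> 'b) \<Rightarrow> 'b set"
  where "bds_regular \<B> L \<theta> = {A \<in> carrier \<B>.
    \<forall>B\<in>carrier \<B>. B \<noteq> \<emptyset>\<^bsub>\<B>\<^esub> \<and> bsubset \<B> B A \<longrightarrow>
      finite (bds_labels \<B> L \<theta> B) \<and> bds_labels \<B> L \<theta> B \<noteq> {}}"

datatype ('l, 'b) bds_gen = Proj 'b | Isom 'l 'b

definition bds_gens ::
    "('b, 'm) boolean_ops_scheme \<Rightarrow> 'l set \<Rightarrow> ('l \<Rightarrow> 'b \<Rightarrow> 'b) \<Rightarrow> ('l, 'b) bds_gen set"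
  where "bds_gens \<B> L \<theta> =
    Proj ` carrier \<B> \<union> {Isom \<alpha> B |\<alpha> B. \<alpha> \<in> L \<and> B \<in> bds_range \<B> \<theta> \<alpha>}"

definition bds_relations ::
    "('b, 'm) boolean_ops_scheme \<Rightarrow> 'l set \<Rightarrow> ('l \<Rightarrow> 'b \<Rightarrow> 'b) \<Rightarrow>
      (('l, 'b) bds_gen ncpoly \<times> ('l, 'b) bds_gen ncpoly) set"
  where "bds_relations \<B> L \<theta> =
    (let p = (\<lambda>A. nc_letter (Proj A)); s = (\<lambda>\<alpha> B. nc_letter (Isom \<alpha> B)); E = carrier \<B>;
         Ran = bds_range \<B> \<theta>
     in \<comment> \<open>each \<open>p A\<close> is a projection and each \<open>s \<alpha> B\<close> is a partial isometry\<close>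
        {(p A \<odot> p A, p A) |A. A \<in> E} \<union>
        {(nc_adj (p A), p A) |A. A \<in> E} \<union>
        {(s \<alpha> B \<odot> nc_adj (s \<alpha> B) \<odot> s \<alpha> B, s \<alpha> B) |\<alpha> B. \<alpha> \<in> L \<and> B \<in> Ran \<alpha>} \<union>
        {(p \<emptyset>\<^bsub>\<B>\<^esub>, \<lambda>_. 0)} \<union>
        {(p (A \<curlywedge>\<^bsub>\<B>\<^esub> A'), p A \<odot> p A') |A A'. A \<in> E \<and> A' \<in> E} \<union>
        {(p (A \<curlyvee>\<^bsub>\<B>\<^esub> A'), \<lambda>w. p A w + p A' w - p (A \<curlywedge>\<^bsub>\<B>\<^esub> A') w) |A A'. A \<in> E \<and> A' \<in> E} \<union>
        {(p A \<odot> s \<alpha> B, s \<alpha> B \<odot> p (\<theta> \<alpha> A)) |A \<alpha> B. A \<in> E \<and> \<alpha> \<in> L \<and> B \<in> Ran \<alpha>} \<union>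
        {(nc_adj (s \<alpha> B) \<odot> s \<alpha>' B', if \<alpha> = \<alpha>' then p (B \<curlywedge>\<^bsub>\<B>\<^esub> B') else (\<lambda>_. 0)) |\<alpha> B \<alpha>' B'.
          \<alpha> \<in> L \<and> B \<in> Ran \<alpha> \<and> \<alpha>' \<in> L \<and> B' \<in> Ran \<alpha>'} \<union>
        {(p A, \<lambda>w. \<Sum>\<alpha>\<in>bds_labels \<B> L \<theta> A. (s \<alpha> (\<theta> \<alpha> A) \<odot> nc_adj (s \<alpha> (\<theta> \<alpha> A))) w) |A.
          A \<in> bds_regular \<B> L \<theta>})"

definition bds_cstar ::
    "('b, 'm) boolean_ops_scheme \<Rightarrow> 'l set \<Rightarrow> ('l \<Rightarrow> 'b \<Rightarrow> 'b) \<Rightarrow>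
      (nat \<Rightarrow> ('l, 'b) bds_gen ncpoly) set normed_star_alg"
  where "bds_cstar \<B> L \<theta> =
    universal_cstar (free_star_algebra (bds_gens \<B> L \<theta>)) (bds_relations \<B> L \<theta>)"

end

theory Submission
  imports Defs
begin

text \<open>Take the Boolean algebra of projections of the algebra and \<open>\<theta>\<^sub>\<alpha> = \<tau>\<^sub>\<alpha>\<inverse> \<circ> (projection onto D\<^sub>\<alpha>)\<close>.
  Sending \<open>p\<^sub>A\<close> to \<open>A \<delta>\<^sub>1\<close> and \<open>s\<^sub>\<alpha>\<^sub>,\<^sub>B\<close> to \<open>\<tau>\<^sub>\<alpha>(B) \<delta>\<^sub>\<alpha>\<close> defines a \<open>*\<close>-homomorphism \<open>\<Phi>\<close> from the free
  \<open>*\<close>-algebra to the algebraic crossed product that respects the relations and has dense image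
  for the norm \<open>\<parallel>\<Sum>\<^sub>t a\<^sub>t \<delta>\<^sub>t\<parallel>\<^sub>1 = \<Sum>\<^sub>t \<parallel>a\<^sub>t\<parallel>\<close>.  It therefore suffices that the maximal seminorms correspond
  under \<open>\<Phi>\<close>.  Composition with \<open>\<Phi>\<close> turns C*-seminorms on the crossed product into C*-seminorms
  compatible with the relations.  Conversely, modulo the kernel of such a compatible seminorm \<open>p\<close> the
  relations reduce every word to a normal form that depends only on its image \<open>q \<delta>\<^sub>t\<close> under \<open>\<Phi>\<close>.
  By the C*-identity a combination of normal forms with the same \<open>t\<close> has the same \<open>p\<close>-value as the
  combination of the projections \<open>p\<^sub>q\<close>, whose \<open>p\<close>-value is at most its norm.
  Hence \<open>p(f) \<le> \<parallel>\<Phi>(f)\<parallel>\<^sub>1\<close>, and \<open>p\<close> extends by continuity to a C*-seminorm on the crossed product.\<close>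

section \<open>Commutative C*-algebras generated by projections\<close>

text \<open>The obstacle is relation (iv): it is available for regular sets only, whereas cancelling
  a generator against its inverse requires \<open>s s*\<close> to be some \<open>p\<close>.
  Orthogonality resolves this. A nonzero projection in D_\<alpha> has \<alpha> as its only label,
  and so have its nonzero subprojections; hence it is regular and (iv) collapses to one summand.
  Semi-saturation enters as the inclusion of D_{at} in D_a for a reduced word \<open>a # t\<close>:
  it lets a monomial with projection coefficient be factored letter by letter. The complements
  C_\<alpha> make the projection onto D_\<alpha> multiplicative on the whole algebra, so that
  \<theta>_\<alpha> is defined on every projection. The identity s_{\<alpha>,B} p_C =
  s_{\<alpha>,B\<inter>C} is not among the relations; it is recovered from the C*-identity. On the
  analytic side, writing a contraction as an average of two unitaries stands in for spectral theory,
  both for the contractivity of C*-seminorms and for the bound on combinations of orthogonal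
  projections.\<close>

lemma cscale_zero_left [simp]: "cscale 0 x = 0"
  using cscale_of_real[of 0 x] by simp

lemma cscale_one [simp]: "cscale 1 x = x"
  using cscale_of_real[of 1 x] by simp

lemma cscale_zero_right [simp]: "cscale c 0 = 0"
  using cscale_add_right[of c 0 0] by simp

lemma cscale_minus_left [simp]: "cscale (- c) x = - cscale c x"
  using cscale_add_left[of c "- c" x] by (simp add: eq_neg_iff_add_eq_0 add.commute)

lemma cscale_minus_right [simp]: "cscale c (- x) = - cscale c x"
  using cscale_add_right[of c x "- x"] by (simp add: eq_neg_iff_add_eq_0 add.commute)

lemma cscale_diff_right: "cscale c (x - y) = cscale c x - cscale c y"
  using cscale_add_right[of c x "- y"] by simp

lemma cscale_sum_right: "cscale c (sum f A) = (\<Sum>i\<in>A. cscale c (f i))"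
  by (induction A rule: infinite_finite_induct) (simp_all add: cscale_add_right)

lemma cscale_sum_left: "cscale (sum f A) x = (\<Sum>i\<in>A. cscale (f i) x)"
  by (induction A rule: infinite_finite_induct) (simp_all add: cscale_add_left)

lemma adj_zero [simp]: "adj 0 = 0"
  using adj_cscale[of 0 0] by simp

lemma adj_minus [simp]: "adj (- x) = - adj x"
  using adj_add[of x "- x"] by (simp add: eq_neg_iff_add_eq_0 add.commute)

lemma adj_diff: "adj (x - y) = adj x - adj y"
  using adj_add[of x "- y"] by simp

lemma adj_sum: "adj (sum f A) = (\<Sum>i\<in>A. adj (f i))"
  by (induction A rule: infinite_finite_induct) (simp_all add: adj_add)

text \<open>The C*-identity and submultiplicativity bound the square of \<open>norm y\<close> by
  \<open>norm (adj y) * norm y\<close>. Cancelling, for \<open>x\<close> and for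
  \<open>adj x\<close>, gives both inequalities.\<close>

lemma norm_adj [simp]: "norm (adj x) = norm x"
proof -
  have le: "norm y \<le> norm (adj y)" for y :: 'a
  proof (cases "y = 0")
    case False
    have "norm y * norm y \<le> norm (adj y) * norm y"
      using norm_mult_ineq[of "adj y" y] by (simp add: norm_adj_mult power2_eq_square)
    with False show ?thesis by simp
  qed simp
  from le[of x] le[of "adj x"] show ?thesis by (simp add: adj_adj)
qed

lemma bounded_linear_cscale: "bounded_linear (cscale c)"
  by (rule bounded_linear_intro[of _ "cmod c"])
    (simp_all add: cscale_add_right norm_cscale cscale_cscale mult.commute flip: cscale_of_real)

lemma adj_scaleR: "adj (r *\<^sub>R x) = r *\<^sub>R adj x"
  using adj_cscale[of "complex_of_real r" x] by (simp add: cscale_of_real)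

lemma bounded_linear_adj: "bounded_linear adj"
  by (rule bounded_linear_intro[of _ 1]) (simp_all add: adj_add adj_scaleR)

lemma cstar_idealD:
  assumes "cstar_ideal I"
  shows "closed I" "0 \<in> I" "x \<in> I \<Longrightarrow> y \<in> I \<Longrightarrow> x + y \<in> I" "x \<in> I \<Longrightarrow> cscale c x \<in> I"
    "x \<in> I \<Longrightarrow> a * x \<in> I" "x \<in> I \<Longrightarrow> x * a \<in> I" "x \<in> I \<Longrightarrow> - x \<in> I"
    "x \<in> I \<Longrightarrow> y \<in> I \<Longrightarrow> x - y \<in> I" "x \<in> I \<Longrightarrow> r *\<^sub>R x \<in> I"
proof -
  show *: "closed I" "0 \<in> I" "x \<in> I \<Longrightarrow> y \<in> I \<Longrightarrow> x + y \<in> I" "x \<in> I \<Longrightarrow> cscale c x \<in> I"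
    "x \<in> I \<Longrightarrow> a * x \<in> I" "x \<in> I \<Longrightarrow> x * a \<in> I" for x y c a
    using assms by (auto simp: cstar_ideal_def)
  show m: "x \<in> I \<Longrightarrow> - x \<in> I" for x
    using *(4)[of x "- 1"] by simp
  show "x \<in> I \<Longrightarrow> y \<in> I \<Longrightarrow> x - y \<in> I"
    using *(3)[of x "- y"] m by simp
  show "x \<in> I \<Longrightarrow> r *\<^sub>R x \<in> I"
    using *(4)[of x "complex_of_real r"] by (simp add: cscale_of_real)
qed

lemma cstar_ideal_sum: "cstar_ideal I \<Longrightarrow> (\<And>i. i \<in> A \<Longrightarrow> f i \<in> I) \<Longrightarrow> sum f A \<in> I"
  by (induction A rule: infinite_finite_induct) (simp_all add: cstar_idealD)

lemma cstar_ideal_UNIV: "cstar_ideal UNIV"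
  by (simp add: cstar_ideal_def)

text \<open>For selfadjoint \<open>h\<close> with \<open>\<parallel>h\<parallel> < 1\<close> put \<open>k = 1 - (1 - h\<^sup>2)\<^sup>1\<^sup>/\<^sup>2\<close>, the solution of
  \<open>2k = h\<^sup>2 + k\<^sup>2\<close>.  Then \<open>h \<plusminus> \<i>(1 - k)\<close> are unitaries in the unitization, so multiplication by
  them preserves \<open>q\<close>, and multiplication by their average \<open>h\<close> does not increase \<open>q\<close>.\<close>

lemma cstar_seminorm_le_norm:
  fixes q :: "'a::{cstar_algebra, comm_ring} \<Rightarrow> real"
  assumes I: "cstar_ideal I"
    and nonneg: "\<And>x. x \<in> I \<Longrightarrow> 0 \<le> q x"
    and add: "\<And>x y. x \<in> I \<Longrightarrow> y \<in> I \<Longrightarrow> q (x + y) \<le> q x + q y"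
    and scale: "\<And>x c. x \<in> I \<Longrightarrow> q (cscale c x) = cmod c * q x"
    and cstar: "\<And>x. x \<in> I \<Longrightarrow> q (adj x * x) = (q x)\<^sup>2"
    and x: "x \<in> I"
  shows "q x \<le> norm x"
proof -
  note I' = cstar_idealD[OF I]
  have small: "q h \<le> 1" if h: "h \<in> I" "adj h = h" "norm h < 1" for h
  proof -
    define r where "r = norm h"
    \<comment> \<open>Fixed points of \<open>f\<close> are the solutions \<open>k\<close>. On the
      ball of radius \<open>r\<close> the map contracts by the factor \<open>r\<close>, because
      \<open>f a - f b\<close> is half of \<open>(a - b) * (a + b)\<close>; the selfadjoint part of
      \<open>I\<close> in this ball is complete and invariant, so \<open>k\<close> is found inside
      \<open>I\<close>.\<close>
    define S where "S = I \<inter> {k. adj k = k} \<inter> cball 0 r"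
    define f where "f k = (1/2) *\<^sub>R (h * h + k * k)" for k
    have r: "0 \<le> r" "r < 1" using h by (auto simp: r_def)
    have "closed {k::'a. adj k = k}"
      by (intro closed_Collect_eq linear_continuous_on bounded_linear_adj continuous_on_id)
    then have "complete S"
      unfolding S_def complete_eq_closed by (intro closed_Int I'(1) closed_cball)
    moreover have "0 \<in> S" using r by (simp add: S_def I')
    moreover have "f ` S \<subseteq> S"
    proof clarify
      fix k assume k: "k \<in> S"
      have "norm (f k) \<le> (1/2) * (norm h * norm h + norm k * norm k)"
        unfolding f_def by (simp add: norm_triangle_le add_mono norm_mult_ineq)
      also have "\<dots> \<le> (1/2) * (r * 1 + r * 1)"
        using k r by (intro mult_left_mono add_mono mult_mono) (auto simp: S_def r_def)
      finally have "norm (f k) \<le> r" by simp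
      moreover have "adj (f k) = f k"
        using k h by (simp add: f_def S_def adj_scaleR adj_add adj_mult)
      ultimately show "f k \<in> S"
        using k h I' by (simp add: S_def f_def)
    qed
    moreover have "dist (f a) (f b) \<le> r * dist a b" if "a \<in> S" "b \<in> S" for a b
    proof -
      have "f a - f b = (1/2) *\<^sub>R ((a - b) * (a + b))"
        by (simp add: f_def algebra_simps flip: scaleR_diff_right)
      then have "norm (f a - f b) \<le> (1/2) * (norm (a - b) * norm (a + b))"
        by (simp add: norm_mult_ineq)
      also have "\<dots> \<le> (1/2) * (norm (a - b) * (r + r))"
        using that by (intro mult_left_mono norm_triangle_le add_mono) (auto simp: S_def)
      finally show ?thesis by (simp add: dist_norm mult.commute)
    qed
    ultimately obtain k where k: "k \<in> S" "f k = k"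
      using Banach_fix[of S r f] r by blast
    from k(2) have "(2::real) *\<^sub>R f k = 2 *\<^sub>R k" by simp
    then have hh: "h * h = k + k - k * k"
      by (simp add: f_def scaleR_2 algebra_simps)
    \<comment> \<open>This is \<open>(h + c (1 - k)) y\<close> written without a unit. For
      \<open>c\<close> equal to \<i> or its negative the cross terms of
      \<open>adj (u c y) * u c y\<close> cancel, and \<open>hh\<close> turns the rest into
      \<open>adj y * y\<close>.\<close>
    define u where "u c y = h * y + cscale c (y - k * y)" for c y
    have u: "u c y \<in> I" "q (u c y) = q y" if y: "y \<in> I" and c: "cnj c = - c" "c * c = -1" for c y
    proof -
      show uI: "u c y \<in> I" using y h I' by (simp add: u_def)
      define Y where "Y = adj y"
      have adju: "adj (u c y) = Y * h - cscale c (Y - Y * k)"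
        using h k c unfolding u_def S_def Y_def by (simp add: adj_add adj_mult adj_cscale adj_diff)
      have "adj (u c y) * u c y = (Y * h) * (h * y)
          + (cscale c (Y * h * (y - k * y)) - cscale c ((Y - Y * k) * (h * y)))
          + (Y - Y * k) * (y - k * y)"
        unfolding adju unfolding u_def using c
        by (simp add: ring_distribs mult_cscale_left mult_cscale_right cscale_cscale cscale_diff_right)
      also have "Y * h * (y - k * y) = (Y - Y * k) * (h * y)"
        by (simp add: algebra_simps)
      also have "(Y * h) * (h * y) = (k + k - k * k) * (Y * y)"
        unfolding hh[symmetric] by (simp add: algebra_simps)
      also have "(k + k - k * k) * (Y * y) + (cscale c ((Y - Y * k) * (h * y)) - cscale c ((Y - Y * k) * (h * y)))
          + (Y - Y * k) * (y - k * y) = Y * y"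
        by (simp add: algebra_simps)
      finally have "(q (u c y))\<^sup>2 = (q y)\<^sup>2"
        using cstar[OF uI] cstar[OF y] by (simp add: Y_def)
      then show "q (u c y) = q y" using nonneg uI y by (simp add: power2_eq_iff_nonneg)
    qed
    \<comment> \<open>The case \<open>y = h\<close>: the two images add up to twice
      \<open>h * h\<close>, so \<open>q (h * h)\<close>, the square of \<open>q h\<close>, is at
      most \<open>q h\<close>.\<close>
    have "u \<i> h + u (- \<i>) h = cscale 2 (h * h)"
      using cscale_of_real[of 2 "h * h"] by (simp add: u_def scaleR_2)
    then have "2 * q (h * h) \<le> q (u \<i> h) + q (u (- \<i>) h)"
      using add[OF u(1)[OF h(1), of \<i>] u(1)[OF h(1), of "- \<i>"]] scale[of "h * h" 2] h I' by simp
    then have "q (h * h) \<le> q h"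
      using u(2)[OF h(1), of \<i>] u(2)[OF h(1), of "- \<i>"] by simp
    then have "q h * q h \<le> q h * 1"
      using cstar[OF h(1)] h(2) by (simp add: power2_eq_square)
    then show ?thesis
      using nonneg[OF h(1)] by (cases "q h = 0") (auto simp: mult_le_cancel_left)
  qed
  have sa: "q h \<le> norm h" if h: "h \<in> I" "adj h = h" for h
  proof (rule dense_ge)
    fix r assume r: "norm h < r"
    then have r0: "0 < r" using norm_ge_zero le_less_trans by blast
    let ?h = "cscale (complex_of_real (1 / r)) h"
    have "q ?h \<le> 1"
      using r r0 h I' by (intro small) (auto simp: adj_cscale norm_cscale norm_divide)
    moreover have "q h = r * q ?h"
      using r0 scale[OF h(1), of "complex_of_real (1 / r)"] by (simp add: norm_divide)
    ultimately show "q h \<le> r"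
      using r0 mult_left_mono[of "q ?h" 1 r] by simp
  qed
  have "(q x)\<^sup>2 \<le> (norm x)\<^sup>2"
    using sa[of "adj x * x"] x I' cstar[OF x] by (simp add: adj_mult adj_adj norm_adj_mult)
  then show ?thesis by (rule power2_le_imp_le) simp
qed


section \<open>Projections and finite orthogonal families\<close>

lemma is_projection_zero [simp]: "is_projection 0"
  by (simp add: is_projection_def)

lemma is_projection_mult:
  fixes p :: "'a::{cstar_algebra, comm_ring}"
  shows "is_projection p \<Longrightarrow> is_projection q \<Longrightarrow> is_projection (p * q)"
  unfolding is_projection_def by (metis adj_mult mult.assoc mult.commute)

lemma projection_simps:
  fixes p :: "'a::{cstar_algebra, comm_ring}"
  assumes "is_projection p"
  shows "p * p = p" "p * (p * x) = p * x" "adj p = p"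
  using assms by (auto simp: is_projection_def simp flip: mult.assoc)

lemma is_projection_diff:
  fixes p :: "'a::{cstar_algebra, comm_ring}"
  assumes "is_projection p" "is_projection q"
  shows "is_projection (p - p * q)"
  by (simp add: is_projection_def adj_diff adj_mult algebra_simps
    projection_simps[OF assms(1)] projection_simps[OF assms(2)])

lemma is_projection_union:
  fixes p :: "'a::{cstar_algebra, comm_ring}"
  assumes "is_projection p" "is_projection q"
  shows "is_projection (p + q - p * q)"
  by (simp add: is_projection_def adj_diff adj_add adj_mult algebra_simps
    projection_simps[OF assms(1)] projection_simps[OF assms(2)])

lemma norm_projection:
  assumes "is_projection p" "p \<noteq> 0"
  shows "norm p = 1"
  using norm_adj_mult[of p] assms by (simp add: is_projection_def power2_eq_square)

text \<open>A set, not an indexed family: zero may belong to it, but only once. Splitting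
  projections creates zeros, which \<open>projections_refine\<close> removes at the end.\<close>

definition orthogonal_projections :: "'a::cstar_algebra set \<Rightarrow> bool"
  where "orthogonal_projections R \<longleftrightarrow> finite R \<and> (\<forall>r\<in>R. is_projection r) \<and>
    (\<forall>r\<in>R. \<forall>s\<in>R. r \<noteq> s \<longrightarrow> r * s = 0)"

lemma orthogonal_projections_subset:
  "orthogonal_projections R \<Longrightarrow> S \<subseteq> R \<Longrightarrow> orthogonal_projections S"
  unfolding orthogonal_projections_def by (meson finite_subset subset_iff)

lemma orthogonal_projections_mult_sum:
  assumes R: "orthogonal_projections R" and r: "r \<in> R"
  shows "r * (\<Sum>s\<in>R. cscale (d s) s) = cscale (d r) r"
proof -
  have "r * (\<Sum>s\<in>R. cscale (d s) s) = (\<Sum>s\<in>R. if s = r then cscale (d r) r else 0)"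
    unfolding sum_distrib_left using R r
    by (intro sum.cong) (auto simp: orthogonal_projections_def mult_cscale_right is_projection_def)
  also have "\<dots> = cscale (d r) r"
    using R r by (simp add: orthogonal_projections_def)
  finally show ?thesis .
qed

text \<open>Products of such combinations are formed coefficientwise. Together with
  \<open>norm_adj_mult\<close> this is the hypothesis \<open>cstar\<close> of
  \<open>cstar_seminorm_le_sup\<close> for the norm.\<close>

lemma orthogonal_projections_adj_mult_sum:
  fixes d :: "'a::cstar_algebra \<Rightarrow> complex"
  assumes R: "orthogonal_projections R"
  defines "x \<equiv> (\<Sum>s\<in>R. cscale (d s) s)"
  shows "adj x * x = (\<Sum>s\<in>R. cscale (complex_of_real ((cmod (d s))\<^sup>2)) s)"
proof -
  have "adj x = (\<Sum>s\<in>R. cscale (cnj (d s)) s)"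
    using R unfolding x_def adj_sum
    by (intro sum.cong) (auto simp: adj_cscale orthogonal_projections_def is_projection_def)
  then have "adj x * x = (\<Sum>s\<in>R. cscale (cnj (d s)) (s * x))"
    by (simp add: sum_distrib_right mult_cscale_left)
  also have "\<dots> = (\<Sum>s\<in>R. cscale (complex_of_real ((cmod (d s))\<^sup>2)) s)"
    unfolding x_def using R
    by (intro sum.cong)
      (simp_all add: orthogonal_projections_mult_sum cscale_cscale complex_norm_square
        mult.commute del: of_real_power)
  finally show ?thesis .
qed

lemma is_projection_sum:
  assumes R: "orthogonal_projections R"
  shows "is_projection (\<Sum>R)"
proof -
  have "adj (\<Sum>R) * \<Sum>R = \<Sum>R"
    using orthogonal_projections_adj_mult_sum[OF R, of "\<lambda>_. 1"] by simp
  moreover have "adj (\<Sum>R) = \<Sum>R"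
    using R unfolding adj_sum
    by (intro sum.cong) (auto simp: orthogonal_projections_def is_projection_def)
  ultimately show ?thesis by (simp add: is_projection_def)
qed

text \<open>A function with values in \<open>[0, 1]\<close> is the average of two unimodular ones.\<close>

lemma cstar_seminorm_le_sup:
  fixes n :: "('i \<Rightarrow> complex) \<Rightarrow> real"
  assumes nonneg: "\<And>c. 0 \<le> n c"
    and add: "\<And>c d. n (\<lambda>r. c r + d r) \<le> n c + n d"
    and scale: "\<And>a c. n (\<lambda>r. a * c r) = cmod a * n c"
    and cstar: "\<And>c. (n c)\<^sup>2 = n (\<lambda>r. complex_of_real ((cmod (c r))\<^sup>2))"
    and one: "n (\<lambda>_. 1) \<le> 1"
    and cong: "\<And>c d. (\<And>r. r \<in> R \<Longrightarrow> c r = d r) \<Longrightarrow> n c = n d"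
    and M: "0 \<le> M" "\<And>r. r \<in> R \<Longrightarrow> cmod (c r) \<le> M"
  shows "n c \<le> M"
proof (cases "M = 0")
  case True
  then have "n c = n (\<lambda>r. 0 * c r)"
    using M by (intro cong) simp
  with scale[of 0 c] True show ?thesis by simp
next
  case False
  with M have M0: "0 < M" by simp
  \<comment> \<open>The square is forced by \<open>cstar\<close>, which replaces \<open>c\<close> by
    the squares of its moduli, that is by M squared times \<open>e\<close>.\<close>
  define e where "e r = (cmod (c r) / M)\<^sup>2" for r
  have e: "0 \<le> e r" "e r \<le> 1" if "r \<in> R" for r
    using M(2)[OF that] M0 by (auto simp: e_def power_le_one)
  \<comment> \<open>\<open>u 1\<close> and \<open>u (-1)\<close> are complex conjugates with real
    part \<open>e\<close> and modulus one on \<open>R\<close>. By \<open>cstar\<close> the square of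
    their \<open>n\<close>-value is the value at the constant 1.\<close>
  define u where "u s r = Complex (e r) (s * sqrt (1 - (e r)\<^sup>2))" for s r
  have u: "n (u s) \<le> 1" if "s * s = 1" for s
  proof -
    have "(cmod (u s r))\<^sup>2 = 1" if "r \<in> R" for r
    proof -
      have "(cmod (u s r))\<^sup>2 = (e r)\<^sup>2 + (s * s) * (sqrt (1 - (e r)\<^sup>2))\<^sup>2"
        unfolding cmod_power2 by (simp add: u_def power2_eq_square algebra_simps)
      moreover have "(e r)\<^sup>2 \<le> 1" using e[OF that] by (simp add: power_le_one)
      ultimately show ?thesis using \<open>s * s = 1\<close> by simp
    qed
    then have "complex_of_real ((cmod (u s r))\<^sup>2) = 1" if "r \<in> R" for r
      using that by simp
    then have "(n (u s))\<^sup>2 \<le> 1\<^sup>2"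
      using cong[of "\<lambda>r. complex_of_real ((cmod (u s r))\<^sup>2)" "\<lambda>_. 1"] one by (simp add: cstar)
    then show ?thesis using power2_le_imp_le[of "n (u s)" 1] by simp
  qed
  have "n (\<lambda>r. 2 * complex_of_real (e r)) = n (\<lambda>r. u 1 r + u (-1) r)"
    by (intro cong) (simp add: u_def complex_eq_iff)
  then have ne: "n (\<lambda>r. complex_of_real (e r)) \<le> 1"
    using add[of "u 1" "u (-1)"] u[of 1] u[of "-1"] scale[of 2 "\<lambda>r. complex_of_real (e r)"] by simp
  have "(n c)\<^sup>2 = n (\<lambda>r. complex_of_real (M\<^sup>2) * complex_of_real (e r))"
    unfolding cstar using M0 by (intro cong) (simp add: e_def power_divide)
  also have "\<dots> = M\<^sup>2 * n (\<lambda>r. complex_of_real (e r))"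
    using scale[of "complex_of_real (M\<^sup>2)"] M0 by (simp add: norm_power)
  also have "\<dots> \<le> M\<^sup>2 * 1"
    using ne by (intro mult_left_mono) auto
  finally show ?thesis using M0 by (intro power2_le_imp_le[of "n c" M]) simp_all
qed

lemma norm_orthogonal_sum_le:
  assumes R: "orthogonal_projections R" and M: "0 \<le> M" "\<And>r. r \<in> R \<Longrightarrow> cmod (d r) \<le> M"
  shows "norm (\<Sum>r\<in>R. cscale (d r) r) \<le> M"
proof (rule cstar_seminorm_le_sup[where n = "\<lambda>d. norm (\<Sum>r\<in>R. cscale (d r) r)" and R = R])
  show "norm (\<Sum>r\<in>R. cscale (c r + d r) r) \<le>
      norm (\<Sum>r\<in>R. cscale (c r) r) + norm (\<Sum>r\<in>R. cscale (d r) r)" for c d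
    by (simp add: cscale_add_left sum.distrib norm_triangle_ineq)
  show "norm (\<Sum>r\<in>R. cscale (a * c r) r) = cmod a * norm (\<Sum>r\<in>R. cscale (c r) r)" for a c
    by (simp add: norm_cscale flip: cscale_cscale cscale_sum_right)
  show "(norm (\<Sum>r\<in>R. cscale (c r) r))\<^sup>2 =
      norm (\<Sum>r\<in>R. cscale (complex_of_real ((cmod (c r))\<^sup>2)) r)" for c
    unfolding orthogonal_projections_adj_mult_sum[OF R, symmetric] norm_adj_mult ..
  show "norm (\<Sum>r\<in>R. cscale 1 r) \<le> 1"
    using norm_projection[OF is_projection_sum[OF R]] by (cases "\<Sum>R = 0") auto
qed (use M in auto)

text \<open>A common refinement is built by inserting one projection \<open>q\<close> at a time:
  each old atom \<open>r\<close> splits into \<open>r * q\<close> and \<open>r - r * q\<close>, and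
  the part \<open>c\<close> of \<open>q\<close> outside the old sum \<open>e\<close> becomes a new
  atom.\<close>

lemma projections_refine_aux:
  fixes Q :: "'a::{cstar_algebra, comm_ring} set"
  assumes "finite Q" "\<And>q. q \<in> Q \<Longrightarrow> is_projection q"
  shows "\<exists>R. orthogonal_projections R \<and>
    (\<forall>q\<in>Q. q * \<Sum>R = q \<and> (\<forall>r\<in>R. r * q = 0 \<or> r * q = r))"
  using assms
proof (induction Q)
  case empty
  show ?case by (intro exI[of _ "{}"]) (simp add: orthogonal_projections_def)
next
  case (insert q Q)
  then obtain R where R: "orthogonal_projections R"
    and RQ: "\<And>p. p \<in> Q \<Longrightarrow> p * \<Sum>R = p" "\<And>p r. p \<in> Q \<Longrightarrow> r \<in> R \<Longrightarrow> r * p = 0 \<or> r * p = r"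
    by auto
  have fin: "finite R" using R by (simp add: orthogonal_projections_def)
  have pR: "is_projection r" if "r \<in> R" for r
    using R that by (simp add: orthogonal_projections_def)
  have oR: "r * s = 0" if "r \<in> R" "s \<in> R" "r \<noteq> s" for r s
    using R that by (simp add: orthogonal_projections_def)
  have q: "is_projection q" using insert by simp
  note qq = projection_simps[OF q]
  define e where "e = \<Sum>R"
  have e: "is_projection e" unfolding e_def by (rule is_projection_sum[OF R])
  have re: "r * e = r" if "r \<in> R" for r
    using orthogonal_projections_mult_sum[OF R that, of "\<lambda>_. 1"] by (simp add: e_def)
  define A B c where "A = (\<lambda>r. r * q) ` R" and "B = (\<lambda>r. r - r * q) ` R" and "c = q - q * e"
  have rs: "r * (s * x) = (if r = s then r * x else 0)" if "r \<in> R" "s \<in> R" for r s x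
    using oR[OF that] projection_simps[OF pR[OF that(1)]] by (auto simp flip: mult.assoc)
  have rs': "r * s = (if r = s then r else 0)" if "r \<in> R" "s \<in> R" for r s
    using oR[OF that] projection_simps[OF pR[OF that(1)]] by auto
  have re': "r * (e * x) = r * x" if "r \<in> R" for r x
    using re[OF that] by (simp flip: mult.assoc)
  have AB: "a * b = 0" if "a \<in> A" "b \<in> B" for a b
    using that rs rs' qq by (auto simp: A_def B_def algebra_simps)
  have AA: "a * b = 0" if "a \<in> A" "b \<in> A" "a \<noteq> b" for a b
    using that rs rs' qq by (auto simp: A_def algebra_simps split: if_splits)
  have BB: "a * b = 0" if "a \<in> B" "b \<in> B" "a \<noteq> b" for a b
    using that rs rs' qq by (auto simp: B_def algebra_simps split: if_splits)
  have cA: "a * c = 0" if "a \<in> A" for a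
  proof -
    from that obtain r where r: "r \<in> R" "a = r * q" by (auto simp: A_def)
    have "a * c = r * q - (r * e) * q" by (simp add: r c_def algebra_simps qq)
    then show ?thesis by (simp add: re r)
  qed
  have cB: "a * c = 0" if "a \<in> B" for a
    using that by (auto simp: B_def c_def algebra_simps qq)
  have sumA: "\<Sum>A = e * q"
  proof -
    \<comment> \<open>\<open>A\<close> is an image set, so equal pieces are counted once. Pieces of
      different atoms are orthogonal and can coincide only if they vanish, so no contribution is
      lost.\<close>
    have "\<Sum>A = (\<Sum>r\<in>R. r * q)" unfolding A_def
    proof (subst sum.reindex_nontrivial[OF fin])
      fix x y assume xy: "x \<in> R" "y \<in> R" "x \<noteq> y" "x * q = y * q"
      have "x * q = x * (x * q)" using projection_simps(2)[OF pR[OF xy(1)]] by simp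
      also have "\<dots> = x * (y * q)" using xy by simp
      also have "\<dots> = 0" using rs xy by simp
      finally show "x * q = 0" .
    qed simp
    then show ?thesis by (simp add: e_def sum_distrib_right)
  qed
  have sumB: "\<Sum>B = e - e * q"
  proof -
    have "\<Sum>B = (\<Sum>r\<in>R. r - r * q)" unfolding B_def
    proof (subst sum.reindex_nontrivial[OF fin])
      fix x y assume xy: "x \<in> R" "y \<in> R" "x \<noteq> y" "x - x * q = y - y * q"
      have "x - x * q = x * (x - x * q)" using projection_simps[OF pR[OF xy(1)]]
        by (simp add: right_diff_distrib)
      also have "\<dots> = x * (y - y * q)" using xy by simp
      also have "\<dots> = 0" using rs rs' xy by (simp add: right_diff_distrib)
      finally show "x - x * q = 0" .
    qed simp
    then show ?thesis by (simp add: e_def sum_distrib_right sum_subtractf)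
  qed
  have finA: "finite A" "finite B" by (simp_all add: A_def B_def fin)
  have pA: "is_projection a" if "a \<in> A \<union> B" for a
    using that pR q by (auto simp: A_def B_def is_projection_mult is_projection_diff)
  have pc: "is_projection c" using q e by (simp add: c_def is_projection_diff)
  have dup: "x = 0" if "x * x = 0" "is_projection x" for x :: 'a
    using that by (simp add: is_projection_def)
  have sumAB: "\<Sum>(A \<union> B) = e"
  proof -
    have "\<forall>x\<in>A \<inter> B. x = 0" using AB dup pA by blast
    then have "\<Sum>(A \<union> B) = \<Sum>A + \<Sum>B" by (rule sum.union_inter_neutral[OF finA])
    then show ?thesis by (simp add: sumA sumB)
  qed
  have sum: "\<Sum>(insert c (A \<union> B)) = e + c"
  proof (cases "c \<in> A \<union> B")
    case True
    then have "c = 0" using cA cB dup pc by blast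
    with True show ?thesis by (simp add: insert_absorb sumAB)
  qed (use finA sumAB in \<open>simp add: add.commute\<close>)
  have orth: "orthogonal_projections (insert c (A \<union> B))"
    unfolding orthogonal_projections_def using finA pA pc AA BB cA cB AB
    by (simp add: ball_Un) (metis mult.commute)
  have "p * \<Sum>(insert c (A \<union> B)) = p \<and>
      (\<forall>r\<in>insert c (A \<union> B). r * p = 0 \<or> r * p = r)" if p: "p \<in> insert q Q" for p
  proof (cases "p = q")
    case True
    have "q * (e + c) = q" by (simp add: c_def algebra_simps qq)
    moreover have "c * q = c" by (simp add: c_def algebra_simps qq)
    then have "r * q = 0 \<or> r * q = r" if "r \<in> insert c (A \<union> B)" for r
      using that by (auto simp: A_def B_def algebra_simps qq)
    ultimately show ?thesis using True sum by simp
  next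
    case False
    with p have p: "p \<in> Q" by simp
    have pe: "p * e = p" using RQ(1)[OF p] by (simp add: e_def)
    have "e * p = p" using pe by (simp add: mult.commute)
    then have epx: "e * (p * x) = p * x" for x by (simp flip: mult.assoc)
    then have cp: "c * p = 0" by (simp add: c_def algebra_simps pe epx)
    have "p * (e + c) = p" using cp pe by (simp add: distrib_left mult.commute)
    moreover have "r * p = 0 \<or> r * p = r" if "r \<in> insert c (A \<union> B)" for r
    proof -
      have eq: "(s * q) * p = (s * p) * q" "(s - s * q) * p = s * p - (s * p) * q" for s
        by (simp_all add: algebra_simps)
      have "(s * q) * p = 0 \<or> (s * q) * p = s * q"
        "(s - s * q) * p = 0 \<or> (s - s * q) * p = s - s * q" if "s \<in> R" for s
        unfolding eq using RQ(2)[OF p that] by auto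
      then show ?thesis using that cp by (auto simp: A_def B_def)
    qed
    ultimately show ?thesis using sum by simp
  qed
  with orth show ?case by blast
qed

text \<open>\<open>r * q = r\<close> says that the atom \<open>r\<close> lies below
  \<open>q\<close>. Expanding \<open>q\<close> times the sum of all atoms and dropping vanishing
  products leaves the atoms below \<open>q\<close>. Zero is discarded so that every atom has norm
  one.\<close>

lemma projections_refine:
  fixes Q :: "'a::{cstar_algebra, comm_ring} set"
  assumes "finite Q" "\<And>q. q \<in> Q \<Longrightarrow> is_projection q"
  obtains R where "orthogonal_projections R" "0 \<notin> R" "\<And>q. q \<in> Q \<Longrightarrow> q = \<Sum>{r \<in> R. r * q = r}"
proof -
  obtain R where R: "orthogonal_projections R"
    and RQ: "\<And>p. p \<in> Q \<Longrightarrow> p * \<Sum>R = p" "\<And>p r. p \<in> Q \<Longrightarrow> r \<in> R \<Longrightarrow> r * p = 0 \<or> r * p = r"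
    using projections_refine_aux[of Q] assms by auto
  have fin: "finite R" using R by (simp add: orthogonal_projections_def)
  show thesis
  proof (rule that[of "R - {0}"])
    show "orthogonal_projections (R - {0})"
      using orthogonal_projections_subset[OF R] by blast
    fix q assume q: "q \<in> Q"
    have "q = (\<Sum>r\<in>R. r * q)"
      using RQ(1)[OF q] by (simp add: mult.commute flip: sum_distrib_right)
    also have "\<dots> = (\<Sum>r\<in>{r \<in> R - {0}. r * q = r}. r)"
      using fin RQ(2)[OF q] by (intro sum.mono_neutral_cong_right) auto
    finally show "q = \<Sum>{r \<in> R - {0}. r * q = r}" by simp
  qed simp
qed

text \<open>Both sums run over the incidences of an atom lying below some \<open>q i\<close>. The
  index \<open>i\<close> allows a projection to occur repeatedly, as it does when several words have
  the same image.\<close>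

lemma sum_cscale_refine:
  assumes "finite I" "finite R" and q: "\<And>i. i \<in> I \<Longrightarrow> q i = \<Sum>{r \<in> R. r * q i = r}"
  shows "(\<Sum>i\<in>I. cscale (c i) (q i)) = (\<Sum>r\<in>R. cscale (\<Sum>i | i \<in> I \<and> r * q i = r. c i) r)"
proof -
  have "cscale (c i) (q i) = (\<Sum>r | r \<in> R \<and> r * q i = r. cscale (c i) r)" if "i \<in> I" for i
    using arg_cong[OF q[OF that], of "cscale (c i)"] by (simp only: cscale_sum_right)
  then have "(\<Sum>i\<in>I. cscale (c i) (q i)) = (\<Sum>i\<in>I. \<Sum>r | r \<in> R \<and> r * q i = r. cscale (c i) r)"
    by (rule sum.cong[OF refl])
  also have "\<dots> = (\<Sum>r\<in>R. \<Sum>i | i \<in> I \<and> r * q i = r. cscale (c i) r)"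
    using assms(1,2) by (rule sum.swap_restrict)
  finally show ?thesis by (simp add: cscale_sum_left)
qed

section \<open>Linear combinations of the projections of an ideal\<close>

inductive_set proj_span :: "'a::cstar_algebra set \<Rightarrow> 'a set" for I
  where zero: "0 \<in> proj_span I"
  | step: "x \<in> proj_span I \<Longrightarrow> is_projection p \<Longrightarrow> p \<in> I \<Longrightarrow> cscale c p + x \<in> proj_span I"

lemma proj_span_sumD:
  assumes "x \<in> proj_span I"
  shows "\<exists>Q c. finite Q \<and> Q \<subseteq> {p \<in> I. is_projection p} \<and> x = (\<Sum>q\<in>Q. cscale (c q) q)"
  using assms
proof induction
  case zero
  show ?case by (intro exI[of _ "{}"]) simp
next
  case (step x p a)
  then obtain Q c where Q: "finite Q" "Q \<subseteq> {p \<in> I. is_projection p}"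
    "x = (\<Sum>q\<in>Q. cscale (c q) q)" by blast
  \<comment> \<open>\<open>Q\<close> is a set, so if \<open>p\<close> already occurs the new
    coefficient is added to the old one.\<close>
  define d where "d = c(p := a + (if p \<in> Q then c p else 0))"
  have "(\<Sum>q\<in>insert p Q. cscale (d q) q) = cscale (d p) p + (\<Sum>q\<in>Q - {p}. cscale (d q) q)"
    using Q(1) by (rule sum.insert_remove)
  also have "(\<Sum>q\<in>Q - {p}. cscale (d q) q) = (\<Sum>q\<in>Q - {p}. cscale (c q) q)"
    by (intro sum.cong) (simp_all add: d_def)
  also have "cscale (d p) p + \<dots> = cscale a p + x"
    using Q by (simp add: d_def cscale_add_left sum_diff1)
  finally show ?case
    using Q step by (intro exI[of _ "insert p Q"] exI[of _ d]) auto
qed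

lemma proj_span_sumI:
  "(\<And>i. i \<in> A \<Longrightarrow> is_projection (q i) \<and> q i \<in> I) \<Longrightarrow> (\<Sum>i\<in>A. cscale (c i) (q i)) \<in> proj_span I"
  by (induction A rule: infinite_finite_induct) (simp_all add: proj_span.intros)

lemma proj_span_add: "x \<in> proj_span I \<Longrightarrow> y \<in> proj_span I \<Longrightarrow> x + y \<in> proj_span I"
  by (induction rule: proj_span.induct) (simp_all add: proj_span.step add.assoc)

lemma proj_span_cscale: "x \<in> proj_span I \<Longrightarrow> cscale a x \<in> proj_span I"
  by (induction rule: proj_span.induct)
    (simp_all add: proj_span.intros cscale_add_right cscale_cscale)

lemma proj_span_adj: "x \<in> proj_span I \<Longrightarrow> adj x \<in> proj_span I"
  by (induction rule: proj_span.induct)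
    (simp_all add: proj_span.intros adj_add adj_cscale is_projection_def)

lemma proj_span_mult:
  fixes x :: "'a::{cstar_algebra, comm_ring}"
  assumes "x \<in> proj_span UNIV" "y \<in> proj_span UNIV"
  shows "x * y \<in> proj_span UNIV"
  using assms(1)
proof induction
  case (step x p c)
  have "p * y \<in> proj_span UNIV"
    using assms(2)
  proof induction
    case (step y q d)
    then show ?case
      using proj_span.step[of "p * y" UNIV "p * q" d] \<open>is_projection p\<close>
      by (simp add: distrib_left mult_cscale_right is_projection_mult)
  qed (simp add: proj_span.zero)
  with step show ?case
    by (simp add: distrib_right mult_cscale_left proj_span_add proj_span_cscale)
qed (simp add: proj_span.zero)

lemma proj_span_subset: "cstar_ideal I \<Longrightarrow> proj_span I \<subseteq> I"
proof
  fix x assume I: "cstar_ideal I" and "x \<in> proj_span I"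
  from this(2) show "x \<in> I" by induction (simp_all add: cstar_idealD[OF I])
qed

definition generated_by_projections :: "'a::cstar_algebra itself \<Rightarrow> bool"
  where "generated_by_projections TYPE('a) \<longleftrightarrow>
    cstar_subalgebra hull {p::'a. is_projection p} = UNIV"

text \<open>Products of commuting projections are projections, so the span is closed under all
  algebraic operations. Its closure is then a C*-subalgebra that contains the generators.\<close>

lemma closure_proj_span_UNIV:
  assumes "generated_by_projections TYPE('a::{cstar_algebra, comm_ring})"
  shows "closure (proj_span UNIV) = (UNIV :: 'a set)"
proof -
  let ?S = "closure (proj_span UNIV) :: 'a set"
  have "cstar_subalgebra ?S"
    unfolding cstar_subalgebra_def
  proof (intro conjI ballI allI)
    show "0 \<in> ?S" using closure_subset proj_span.zero by blast
    fix x assume "x \<in> ?S"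
    then obtain u where u: "\<And>n. u n \<in> proj_span UNIV" "u \<longlonglongrightarrow> x"
      by (auto simp: closure_sequential)
    show "adj x \<in> ?S" unfolding closure_sequential
      by (intro exI[of _ "\<lambda>n. adj (u n)"])
        (simp add: u proj_span_adj bounded_linear.tendsto[OF bounded_linear_adj u(2)])
    show "cscale c x \<in> ?S" for c unfolding closure_sequential
      by (intro exI[of _ "\<lambda>n. cscale c (u n)"])
        (simp add: u proj_span_cscale bounded_linear.tendsto[OF bounded_linear_cscale u(2)])
    fix y assume "y \<in> ?S"
    then obtain v where v: "\<And>n. v n \<in> proj_span UNIV" "v \<longlonglongrightarrow> y"
      by (auto simp: closure_sequential)
    show "x + y \<in> ?S" unfolding closure_sequential
      by (intro exI[of _ "\<lambda>n. u n + v n"]) (simp add: u v proj_span_add tendsto_add)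
    show "x * y \<in> ?S" unfolding closure_sequential
      by (intro exI[of _ "\<lambda>n. u n * v n"]) (simp add: u v proj_span_mult tendsto_mult)
  qed simp
  moreover have "{p. is_projection p} \<subseteq> ?S"
    using closure_subset proj_span.step[OF proj_span.zero, of _ UNIV 1] by fastforce
  ultimately have "cstar_subalgebra hull {p. is_projection p} \<subseteq> ?S"
    by (rule hull_minimal[rotated])
  with assms show ?thesis by (auto simp: generated_by_projections_def)
qed

text \<open>If \<open>x \<in> I\<close> is close to \<open>\<Sum> d r r\<close> with orthogonal \<open>r\<close>, then \<open>x r\<close> is invertible in the corner of
  each \<open>r\<close> whose coefficient is not small, by the Neumann series; so \<open>I\<close> contains these \<open>r\<close>.\<close>

lemma ideal_approx_proj_span:
  fixes x :: "'a::{cstar_algebra, comm_ring}"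
  assumes gen: "generated_by_projections TYPE('a)" and I: "cstar_ideal I"
    and x: "x \<in> I" and e: "0 < e"
  shows "\<exists>y\<in>proj_span I. norm (x - y) < e"
proof -
  define \<delta> where "\<delta> = e / 3"
  have \<delta>: "0 < \<delta>" using e by (simp add: \<delta>_def)
  obtain y where y: "y \<in> proj_span UNIV" "norm (x - y) < \<delta>"
    using closure_approachable[of x "proj_span UNIV"] closure_proj_span_UNIV[OF gen] \<delta>
    by (auto simp: dist_norm norm_minus_commute)
  obtain Q c where Q: "finite Q" "\<And>q. q \<in> Q \<Longrightarrow> is_projection q"
    and yQ: "y = (\<Sum>q\<in>Q. cscale (c q) q)"
    using proj_span_sumD[OF y(1)] by blast
  obtain R where R: "orthogonal_projections R" "0 \<notin> R"
    and QR: "\<And>q. q \<in> Q \<Longrightarrow> q = \<Sum>{r \<in> R. r * q = r}"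
    using projections_refine[OF Q] by blast
  have fin: "finite R" using R by (simp add: orthogonal_projections_def)
  define d where "d r = (\<Sum>q | q \<in> Q \<and> r * q = r. c q)" for r
  have yR: "y = (\<Sum>r\<in>R. cscale (d r) r)"
    unfolding yQ d_def using Q(1) fin QR by (rule sum_cscale_refine)
  \<comment> \<open>The threshold is twice the approximation error, which puts \<open>z\<close>
    within 1/2 of \<open>r\<close> for every \<open>r\<close> that is kept. The discarded part has
    norm at most \<open>2 * \<delta>\<close>, and the error of \<open>y\<close> takes up the
    remaining third of \<open>e\<close>.\<close>
  define B where "B = {r \<in> R. 2 * \<delta> \<le> cmod (d r)}"
  have "r \<in> I" if r: "r \<in> B" for r
  proof -
    have rR: "r \<in> R" and dr: "2 * \<delta> \<le> cmod (d r)" using r by (auto simp: B_def)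
    then have dr0: "d r \<noteq> 0" using \<delta> by auto
    have pr: "is_projection r" using R rR by (simp add: orthogonal_projections_def)
    have nr: "norm r = 1" using norm_projection[OF pr] R rR by auto
    define z where "z = cscale (1 / d r) (r * x)"
    have zI: "z \<in> I" using cstar_idealD[OF I] x by (simp add: z_def)
    have "r = cscale (1 / d r) (r * y)"
      using orthogonal_projections_mult_sum[OF R(1) rR, of d] dr0 by (simp add: yR cscale_cscale)
    then have "r - z = cscale (1 / d r) (r * (y - x))"
      unfolding z_def by (metis cscale_diff_right right_diff_distrib)
    then have "norm (r - z) = norm (r * (y - x)) / cmod (d r)"
      by (simp add: norm_cscale norm_divide)
    also have "\<dots> \<le> \<delta> / (2 * \<delta>)"
      using norm_mult_ineq[of r "y - x"] nr y(2) dr \<delta>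
      by (intro frac_le) (auto simp: norm_minus_commute)
    finally have u: "norm (r - z) \<le> 1 / 2" using \<delta> by simp
    \<comment> \<open>The sum of the Neumann series is obtained as the fixed point
      \<open>w = r + (r - z) * w\<close>. Since \<open>r * w = w\<close>, this equation reads
      \<open>z * w = r\<close>.\<close>
    have "dist (r + (r - z) * v) (r + (r - z) * w) \<le> 1 / 2 * dist v w" for v w
    proof -
      have "dist (r + (r - z) * v) (r + (r - z) * w) \<le> norm (r - z) * norm (v - w)"
        using norm_mult_ineq[of "r - z" "v - w"] by (simp add: dist_norm right_diff_distrib)
      also have "\<dots> \<le> 1 / 2 * norm (v - w)" using u by (intro mult_right_mono) auto
      finally show ?thesis by (simp add: dist_norm)
    qed
    then obtain w where w: "r + (r - z) * w = w"
      using banach_fix_type[of "1/2" "\<lambda>w. r + (r - z) * w"] by auto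
    have "r * z = z"
      using projection_simps[OF pr] by (simp add: z_def mult_cscale_right)
    then have "r * (z * w) = z * w" by (simp flip: mult.assoc)
    then have "r * (r + (r - z) * w) = r + (r - z) * w"
      using projection_simps[OF pr] by (simp add: ring_distribs)
    then have "r * w = w" unfolding w .
    then have "z * w = r" using w by (simp add: algebra_simps)
    then show "r \<in> I" using cstar_idealD(6)[OF I zI, of w] by simp
  qed
  then have "(\<Sum>r\<in>B. cscale (d r) r) \<in> proj_span I"
    using R by (intro proj_span_sumI) (auto simp: B_def orthogonal_projections_def)
  moreover have "norm (x - (\<Sum>r\<in>B. cscale (d r) r)) < e"
  proof -
    have "y = (\<Sum>r\<in>B. cscale (d r) r) + (\<Sum>r\<in>R - B. cscale (d r) r)"
      unfolding yR using fin sum.subset_diff[of B R] by (simp add: B_def add.commute)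
    then have eq: "x - (\<Sum>r\<in>B. cscale (d r) r) = (x - y) + (\<Sum>r\<in>R - B. cscale (d r) r)"
      by (simp add: algebra_simps)
    have "norm (\<Sum>r\<in>R - B. cscale (d r) r) \<le> 2 * \<delta>"
      using orthogonal_projections_subset[OF R(1)] \<delta>
      by (intro norm_orthogonal_sum_le) (auto simp: B_def)
    then show ?thesis
      using y(2) norm_triangle_ineq[of "x - y" "\<Sum>r\<in>R - B. cscale (d r) r"]
      unfolding eq \<delta>_def by linarith
  qed
  ultimately show ?thesis by blast
qed

text \<open>Selfadjointness of a closed ideal is a consequence, not part of
  \<open>cstar_ideal\<close>. Here the combinations of projections of \<open>I\<close> are dense in
  \<open>I\<close> and stable under \<open>adj\<close>.\<close>

lemma ideal_adj:
  fixes x :: "'a::{cstar_algebra, comm_ring}"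
  assumes gen: "generated_by_projections TYPE('a)" and I: "cstar_ideal I" and x: "x \<in> I"
  shows "adj x \<in> I"
proof -
  have "\<exists>y\<in>I. dist y (adj x) < e" if e: "0 < e" for e
  proof -
    obtain y where y: "y \<in> proj_span I" "norm (x - y) < e"
      using ideal_approx_proj_span[OF gen I x e] by blast
    then have "adj y \<in> I" "dist (adj y) (adj x) < e"
      using proj_span_adj proj_span_subset[OF I]
      by (auto simp: dist_norm norm_minus_commute simp flip: adj_diff)
    then show ?thesis by blast
  qed
  then have "adj x \<in> closure I" by (simp add: closure_approachable)
  then show ?thesis using cstar_idealD(1)[OF I] by simp
qed

section \<open>Seminorms and completions\<close>

text \<open>The consequences of the axioms of a \<open>*\<close>-algebra that completions depend on; associativity and
  \<open>(xy)\<^sup>* = y\<^sup>*x\<^sup>*\<close> play no role for them.\<close>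

locale star_algebra =
  fixes S :: "('x, 'm) star_alg_scheme"
  assumes zero_closed: "szero S \<in> carrier S"
    and add_closed: "x \<in> carrier S \<Longrightarrow> y \<in> carrier S \<Longrightarrow> sadd S x y \<in> carrier S"
    and scale_closed: "x \<in> carrier S \<Longrightarrow> sscale S c x \<in> carrier S"
    and mult_closed: "x \<in> carrier S \<Longrightarrow> y \<in> carrier S \<Longrightarrow> smult S x y \<in> carrier S"
    and adj_closed: "x \<in> carrier S \<Longrightarrow> sadj S x \<in> carrier S"
    and sdiff_self: "x \<in> carrier S \<Longrightarrow> sdiff S x x = sscale S 0 x"
    and sdiff_commute: "x \<in> carrier S \<Longrightarrow> y \<in> carrier S \<Longrightarrow> sdiff S y x = sscale S (-1) (sdiff S x y)"
    and sdiff_chain: "x \<in> carrier S \<Longrightarrow> y \<in> carrier S \<Longrightarrow> z \<in> carrier S \<Longrightarrow>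
      sdiff S x z = sadd S (sdiff S x y) (sdiff S y z)"
    and add_sdiff: "x \<in> carrier S \<Longrightarrow> y \<in> carrier S \<Longrightarrow> sadd S (sdiff S x y) y = x"
    and sdiff_add: "x \<in> carrier S \<Longrightarrow> x' \<in> carrier S \<Longrightarrow> y \<in> carrier S \<Longrightarrow> y' \<in> carrier S \<Longrightarrow>
      sdiff S (sadd S x y) (sadd S x' y') = sadd S (sdiff S x x') (sdiff S y y')"
    and sdiff_scale: "x \<in> carrier S \<Longrightarrow> x' \<in> carrier S \<Longrightarrow>
      sdiff S (sscale S c x) (sscale S c x') = sscale S c (sdiff S x x')"
    and sdiff_mult: "x \<in> carrier S \<Longrightarrow> x' \<in> carrier S \<Longrightarrow> y \<in> carrier S \<Longrightarrow> y' \<in> carrier S \<Longrightarrow>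
      sdiff S (smult S x y) (smult S x' y') =
        sadd S (smult S x (sdiff S y y')) (smult S (sdiff S x x') y')"
    and sdiff_adj: "x \<in> carrier S \<Longrightarrow> x' \<in> carrier S \<Longrightarrow>
      sdiff S (sadj S x) (sadj S x') = sadj S (sdiff S x x')"
begin

lemmas closed = zero_closed add_closed scale_closed mult_closed adj_closed

lemma sdiff_closed: "x \<in> carrier S \<Longrightarrow> y \<in> carrier S \<Longrightarrow> sdiff S x y \<in> carrier S"
  by (simp add: sdiff_def closed)

end

text \<open>\<open>cstar_seminorm\<close> without the C*-identity. This covers the l1 norm of the
  crossed product, against which C*-seminorms are compared.\<close>

definition star_seminorm :: "('x, 'm) star_alg_scheme \<Rightarrow> ('x \<Rightarrow> real) \<Rightarrow> bool"
  where "star_seminorm S p \<longleftrightarrow>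
    (\<forall>x\<in>carrier S. 0 \<le> p x) \<and>
    (\<forall>x\<in>carrier S. \<forall>y\<in>carrier S. p (sadd S x y) \<le> p x + p y) \<and>
    (\<forall>x\<in>carrier S. \<forall>c. p (sscale S c x) = cmod c * p x) \<and>
    (\<forall>x\<in>carrier S. \<forall>y\<in>carrier S. p (smult S x y) \<le> p x * p y) \<and>
    (\<forall>x\<in>carrier S. p (sadj S x) = p x)"

lemma cstar_seminorm_iff:
  "cstar_seminorm S p \<longleftrightarrow>
    star_seminorm S p \<and> (\<forall>x\<in>carrier S. p (smult S (sadj S x) x) = (p x)\<^sup>2)"
  by (auto simp: cstar_seminorm_def star_seminorm_def)

locale seminormed_star_algebra = star_algebra S for S :: "('x, 'm) star_alg_scheme" +
  fixes N :: "'x \<Rightarrow> real"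
  assumes star_seminorm: "star_seminorm S N"
begin

section \<open>The distance of a seminorm and its Cauchy sequences\<close>

lemma nonneg: "x \<in> carrier S \<Longrightarrow> 0 \<le> N x"
  and triangle: "x \<in> carrier S \<Longrightarrow> y \<in> carrier S \<Longrightarrow> N (sadd S x y) \<le> N x + N y"
  and scale: "x \<in> carrier S \<Longrightarrow> N (sscale S c x) = cmod c * N x"
  and submult: "x \<in> carrier S \<Longrightarrow> y \<in> carrier S \<Longrightarrow> N (smult S x y) \<le> N x * N y"
  and norm_adj: "x \<in> carrier S \<Longrightarrow> N (sadj S x) = N x"
  using star_seminorm by (simp_all add: star_seminorm_def)

abbreviation d where "d x y \<equiv> N (sdiff S x y)"
abbreviation CS where "CS \<equiv> cauchy_seqs S N"
abbreviation cls where "cls \<equiv> cauchy_class S N"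
abbreviation HC where "HC \<equiv> hausdorff_completion S N"

lemma d_nonneg: "x \<in> carrier S \<Longrightarrow> y \<in> carrier S \<Longrightarrow> 0 \<le> d x y"
  by (simp add: nonneg sdiff_closed)

lemma d_self: "x \<in> carrier S \<Longrightarrow> d x x = 0"
  by (simp add: sdiff_self scale)

lemma d_commute: "x \<in> carrier S \<Longrightarrow> y \<in> carrier S \<Longrightarrow> d x y = d y x"
  by (subst (2) sdiff_commute) (simp_all add: scale sdiff_closed)

lemma d_triangle:
  "x \<in> carrier S \<Longrightarrow> y \<in> carrier S \<Longrightarrow> z \<in> carrier S \<Longrightarrow> d x z \<le> d x y + d y z"
  using triangle[of "sdiff S x y" "sdiff S y z"] by (simp add: sdiff_closed flip: sdiff_chain)

lemma d_add:
  "x \<in> carrier S \<Longrightarrow> x' \<in> carrier S \<Longrightarrow> y \<in> carrier S \<Longrightarrow> y' \<in> carrier S \<Longrightarrow>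
    d (sadd S x y) (sadd S x' y') \<le> d x x' + d y y'"
  by (simp add: sdiff_add triangle sdiff_closed)

lemma d_scale:
  "x \<in> carrier S \<Longrightarrow> x' \<in> carrier S \<Longrightarrow> d (sscale S c x) (sscale S c x') = cmod c * d x x'"
  by (simp add: sdiff_scale scale sdiff_closed)

lemma d_mult:
  assumes "x \<in> carrier S" "x' \<in> carrier S" "y \<in> carrier S" "y' \<in> carrier S"
  shows "d (smult S x y) (smult S x' y') \<le> N x * d y y' + d x x' * N y'"
proof -
  have "d (smult S x y) (smult S x' y') \<le>
      N (smult S x (sdiff S y y')) + N (smult S (sdiff S x x') y')"
    using assms by (simp add: sdiff_mult triangle closed sdiff_closed)
  also have "\<dots> \<le> N x * d y y' + d x x' * N y'"
    using assms by (intro add_mono submult) (simp_all add: sdiff_closed)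
  finally show ?thesis .
qed

lemma d_adj: "x \<in> carrier S \<Longrightarrow> x' \<in> carrier S \<Longrightarrow> d (sadj S x) (sadj S x') = d x x'"
  by (simp add: sdiff_adj norm_adj sdiff_closed)

lemma abs_diff_le_d:
  assumes "x \<in> carrier S" "y \<in> carrier S"
  shows "\<bar>N x - N y\<bar> \<le> d x y"
  using triangle[of "sdiff S x y" y] triangle[of "sdiff S y x" x] assms
  by (simp add: add_sdiff sdiff_closed d_commute abs_le_iff)

lemma cauchy_seqs_carrier: "u \<in> CS \<Longrightarrow> u n \<in> carrier S"
  by (simp add: cauchy_seqs_def)

lemma norm_convergent:
  assumes "u \<in> CS"
  shows "(\<lambda>n. N (u n)) \<longlonglongrightarrow> lim (\<lambda>n. N (u n))"
proof -
  have "Cauchy (\<lambda>n. N (u n))"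
    unfolding Cauchy_def dist_real_def
  proof (intro allI impI)
    fix e :: real assume "0 < e"
    with assms obtain M where "\<forall>m\<ge>M. \<forall>n\<ge>M. d (u m) (u n) < e"
      unfolding cauchy_seqs_def by blast
    then have "\<forall>m\<ge>M. \<forall>n\<ge>M. \<bar>N (u m) - N (u n)\<bar> < e"
      using abs_diff_le_d[OF cauchy_seqs_carrier[OF assms] cauchy_seqs_carrier[OF assms]]
      by (meson le_less_trans)
    then show "\<exists>M. \<forall>m\<ge>M. \<forall>n\<ge>M. \<bar>N (u m) - N (u n)\<bar> < e" ..
  qed
  then show ?thesis by (simp add: Cauchy_convergent_iff convergent_LIMSEQ_iff)
qed

lemma norm_bounded:
  assumes "u \<in> CS"
  obtains B where "0 < B" "\<And>n. N (u n) \<le> B"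
proof -
  have "Bseq (\<lambda>n. N (u n))"
    using norm_convergent[OF assms] by (blast intro: convergent_imp_Bseq convergentI)
  then obtain B where "0 < B" "\<And>n. \<bar>N (u n)\<bar> \<le> B" by (auto elim: BseqE)
  then show thesis using that abs_le_D1 by blast
qed

text \<open>One criterion for all operations: unary ones take \<open>u = v\<close>, and
  multiplication takes for \<open>K\<close> the sum of bounds of the two sequences.\<close>

lemma cauchy_seqsI:
  assumes "\<And>n. w n \<in> carrier S" "u \<in> CS" "v \<in> CS"
    and "0 \<le> K" and le: "\<And>m n. d (w m) (w n) \<le> K * d (u m) (u n) + K * d (v m) (v n)"
  shows "w \<in> CS"
proof -
  have "\<exists>M. \<forall>m\<ge>M. \<forall>n\<ge>M. d (w m) (w n) < e" if e: "0 < e" for e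
  proof -
    \<comment> \<open>The summand 1 keeps the denominator positive for \<open>K = 0\<close>, as for
      the scalar zero.\<close>
    define e' where "e' = e / (2 * (K + 1))"
    have e': "0 < e'" using e assms(4) by (simp add: e'_def)
    obtain M1 where M1: "\<forall>m\<ge>M1. \<forall>n\<ge>M1. d (u m) (u n) < e'"
      using assms(2) e' unfolding cauchy_seqs_def by blast
    obtain M2 where M2: "\<forall>m\<ge>M2. \<forall>n\<ge>M2. d (v m) (v n) < e'"
      using assms(3) e' unfolding cauchy_seqs_def by blast
    have "d (w m) (w n) < e" if "m \<ge> max M1 M2" "n \<ge> max M1 M2" for m n
    proof -
      have "d (u m) (u n) \<le> e'" "d (v m) (v n) \<le> e'"
        using M1 M2 that by (simp_all add: less_imp_le)
      then have "d (w m) (w n) \<le> K * e' + K * e'"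
        using le[of m n] assms(4) by (meson add_mono mult_left_mono order_trans)
      also have "\<dots> < 2 * (K + 1) * e'" using e' by (simp add: algebra_simps)
      also have "\<dots> = e" using assms(4) by (simp add: e'_def field_simps)
      finally show ?thesis .
    qed
    then show ?thesis by blast
  qed
  then show ?thesis using assms(1) by (simp add: cauchy_seqs_def)
qed

lemma cauchy_seqs_add:
  "u \<in> CS \<Longrightarrow> v \<in> CS \<Longrightarrow> (\<lambda>n. sadd S (u n) (v n)) \<in> CS"
  by (rule cauchy_seqsI[of _ u v 1]) (simp_all add: closed d_add cauchy_seqs_carrier)

lemma cauchy_seqs_scale: "u \<in> CS \<Longrightarrow> (\<lambda>n. sscale S c (u n)) \<in> CS"
  by (rule cauchy_seqsI[of _ u u "cmod c"])
    (simp_all add: closed d_scale d_nonneg cauchy_seqs_carrier)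

lemma cauchy_seqs_adj: "u \<in> CS \<Longrightarrow> (\<lambda>n. sadj S (u n)) \<in> CS"
  by (rule cauchy_seqsI[of _ u u 1]) (simp_all add: closed d_adj d_nonneg cauchy_seqs_carrier)

lemma cauchy_seqs_mult:
  assumes u: "u \<in> CS" and v: "v \<in> CS"
  shows "(\<lambda>n. smult S (u n) (v n)) \<in> CS"
proof -
  obtain A where A: "0 < A" "\<And>n. N (u n) \<le> A" using norm_bounded[OF u] by blast
  obtain B where B: "0 < B" "\<And>n. N (v n) \<le> B" using norm_bounded[OF v] by blast
  note c = cauchy_seqs_carrier[OF u] cauchy_seqs_carrier[OF v]
  show ?thesis
  proof (rule cauchy_seqsI[OF _ u v, of _ "A + B"])
    fix m n
    have "d (smult S (u m) (v m)) (smult S (u n) (v n)) \<le>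
        N (u m) * d (v m) (v n) + d (u m) (u n) * N (v n)"
      using c by (intro d_mult)
    also have "\<dots> \<le> (A + B) * d (v m) (v n) + d (u m) (u n) * (A + B)"
      using A B c by (intro add_mono mult_right_mono mult_left_mono)
        (auto simp: d_nonneg intro: add_increasing add_increasing2)
    finally show "d (smult S (u m) (v m)) (smult S (u n) (v n)) \<le>
        (A + B) * d (u m) (u n) + (A + B) * d (v m) (v n)" by (simp add: mult.commute add.commute)
  qed (use A B c closed in auto)
qed

section \<open>Equivalence of Cauchy sequences and the operations on classes\<close>

definition null_dist where "null_dist u v \<longleftrightarrow> (\<lambda>n. d (u n) (v n)) \<longlonglongrightarrow> 0"

lemma null_distI:
  assumes "\<And>n. u n \<in> carrier S" "\<And>n. v n \<in> carrier S"
    and "f \<longlonglongrightarrow> 0" "\<And>n. d (u n) (v n) \<le> f n"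
  shows "null_dist u v"
  unfolding null_dist_def
  by (rule tendsto_sandwich[OF _ _ tendsto_const assms(3)]) (use assms in \<open>auto simp: d_nonneg\<close>)

lemma null_dist_self: "u \<in> CS \<Longrightarrow> null_dist u u"
  by (simp add: null_dist_def d_self cauchy_seqs_carrier)

lemma null_dist_sym:
  "u \<in> CS \<Longrightarrow> v \<in> CS \<Longrightarrow> null_dist u v \<Longrightarrow> null_dist v u"
  by (simp add: null_dist_def d_commute cauchy_seqs_carrier)

lemma null_dist_trans:
  assumes "u \<in> CS" "v \<in> CS" "w \<in> CS"
    and "null_dist u v" "null_dist v w"
  shows "null_dist u w"
  using assms tendsto_add[of "\<lambda>n. d (u n) (v n)" 0 sequentially "\<lambda>n. d (v n) (w n)" 0]
  by (intro null_distI[where f = "\<lambda>n. d (u n) (v n) + d (v n) (w n)"])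
    (auto simp: null_dist_def cauchy_seqs_carrier intro!: d_triangle)

lemma cauchy_class_eq_iff:
  assumes "u \<in> CS" "v \<in> CS"
  shows "cls u = cls v \<longleftrightarrow> null_dist u v"
proof
  assume "cls u = cls v"
  moreover have "v \<in> cls v"
    using assms null_dist_self by (simp add: cauchy_class_def null_dist_def)
  ultimately show "null_dist u v" by (auto simp: cauchy_class_def null_dist_def)
next
  assume "null_dist u v"
  then have "null_dist u w \<longleftrightarrow> null_dist v w" if "w \<in> CS" for w
    using that assms null_dist_trans null_dist_sym by blast
  then show "cls u = cls v"
    by (auto simp: cauchy_class_def null_dist_def)
qed

lemma cauchy_class_self: "u \<in> CS \<Longrightarrow> u \<in> cls u"
  using null_dist_self by (simp add: cauchy_class_def null_dist_def)

lemma cauchy_classD: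
  "v \<in> cls u \<Longrightarrow> v \<in> CS" "v \<in> cls u \<Longrightarrow> null_dist u v"
  by (auto simp: cauchy_class_def null_dist_def)

lemma null_dist_add:
  assumes "u \<in> CS" "u' \<in> CS" "v \<in> CS" "v' \<in> CS"
    and "null_dist u u'" "null_dist v v'"
  shows "null_dist (\<lambda>n. sadd S (u n) (v n)) (\<lambda>n. sadd S (u' n) (v' n))"
  using assms tendsto_add[of "\<lambda>n. d (u n) (u' n)" 0 sequentially "\<lambda>n. d (v n) (v' n)" 0]
  by (intro null_distI[where f = "\<lambda>n. d (u n) (u' n) + d (v n) (v' n)"])
    (auto simp: null_dist_def cauchy_seqs_carrier closed intro!: d_add)

lemma null_dist_scale:
  assumes "u \<in> CS" "u' \<in> CS" "null_dist u u'"
  shows "null_dist (\<lambda>n. sscale S c (u n)) (\<lambda>n. sscale S c (u' n))"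
  using assms tendsto_mult_right_zero[of "\<lambda>n. d (u n) (u' n)" sequentially "cmod c"]
  by (simp add: null_dist_def d_scale cauchy_seqs_carrier)

lemma null_dist_adj:
  assumes "u \<in> CS" "u' \<in> CS" "null_dist u u'"
  shows "null_dist (\<lambda>n. sadj S (u n)) (\<lambda>n. sadj S (u' n))"
  using assms by (simp add: null_dist_def d_adj cauchy_seqs_carrier)

lemma null_dist_mult:
  assumes "u \<in> CS" "u' \<in> CS" "v \<in> CS" "v' \<in> CS"
    and "null_dist u u'" "null_dist v v'"
  shows "null_dist (\<lambda>n. smult S (u n) (v n)) (\<lambda>n. smult S (u' n) (v' n))"
proof (rule null_distI[where f = "\<lambda>n. N (u n) * d (v n) (v' n) + d (u n) (u' n) * N (v' n)"])
  show "(\<lambda>n. N (u n) * d (v n) (v' n) + d (u n) (u' n) * N (v' n)) \<longlonglongrightarrow> 0"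
    using tendsto_add[OF tendsto_mult[OF norm_convergent[OF assms(1)]]
        tendsto_mult[OF _ norm_convergent[OF assms(4)]],
        of "\<lambda>n. d (v n) (v' n)" 0 "\<lambda>n. d (u n) (u' n)" 0] assms
    by (simp add: null_dist_def)
qed (use assms in \<open>auto simp: cauchy_seqs_carrier closed intro!: d_mult\<close>)

lemma lim_norm_eq:
  assumes "u \<in> CS" "v \<in> CS" "null_dist u v"
  shows "lim (\<lambda>n. N (u n)) = lim (\<lambda>n. N (v n))"
proof -
  have "(\<lambda>n. N (u n) - N (v n)) \<longlonglongrightarrow> 0"
    using assms(3) unfolding null_dist_def
    by (rule Lim_null_comparison[rotated])
      (use assms in \<open>auto simp: cauchy_seqs_carrier intro!: abs_diff_le_d always_eventually\<close>)
  moreover have "(\<lambda>n. N (u n) - N (v n)) \<longlonglongrightarrow> lim (\<lambda>n. N (u n)) - lim (\<lambda>n. N (v n))"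
    using assms by (intro tendsto_diff norm_convergent)
  ultimately show ?thesis using LIMSEQ_unique by fastforce
qed

lemma completion_carrier:
  "U \<in> carrier HC \<longleftrightarrow> (\<exists>u\<in>CS. U = cls u)"
  by (auto simp: hausdorff_completion_def)

text \<open>The operations of the completion are unions over all representatives. The class of the
  result does not depend on the representatives (\<open>eq\<close>, \<open>eq2\<close>), so each
  union is over a constant family (\<open>Un\<close>); the norm is the single element of a set of
  equal limits.\<close>

lemma completion_ops:
  assumes u: "u \<in> CS"
  shows "v \<in> CS \<Longrightarrow>
      sadd HC (cls u) (cls v) =
        cls (\<lambda>n. sadd S (u n) (v n))"
    and "v \<in> CS \<Longrightarrow>
      smult HC (cls u) (cls v) =
        cls (\<lambda>n. smult S (u n) (v n))"
    and "sscale HC c (cls u) =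
        cls (\<lambda>n. sscale S c (u n))"
    and "sadj HC (cls u) = cls (\<lambda>n. sadj S (u n))"
    and "snorm HC (cls u) = lim (\<lambda>n. N (u n))"
proof -
  have eq: "cls (f v) = cls (f u)"
    if "v \<in> cls u" "\<And>w. w \<in> CS \<Longrightarrow> f w \<in> CS"
      "\<And>w. w \<in> CS \<Longrightarrow> null_dist u w \<Longrightarrow> null_dist (f u) (f w)" for f v
    using that u cauchy_class_eq_iff[of "f u" "f v"] by (simp add: cauchy_classD)
  have eq2: "cls (f u' v') = cls (f u v)"
    if "u' \<in> cls u" "v' \<in> cls v" "v \<in> CS"
      "\<And>w w'. w \<in> CS \<Longrightarrow> w' \<in> CS \<Longrightarrow> f w w' \<in> CS"
      "\<And>w w'. w \<in> CS \<Longrightarrow> w' \<in> CS \<Longrightarrow> null_dist u w \<Longrightarrow> null_dist v w' \<Longrightarrow>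
        null_dist (f u v) (f w w')" for f u' v v'
    using that u cauchy_class_eq_iff[of "f u v" "f u' v'"] by (simp add: cauchy_classD)
  have Un: "(\<Union>x\<in>A. f x) = B" if "x0 \<in> A" "\<And>x. x \<in> A \<Longrightarrow> f x = B"
    for x0 and A :: "'c set" and f and B :: "(nat \<Rightarrow> 'x) set"
    using that by blast
  note self = cauchy_class_self
  show "sadd HC (cls u) (cls v) =
        cls (\<lambda>n. sadd S (u n) (v n))" if v: "v \<in> CS"
    unfolding hausdorff_completion_def star_alg.simps normed_star_alg.simps
    by (intro Un[OF self[OF u]] Un[OF self[OF v]] eq2[where f = "\<lambda>u v n. sadd S (u n) (v n)"] v
      cauchy_seqs_add null_dist_add u)
  show "smult HC (cls u) (cls v) =
        cls (\<lambda>n. smult S (u n) (v n))" if v: "v \<in> CS"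
    unfolding hausdorff_completion_def star_alg.simps normed_star_alg.simps
    by (intro Un[OF self[OF u]] Un[OF self[OF v]] eq2[where f = "\<lambda>u v n. smult S (u n) (v n)"] v
      cauchy_seqs_mult null_dist_mult u)
  show "sscale HC c (cls u) =
        cls (\<lambda>n. sscale S c (u n))"
    unfolding hausdorff_completion_def star_alg.simps normed_star_alg.simps
    by (intro Un[OF self[OF u]] eq[where f = "\<lambda>u n. sscale S c (u n)"]
      cauchy_seqs_scale null_dist_scale u)
  show "sadj HC (cls u) = cls (\<lambda>n. sadj S (u n))"
    unfolding hausdorff_completion_def star_alg.simps normed_star_alg.simps
    by (intro Un[OF self[OF u]] eq[where f = "\<lambda>u n. sadj S (u n)"]
      cauchy_seqs_adj null_dist_adj u)
  have "(\<lambda>u. lim (\<lambda>n. N (u n))) ` cls u = {lim (\<lambda>n. N (u n))}"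
    using self[OF u] cauchy_classD lim_norm_eq[OF u] by force
  then show "snorm HC (cls u) = lim (\<lambda>n. N (u n))"
    by (simp add: hausdorff_completion_def)
qed

lemma completion_closed:
  assumes "U \<in> carrier HC" "V \<in> carrier HC"
  shows "sadd HC U V \<in> carrier HC"
    and "smult HC U V \<in> carrier HC"
    and "sscale HC c U \<in> carrier HC"
    and "sadj HC U \<in> carrier HC"
  using assms unfolding completion_carrier
  by (auto simp: completion_ops intro: cauchy_seqs_add cauchy_seqs_mult cauchy_seqs_scale
      cauchy_seqs_adj)

end

text \<open>The natural map goes from the completed free algebra to the crossed product, against the
  direction of the goal. Closure of \<open>S\<close> is what allows the inverse to be pulled through
  the operations.\<close>

lemma cstar_isomorphic_sym:
  assumes iso: "cstar_isomorphic S T"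
    and closed: "\<And>x y c. x \<in> carrier S \<Longrightarrow> y \<in> carrier S \<Longrightarrow> sadd S x y \<in> carrier S \<and>
      smult S x y \<in> carrier S \<and> sscale S c x \<in> carrier S \<and> sadj S x \<in> carrier S"
  shows "cstar_isomorphic T S"
proof -
  obtain \<phi> where bij: "bij_betw \<phi> (carrier S) (carrier T)"
    and hom: "\<And>x y. x \<in> carrier S \<Longrightarrow> y \<in> carrier S \<Longrightarrow>
      \<phi> (sadd S x y) = sadd T (\<phi> x) (\<phi> y) \<and> \<phi> (smult S x y) = smult T (\<phi> x) (\<phi> y)"
      "\<And>x c. x \<in> carrier S \<Longrightarrow> \<phi> (sscale S c x) = sscale T c (\<phi> x)"
      "\<And>x. x \<in> carrier S \<Longrightarrow> \<phi> (sadj S x) = sadj T (\<phi> x)"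
      "\<And>x. x \<in> carrier S \<Longrightarrow> snorm T (\<phi> x) = snorm S x"
    using iso by (auto simp: cstar_isomorphic_def)
  define \<psi> where "\<psi> = inv_into (carrier S) \<phi>"
  have \<psi>: "\<psi> y \<in> carrier S" "\<phi> (\<psi> y) = y" if "y \<in> carrier T" for y
    using that bij by (auto simp: \<psi>_def bij_betw_def inv_into_into f_inv_into_f)
  have \<psi>\<phi>: "\<psi> (\<phi> x) = x" if "x \<in> carrier S" for x
    using that bij by (simp add: \<psi>_def bij_betw_inv_into_left)
  have "\<psi> (sadd T x y) = sadd S (\<psi> x) (\<psi> y)" "\<psi> (smult T x y) = smult S (\<psi> x) (\<psi> y)"
    if "x \<in> carrier T" "y \<in> carrier T" for x y
    using hom(1)[of "\<psi> x" "\<psi> y"] closed[of "\<psi> x" "\<psi> y"] \<psi> that \<psi>\<phi> by metis+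
  moreover have "\<psi> (sscale T c x) = sscale S c (\<psi> x)" "\<psi> (sadj T x) = sadj S (\<psi> x)"
    "snorm S (\<psi> x) = snorm T x" if "x \<in> carrier T" for x c
    using hom(2-)[of "\<psi> x"] closed[of "\<psi> x" "\<psi> x"] \<psi> that \<psi>\<phi> by metis+
  moreover have "bij_betw \<psi> (carrier T) (carrier S)"
    unfolding \<psi>_def by (rule bij_betw_inv_into[OF bij])
  ultimately show ?thesis
    unfolding cstar_isomorphic_def by (intro exI[of _ \<psi>]) blast
qed

section \<open>Transport along a homomorphism with dense image\<close>

locale star_hom = S: star_algebra S + T: star_algebra T
  for S :: "('x, 'm) star_alg_scheme" and T :: "('y, 'n) star_alg_scheme" +
  fixes \<Phi> :: "'x \<Rightarrow> 'y"
  assumes hom_closed: "x \<in> carrier S \<Longrightarrow> \<Phi> x \<in> carrier T"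
    and hom_add: "x \<in> carrier S \<Longrightarrow> y \<in> carrier S \<Longrightarrow> \<Phi> (sadd S x y) = sadd T (\<Phi> x) (\<Phi> y)"
    and hom_scale: "x \<in> carrier S \<Longrightarrow> \<Phi> (sscale S c x) = sscale T c (\<Phi> x)"
    and hom_mult: "x \<in> carrier S \<Longrightarrow> y \<in> carrier S \<Longrightarrow> \<Phi> (smult S x y) = smult T (\<Phi> x) (\<Phi> y)"
    and hom_adj: "x \<in> carrier S \<Longrightarrow> \<Phi> (sadj S x) = sadj T (\<Phi> x)"
begin

lemma hom_sdiff: "x \<in> carrier S \<Longrightarrow> y \<in> carrier S \<Longrightarrow> \<Phi> (sdiff S x y) = sdiff T (\<Phi> x) (\<Phi> y)"
  by (simp add: sdiff_def hom_add hom_scale S.closed)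

lemma cstar_seminorm_pullback:
  "cstar_seminorm T q \<Longrightarrow> cstar_seminorm S (\<lambda>x. q (\<Phi> x))"
  by (simp add: cstar_seminorm_def S.closed hom_add hom_scale hom_mult hom_adj hom_closed)

text \<open>\<open>\<Phi>\<close> preserves distances, so sequences over \<open>S\<close> are Cauchy
  or equivalent exactly when their images are. Elements that \<open>\<Phi>\<close> identifies have
  distance zero and are already identified in the completion; density gives surjectivity.\<close>

theorem completion_isomorphic:
  assumes M: "star_seminorm T M"
    and NM: "\<And>x. x \<in> carrier S \<Longrightarrow> N x = M (\<Phi> x)"
    and dense: "\<And>y e. y \<in> carrier T \<Longrightarrow> 0 < e \<Longrightarrow> \<exists>x\<in>carrier S. M (sdiff T y (\<Phi> x)) < e"
  shows "cstar_isomorphic (hausdorff_completion T M) (hausdorff_completion S N)"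
proof -
  have N: "star_seminorm S N"
    using M by (simp add: star_seminorm_def NM S.closed hom_add hom_scale hom_mult hom_adj hom_closed)
  interpret N: seminormed_star_algebra S N by unfold_locales (rule N)
  interpret M: seminormed_star_algebra T M by unfold_locales (rule M)
  have d: "N.d x y = M.d (\<Phi> x) (\<Phi> y)" if "x \<in> carrier S" "y \<in> carrier S" for x y
    using that by (simp add: NM S.sdiff_closed hom_sdiff)
  have seq: "(\<lambda>n. \<Phi> (u n)) \<in> cauchy_seqs T M \<longleftrightarrow> u \<in> cauchy_seqs S N"
    if "\<And>n. u n \<in> carrier S" for u
    using that by (simp add: cauchy_seqs_def d hom_closed)
  have null: "M.null_dist (\<lambda>n. \<Phi> (u n)) (\<lambda>n. \<Phi> (v n)) \<longleftrightarrow> N.null_dist u v"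
    if "u \<in> cauchy_seqs S N" "v \<in> cauchy_seqs S N" for u v
    using that by (simp add: N.null_dist_def M.null_dist_def d N.cauchy_seqs_carrier)
  define \<phi> where "\<phi> U = (\<Union>u\<in>U. cauchy_class T M (\<lambda>n. \<Phi> (u n)))" for U
  have \<phi>: "\<phi> (cauchy_class S N u) = cauchy_class T M (\<lambda>n. \<Phi> (u n))"
    if u: "u \<in> cauchy_seqs S N" for u
  proof -
    have "cauchy_class T M (\<lambda>n. \<Phi> (v n)) = cauchy_class T M (\<lambda>n. \<Phi> (u n))"
      if "v \<in> cauchy_class S N u" for v
      using N.cauchy_classD[OF that] u null N.null_dist_sym
      by (subst M.cauchy_class_eq_iff) (auto simp: seq N.cauchy_seqs_carrier)
    then show ?thesis
      unfolding \<phi>_def using N.cauchy_class_self[OF u] by (intro SUP_eq_const) blast+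
  qed
  \<comment> \<open>The \<open>n\<close>-th term is approximated up to \<open>1 / (n + 1)\<close>.
    The images of the approximants stay Cauchy by an argument with thirds and differ from
    \<open>v\<close> by a null sequence.\<close>
  have onto: "\<exists>u\<in>cauchy_seqs S N. cauchy_class T M v = cauchy_class T M (\<lambda>n. \<Phi> (u n))"
    if v: "v \<in> cauchy_seqs T M" for v
  proof -
    have vc: "v n \<in> carrier T" for n using v by (rule M.cauchy_seqs_carrier)
    have "\<exists>x\<in>carrier S. M.d (v n) (\<Phi> x) < inverse (real (Suc n))" for n
      using dense[OF vc] by simp
    then obtain u where uc: "\<And>n. u n \<in> carrier S"
      and u: "\<And>n. M.d (v n) (\<Phi> (u n)) < inverse (real (Suc n))" by metis
    have \<Phi>uc: "\<Phi> (u n) \<in> carrier T" for n using uc hom_closed by blast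
    have "(\<lambda>n. \<Phi> (u n)) \<in> cauchy_seqs T M"
      unfolding cauchy_seqs_def
    proof (intro CollectI conjI allI impI \<Phi>uc)
      fix e :: real assume "0 < e"
      then have e: "0 < e / 3" by simp
      obtain K where K: "\<And>m n. K \<le> m \<Longrightarrow> K \<le> n \<Longrightarrow> M.d (v m) (v n) < e / 3"
        using v e unfolding cauchy_seqs_def by blast
      obtain K' where K': "inverse (real (Suc K')) < e / 3"
        using reals_Archimedean[OF e] by blast
      have small: "M.d (v n) (\<Phi> (u n)) < e / 3" if "K' \<le> n" for n
      proof -
        have "inverse (real (Suc n)) \<le> inverse (real (Suc K'))" using that by (simp add: le_imp_inverse_le)
        with u[of n] K' show ?thesis by linarith
      qed
      have "M.d (\<Phi> (u m)) (\<Phi> (u n)) < e" if "max K K' \<le> m" "max K K' \<le> n" for m n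
        using M.d_triangle[of "\<Phi> (u m)" "v m" "\<Phi> (u n)"] M.d_triangle[of "v m" "v n" "\<Phi> (u n)"]
          K[of m n] small[of m] small[of n] that M.d_commute[of "\<Phi> (u m)" "v m"] \<Phi>uc vc by auto
      then show "\<exists>K. \<forall>m\<ge>K. \<forall>n\<ge>K. M.d (\<Phi> (u m)) (\<Phi> (u n)) < e" by blast
    qed
    moreover have "M.null_dist v (\<lambda>n. \<Phi> (u n))"
      using vc \<Phi>uc LIMSEQ_inverse_real_of_nat less_imp_le[OF u] by (rule M.null_distI)
    ultimately show ?thesis
      using v uc seq[OF uc] by (intro bexI[of _ u]) (simp_all add: M.cauchy_class_eq_iff)
  qed
  have "cstar_isomorphic (hausdorff_completion S N) (hausdorff_completion T M)"
    unfolding cstar_isomorphic_def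
  proof (intro exI[of _ \<phi>] conjI ballI allI)
    show "bij_betw \<phi> (carrier (hausdorff_completion S N)) (carrier (hausdorff_completion T M))"
    proof (rule bij_betwI')
      show "\<phi> U \<in> carrier (hausdorff_completion T M)" if "U \<in> carrier (hausdorff_completion S N)" for U
        using that by (auto simp: N.completion_carrier M.completion_carrier \<phi> seq N.cauchy_seqs_carrier)
      show "\<exists>U\<in>carrier (hausdorff_completion S N). V = \<phi> U"
        if V: "V \<in> carrier (hausdorff_completion T M)" for V
      proof -
        from V obtain v where v: "v \<in> cauchy_seqs T M" "V = cauchy_class T M v"
          by (auto simp: M.completion_carrier)
        from onto[OF v(1)] obtain u where u: "u \<in> cauchy_seqs S N"
          and eq: "cauchy_class T M v = cauchy_class T M (\<lambda>n. \<Phi> (u n))" by blast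
        have "V = \<phi> (cauchy_class S N u)" unfolding \<phi>[OF u] v eq ..
        moreover have "cauchy_class S N u \<in> carrier (hausdorff_completion S N)"
          using u N.completion_carrier by blast
        ultimately show ?thesis by (rule bexI)
      qed
      show "(\<phi> U = \<phi> V) = (U = V)"
        if UV: "U \<in> carrier (hausdorff_completion S N)" "V \<in> carrier (hausdorff_completion S N)" for U V
      proof -
        obtain u v where u: "u \<in> cauchy_seqs S N" "U = cauchy_class S N u"
          and v: "v \<in> cauchy_seqs S N" "V = cauchy_class S N v"
          using UV unfolding N.completion_carrier by blast
        have "(\<lambda>n. \<Phi> (u n)) \<in> cauchy_seqs T M" "(\<lambda>n. \<Phi> (v n)) \<in> cauchy_seqs T M"
          using u v seq N.cauchy_seqs_carrier by blast+
        then show ?thesis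
          unfolding u(2) v(2) \<phi>[OF u(1)] \<phi>[OF v(1)] N.cauchy_class_eq_iff[OF u(1) v(1)]
          by (simp add: M.cauchy_class_eq_iff null[OF u(1) v(1)])
      qed
    qed
    fix U assume "U \<in> carrier (hausdorff_completion S N)"
    then obtain u where u: "u \<in> cauchy_seqs S N" "U = cauchy_class S N u"
      by (auto simp: N.completion_carrier)
    note uc = N.cauchy_seqs_carrier[OF u(1)]
    have \<Phi>u: "(\<lambda>n. \<Phi> (u n)) \<in> cauchy_seqs T M" using u uc by (simp add: seq)
    show "\<phi> (sscale (hausdorff_completion S N) c U) = sscale (hausdorff_completion T M) c (\<phi> U)" for c
      using u \<Phi>u by (simp add: N.completion_ops M.completion_ops \<phi> N.cauchy_seqs_scale hom_scale uc)
    show "\<phi> (sadj (hausdorff_completion S N) U) = sadj (hausdorff_completion T M) (\<phi> U)"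
      using u \<Phi>u by (simp add: N.completion_ops M.completion_ops \<phi> N.cauchy_seqs_adj hom_adj uc)
    show "snorm (hausdorff_completion T M) (\<phi> U) = snorm (hausdorff_completion S N) U"
      using u \<Phi>u by (simp add: N.completion_ops M.completion_ops \<phi> NM uc)
    fix V assume "V \<in> carrier (hausdorff_completion S N)"
    then obtain v where v: "v \<in> cauchy_seqs S N" "V = cauchy_class S N v"
      by (auto simp: N.completion_carrier)
    note vc = N.cauchy_seqs_carrier[OF v(1)]
    have \<Phi>v: "(\<lambda>n. \<Phi> (v n)) \<in> cauchy_seqs T M" using v vc by (simp add: seq)
    show "\<phi> (sadd (hausdorff_completion S N) U V) = sadd (hausdorff_completion T M) (\<phi> U) (\<phi> V)"
      using u v \<Phi>u \<Phi>v
      by (simp add: N.completion_ops M.completion_ops \<phi> N.cauchy_seqs_add hom_add uc vc)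
    show "\<phi> (smult (hausdorff_completion S N) U V) = smult (hausdorff_completion T M) (\<phi> U) (\<phi> V)"
      using u v \<Phi>u \<Phi>v
      by (simp add: N.completion_ops M.completion_ops \<phi> N.cauchy_seqs_mult hom_mult uc vc)
  qed
  then show ?thesis
    by (rule cstar_isomorphic_sym) (simp add: N.completion_closed)
qed

text \<open>By \<open>le\<close>, the variation of \<open>p\<close> is at most the distance of the
  images for \<open>\<nu>\<close> (\<open>pd\<close>). So \<open>p\<close> factors through
  \<open>\<Phi>\<close> as a Lipschitz function on a dense set and extends by limits, under which
  every axiom of a C*-seminorm is preserved.\<close>

theorem cstar_seminorm_extend:
  assumes p: "cstar_seminorm S p" and \<nu>: "star_seminorm T \<nu>"
    and le: "\<And>x. x \<in> carrier S \<Longrightarrow> p x \<le> \<nu> (\<Phi> x)"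
    and dense: "\<And>y e. y \<in> carrier T \<Longrightarrow> 0 < e \<Longrightarrow> \<exists>x\<in>carrier S. \<nu> (sdiff T y (\<Phi> x)) < e"
  obtains q where "cstar_seminorm T q" "\<And>x. x \<in> carrier S \<Longrightarrow> q (\<Phi> x) = p x"
proof -
  interpret p: seminormed_star_algebra S p by unfold_locales (use p in \<open>simp add: cstar_seminorm_iff\<close>)
  interpret \<nu>: seminormed_star_algebra T \<nu> by unfold_locales (rule \<nu>)
  define approx where "approx u y \<longleftrightarrow>
    (\<forall>n. u n \<in> carrier S) \<and> (\<lambda>n. \<nu>.d y (\<Phi> (u n))) \<longlonglongrightarrow> 0" for u y
  have "\<exists>u. approx u y" if y: "y \<in> carrier T" for y
  proof -
    have "\<exists>x\<in>carrier S. \<nu>.d y (\<Phi> x) < inverse (real (Suc n))" for n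
      using dense[OF y] by simp
    then obtain u where u: "\<And>n. u n \<in> carrier S"
      "\<And>n. \<nu>.d y (\<Phi> (u n)) < inverse (real (Suc n))" by metis
    have "\<nu>.null_dist (\<lambda>_. y) (\<lambda>n. \<Phi> (u n))"
      using y u hom_closed less_imp_le[OF u(2)]
      by (intro \<nu>.null_distI[OF _ _ LIMSEQ_inverse_real_of_nat]) auto
    then show ?thesis using u by (auto simp: approx_def \<nu>.null_dist_def)
  qed
  then obtain A where A: "\<And>y. y \<in> carrier T \<Longrightarrow> approx (A y) y" by metis
  have pd: "\<bar>p x - p x'\<bar> \<le> \<nu>.d y (\<Phi> x) + \<nu>.d y (\<Phi> x')"
    if "x \<in> carrier S" "x' \<in> carrier S" "y \<in> carrier T" for x x' y
  proof -
    have "\<bar>p x - p x'\<bar> \<le> p.d x x'" using that by (intro p.abs_diff_le_d)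
    also have "\<dots> \<le> \<nu>.d (\<Phi> x) (\<Phi> x')"
      using le[of "sdiff S x x'"] that by (simp add: S.sdiff_closed hom_sdiff)
    also have "\<dots> \<le> \<nu>.d y (\<Phi> x) + \<nu>.d y (\<Phi> x')"
      using \<nu>.d_triangle[of "\<Phi> x" y "\<Phi> x'"] \<nu>.d_commute[of y "\<Phi> x"] that by (simp add: hom_closed)
    finally show ?thesis .
  qed
  \<comment> \<open>The limit is taken along one chosen sequence \<open>A y\<close>. The fact
    \<open>q\<close> shows that all approximating sequences give the same limit, so each axiom can
    be checked on the sequence built by the operation concerned.\<close>
  define q where "q y = lim (\<lambda>n. p (A y n))" for y
  have q0: "(\<lambda>n. p (A y n)) \<longlonglongrightarrow> q y" if y: "y \<in> carrier T" for y
  proof -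
    have "Cauchy (\<lambda>n. p (A y n))"
      unfolding Cauchy_def dist_real_def
    proof (intro allI impI)
      fix e :: real assume "0 < e"
      then have "eventually (\<lambda>n. \<nu>.d y (\<Phi> (A y n)) < e / 2) sequentially"
        using A[OF y] by (intro order_tendstoD(2)[of _ 0]) (auto simp: approx_def)
      then obtain K where K: "\<And>n. K \<le> n \<Longrightarrow> \<nu>.d y (\<Phi> (A y n)) < e / 2"
        by (auto simp: eventually_sequentially)
      have "\<bar>p (A y m) - p (A y n)\<bar> < e" if "K \<le> m" "K \<le> n" for m n
        using pd[of "A y m" "A y n" y] K[OF that(1)] K[OF that(2)] A[OF y] y
        by (auto simp: approx_def)
      then show "\<exists>K. \<forall>m\<ge>K. \<forall>n\<ge>K. \<bar>p (A y m) - p (A y n)\<bar> < e" by blast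
    qed
    then show ?thesis by (simp add: q_def Cauchy_convergent_iff convergent_LIMSEQ_iff)
  qed
  have q: "(\<lambda>n. p (u n)) \<longlonglongrightarrow> q y" if y: "y \<in> carrier T" and u: "approx u y" for u y
  proof -
    have *: "(\<lambda>n. \<nu>.d y (\<Phi> (u n)) + \<nu>.d y (\<Phi> (A y n))) \<longlonglongrightarrow> 0 + 0"
      using u A[OF y] by (intro tendsto_add) (auto simp: approx_def)
    have "(\<lambda>n. p (u n) - p (A y n)) \<longlonglongrightarrow> 0"
    proof (rule Lim_null_comparison)
      show "(\<lambda>n. \<nu>.d y (\<Phi> (u n)) + \<nu>.d y (\<Phi> (A y n))) \<longlonglongrightarrow> 0" using * by simp
      show "\<forall>\<^sub>F n in sequentially. norm (p (u n) - p (A y n)) \<le> \<nu>.d y (\<Phi> (u n)) + \<nu>.d y (\<Phi> (A y n))"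
        unfolding real_norm_def using u A[OF y] y
        by (intro always_eventually allI pd) (auto simp: approx_def)
    qed
    from tendsto_add[OF this q0[OF y]] show ?thesis by simp
  qed
  have approxI: "approx w z" if "\<And>n. w n \<in> carrier S" "z \<in> carrier T"
    "f \<longlonglongrightarrow> 0" "\<And>n. \<nu>.d z (\<Phi> (w n)) \<le> f n" for w z f
    using \<nu>.null_distI[OF that(2) hom_closed[OF that(1)] that(3,4)] that(1)
    by (simp add: approx_def \<nu>.null_dist_def)
  have \<nu>lim: "(\<lambda>n. \<nu> (\<Phi> (u n))) \<longlonglongrightarrow> \<nu> y" if y: "y \<in> carrier T" and u: "approx u y" for u y
  proof -
    have uc: "u n \<in> carrier S" for n using u by (simp add: approx_def)
    have "(\<lambda>n. \<nu> (\<Phi> (u n)) - \<nu> y) \<longlonglongrightarrow> 0"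
    proof (rule Lim_null_comparison)
      show "(\<lambda>n. \<nu>.d y (\<Phi> (u n))) \<longlonglongrightarrow> 0" using u by (simp add: approx_def)
      show "\<forall>\<^sub>F n in sequentially. norm (\<nu> (\<Phi> (u n)) - \<nu> y) \<le> \<nu>.d y (\<Phi> (u n))"
        using \<nu>.abs_diff_le_d[OF y hom_closed[OF uc]] by (simp add: abs_minus_commute)
    qed
    from tendsto_add[OF this tendsto_const[of "\<nu> y"]] show ?thesis by simp
  qed
  have add: "approx (\<lambda>n. sadd S (u n) (v n)) (sadd T x y)"
    if "x \<in> carrier T" "y \<in> carrier T" "approx u x" "approx v y" for u v x y
    using that tendsto_add[of "\<lambda>n. \<nu>.d x (\<Phi> (u n))" 0 sequentially "\<lambda>n. \<nu>.d y (\<Phi> (v n))" 0]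
    by (intro approxI[where f = "\<lambda>n. \<nu>.d x (\<Phi> (u n)) + \<nu>.d y (\<Phi> (v n))"])
      (auto simp: approx_def S.closed T.closed hom_add hom_closed intro!: \<nu>.d_add)
  have scale: "approx (\<lambda>n. sscale S c (u n)) (sscale T c x)" if "x \<in> carrier T" "approx u x" for u x c
    using that tendsto_mult_right_zero[of "\<lambda>n. \<nu>.d x (\<Phi> (u n))" sequentially "cmod c"]
    by (intro approxI[where f = "\<lambda>n. cmod c * \<nu>.d x (\<Phi> (u n))"])
      (auto simp: approx_def S.closed T.closed hom_scale hom_closed \<nu>.d_scale)
  have adj: "approx (\<lambda>n. sadj S (u n)) (sadj T x)" if "x \<in> carrier T" "approx u x" for u x
    using that by (intro approxI[where f = "\<lambda>n. \<nu>.d x (\<Phi> (u n))"])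
      (auto simp: approx_def S.closed T.closed hom_adj hom_closed \<nu>.d_adj)
  have mult: "approx (\<lambda>n. smult S (u n) (v n)) (smult T x y)"
    if "x \<in> carrier T" "y \<in> carrier T" "approx u x" "approx v y" for u v x y
    using that tendsto_add[OF tendsto_mult[OF tendsto_const[of "\<nu> x"], of "\<lambda>n. \<nu>.d y (\<Phi> (v n))" 0]
        tendsto_mult[OF _ \<nu>lim[OF that(2,4)], of "\<lambda>n. \<nu>.d x (\<Phi> (u n))" 0]]
    by (intro approxI[where f = "\<lambda>n. \<nu> x * \<nu>.d y (\<Phi> (v n)) + \<nu>.d x (\<Phi> (u n)) * \<nu> (\<Phi> (v n))"])
      (auto simp: approx_def S.closed T.closed hom_mult hom_closed intro!: \<nu>.d_mult)
  have c: "A x n \<in> carrier S" if "x \<in> carrier T" for x n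
    using A[OF that] by (simp add: approx_def)
  have "cstar_seminorm T q"
    unfolding cstar_seminorm_def
  proof (intro conjI ballI allI)
    fix x assume x: "x \<in> carrier T"
    note qx = q0[OF x]
    show "0 \<le> q x"
      by (rule LIMSEQ_le_const[OF qx]) (use c[OF x] p.nonneg in auto)
    show "q (sscale T a x) = cmod a * q x" for a
      using q[OF T.scale_closed[OF x] scale[OF x A[OF x]], of a]
        tendsto_mult[OF tendsto_const[of "cmod a"] qx] c[OF x]
      by (simp add: p.scale LIMSEQ_unique)
    show "q (sadj T x) = q x"
      using q[OF T.adj_closed[OF x] adj[OF x A[OF x]]] qx c[OF x]
      by (simp add: p.norm_adj LIMSEQ_unique)
    show "q (smult T (sadj T x) x) = (q x)\<^sup>2"
    proof -
      have "p (smult S (sadj S y) y) = (p y)\<^sup>2" if "y \<in> carrier S" for y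
        using p that by (simp add: cstar_seminorm_def)
      then show ?thesis
        using q[OF T.mult_closed[OF T.adj_closed[OF x] x]
            mult[OF T.adj_closed[OF x] x adj[OF x A[OF x]] A[OF x]]] tendsto_power[OF qx, of 2] c[OF x]
        by (simp add: LIMSEQ_unique)
    qed
    fix y assume y: "y \<in> carrier T"
    note qy = q0[OF y]
    show "q (sadd T x y) \<le> q x + q y"
      using c[OF x] c[OF y]
      by (intro LIMSEQ_le[OF q[OF T.add_closed[OF x y] add[OF x y A[OF x] A[OF y]]] tendsto_add[OF qx qy]])
        (auto intro!: p.triangle)
    show "q (smult T x y) \<le> q x * q y"
      using c[OF x] c[OF y]
      by (intro LIMSEQ_le[OF q[OF T.mult_closed[OF x y] mult[OF x y A[OF x] A[OF y]]] tendsto_mult[OF qx qy]])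
        (auto intro!: p.submult)
  qed
  moreover have "q (\<Phi> x) = p x" if "x \<in> carrier S" for x
  proof -
    have "approx (\<lambda>_. x) (\<Phi> x)" using that by (simp add: approx_def hom_closed \<nu>.d_self)
    from q[OF hom_closed[OF that] this] show ?thesis by (simp add: LIMSEQ_const_iff)
  qed
  ultimately show thesis by (rule that)
qed

end

text \<open>Boundedness makes the real-valued \<open>SUP\<close> an upper bound and
  \<open>P \<noteq> {}\<close> makes it the least one. Homogeneity takes two estimates, the lower
  one by division by \<open>cmod c\<close>, with \<open>c = 0\<close> settled by
  nonnegativity.\<close>

lemma star_seminorm_SUP:
  assumes S: "star_algebra S" and ne: "P \<noteq> {}"
    and P: "\<And>p. p \<in> P \<Longrightarrow> star_seminorm S p"
    and bdd: "\<And>x. x \<in> carrier S \<Longrightarrow> bdd_above ((\<lambda>p. p x) ` P)"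
  shows "star_seminorm S (\<lambda>x. SUP p\<in>P. p x)"
proof -
  interpret star_algebra S by (rule S)
  define N where "N x = (SUP p\<in>P. p x)" for x
  have P: "0 \<le> p x" "p (sadd S x y) \<le> p x + p y" "p (sscale S c x) = cmod c * p x"
    "p (smult S x y) \<le> p x * p y" "p (sadj S x) = p x"
    if "p \<in> P" "x \<in> carrier S" "y \<in> carrier S" for p x y c
    using P[OF that(1)] that(2,3) by (simp_all add: star_seminorm_def)
  have up: "p x \<le> N x" if "p \<in> P" "x \<in> carrier S" for p x
    unfolding N_def using bdd that by (intro cSUP_upper)
  have least: "N x \<le> b" if "\<And>p. p \<in> P \<Longrightarrow> p x \<le> b" for x b
    unfolding N_def using ne that by (intro cSUP_least)
  have nonneg: "0 \<le> N x" if "x \<in> carrier S" for x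
    using ne P(1)[OF _ that that] up[OF _ that] by (meson ex_in_conv order_trans)
  have "N (sscale S c x) = cmod c * N x" if x: "x \<in> carrier S" for c x
  proof (rule antisym)
    show "N (sscale S c x) \<le> cmod c * N x"
    proof (rule least)
      fix p assume p: "p \<in> P"
      show "p (sscale S c x) \<le> cmod c * N x"
        unfolding P(3)[OF p x x] using up[OF p x] by (simp add: mult_left_mono)
    qed
    show "cmod c * N x \<le> N (sscale S c x)"
    proof (cases "c = 0")
      case False
      have "N x \<le> N (sscale S c x) / cmod c"
      proof (rule least)
        fix p assume p: "p \<in> P"
        show "p x \<le> N (sscale S c x) / cmod c"
          using up[OF p scale_closed[OF x]] False unfolding P(3)[OF p x x] by (simp add: field_simps)
      qed
      with False show ?thesis by (simp add: field_simps)
    qed (simp add: nonneg scale_closed x)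
  qed
  moreover have "N (sadd S x y) \<le> N x + N y" if "x \<in> carrier S" "y \<in> carrier S" for x y
    using P(2) that up by (intro least) (meson add_mono order_trans)
  moreover have "N (smult S x y) \<le> N x * N y" if "x \<in> carrier S" "y \<in> carrier S" for x y
    using P(1,4) that up nonneg by (intro least) (meson mult_mono order_trans)
  moreover have "N (sadj S x) = N x" if "x \<in> carrier S" for x
    unfolding N_def using P(5)[OF _ that that] by (intro SUP_cong) auto
  ultimately show ?thesis
    using nonneg unfolding star_seminorm_def N_def[symmetric] by blast
qed

lemma cstar_seminorm_zero: "cstar_seminorm S (\<lambda>_. 0)"
  by (simp add: cstar_seminorm_def)

section \<open>Crossed products of commutative algebras\<close>

definition delta :: "'a::zero \<Rightarrow> 't \<Rightarrow> 't \<Rightarrow> 'a"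
  where "delta a t = (\<lambda>s. if s = t then a else 0)"

lemma delta_zero [simp]: "delta 0 t = (\<lambda>_. 0)"
  by (auto simp: delta_def)

definition l1_norm :: "('t \<Rightarrow> 'a::real_normed_vector) \<Rightarrow> real"
  where "l1_norm f = (\<Sum>t | f t \<noteq> 0. norm (f t))"

lemma l1_norm_eq:
  assumes "finite A" "{t. f t \<noteq> 0} \<subseteq> A"
  shows "l1_norm f = (\<Sum>t\<in>A. norm (f t))"
  unfolding l1_norm_def by (rule sum.mono_neutral_left) (use assms in auto)

locale comm_partial_action = partial_action G D \<tau>
  for G :: "('t, 'm) monoid_scheme" (structure)
    and D :: "'t \<Rightarrow> 'a::{cstar_algebra, comm_ring} set" and \<tau> :: "'t \<Rightarrow> 'a \<Rightarrow> 'a" +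
  assumes gen: "generated_by_projections TYPE('a)"
begin

section \<open>The isomorphisms of a partial action\<close>

lemmas D_simps = cstar_idealD[OF ideal_D]

lemma D_adj: "t \<in> carrier G \<Longrightarrow> x \<in> D t \<Longrightarrow> adj x \<in> D t"
  by (rule ideal_adj[OF gen ideal_D])

lemma \<tau>_closed: "s \<in> carrier G \<Longrightarrow> x \<in> D (inv s) \<Longrightarrow> \<tau> s x \<in> D s"
  using iso_\<tau>[of s] by (auto simp: star_iso_on_def bij_betw_def)

lemma \<tau>_add: "s \<in> carrier G \<Longrightarrow> x \<in> D (inv s) \<Longrightarrow> y \<in> D (inv s) \<Longrightarrow> \<tau> s (x + y) = \<tau> s x + \<tau> s y"
  and \<tau>_mult: "s \<in> carrier G \<Longrightarrow> x \<in> D (inv s) \<Longrightarrow> y \<in> D (inv s) \<Longrightarrow> \<tau> s (x * y) = \<tau> s x * \<tau> s y"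
  and \<tau>_adj: "s \<in> carrier G \<Longrightarrow> x \<in> D (inv s) \<Longrightarrow> \<tau> s (adj x) = adj (\<tau> s x)"
  and \<tau>_cscale: "s \<in> carrier G \<Longrightarrow> x \<in> D (inv s) \<Longrightarrow> \<tau> s (cscale c x) = cscale c (\<tau> s x)"
  using iso_\<tau>[of s] by (auto simp: star_iso_on_def)

lemma \<tau>_zero [simp]: "s \<in> carrier G \<Longrightarrow> \<tau> s 0 = 0"
  using \<tau>_cscale[of s 0 0] by (simp add: D_simps)

lemma \<tau>_diff:
  "s \<in> carrier G \<Longrightarrow> x \<in> D (inv s) \<Longrightarrow> y \<in> D (inv s) \<Longrightarrow> \<tau> s (x - y) = \<tau> s x - \<tau> s y"
  using \<tau>_add[of s "x - y" y] by (simp add: D_simps)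

lemma \<tau>_inv_\<tau>: "s \<in> carrier G \<Longrightarrow> x \<in> D (inv s) \<Longrightarrow> \<tau> (inv s) (\<tau> s x) = x"
  using \<tau>_\<tau>[of "inv s" s x] by (simp add: D_one \<tau>_one)

lemma \<tau>_\<tau>_inv: "s \<in> carrier G \<Longrightarrow> x \<in> D s \<Longrightarrow> \<tau> s (\<tau> (inv s) x) = x"
  using \<tau>_inv_\<tau>[of "inv s" x] by simp

lemma \<tau>_inv_closed: "s \<in> carrier G \<Longrightarrow> x \<in> D s \<Longrightarrow> \<tau> (inv s) x \<in> D (inv s)"
  using \<tau>_closed[of "inv s" x] by simp

lemma \<tau>_in:
  assumes "s \<in> carrier G" "t \<in> carrier G" "x \<in> D (inv s)" "x \<in> D t"
  shows "\<tau> s x \<in> D (s \<otimes> t)"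
  using image_\<tau>[of s t] assms by blast

text \<open>\<open>x \<mapsto> norm (\<tau> s x)\<close> is a C*-seminorm on the ideal
  \<open>D (inv s)\<close>, hence bounded by the norm. Applied to \<open>inv s\<close> as well, this
  makes \<open>\<tau> s\<close> isometric.\<close>

lemma norm_\<tau>_le:
  assumes s: "s \<in> carrier G" and x: "x \<in> D (inv s)"
  shows "norm (\<tau> s x) \<le> norm x"
proof (rule cstar_seminorm_le_norm[where q = "\<lambda>x. norm (\<tau> s x)"])
  show "cstar_ideal (D (inv s))" using s by (simp add: ideal_D)
  fix x y c assume x: "x \<in> D (inv s)"
  show "norm (\<tau> s (cscale c x)) = cmod c * norm (\<tau> s x)"
    using s x by (simp add: \<tau>_cscale norm_cscale)
  show "norm (\<tau> s (adj x * x)) = (norm (\<tau> s x))\<^sup>2"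
    using s x by (simp add: \<tau>_mult \<tau>_adj D_adj norm_adj_mult)
  assume "y \<in> D (inv s)"
  with x show "norm (\<tau> s (x + y)) \<le> norm (\<tau> s x) + norm (\<tau> s y)"
    using s by (simp add: \<tau>_add norm_triangle_ineq)
qed (use x in auto)

lemma norm_\<tau>:
  assumes s: "s \<in> carrier G" and x: "x \<in> D (inv s)"
  shows "norm (\<tau> s x) = norm x"
  using norm_\<tau>_le[OF assms] norm_\<tau>_le[of "inv s" "\<tau> s x"] assms
  by (simp add: \<tau>_inv_\<tau> \<tau>_closed)

lemma is_projection_\<tau>:
  "s \<in> carrier G \<Longrightarrow> q \<in> D (inv s) \<Longrightarrow> is_projection q \<Longrightarrow> is_projection (\<tau> s q)"
  unfolding is_projection_def by (metis \<tau>_mult \<tau>_adj)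

text \<open>\<open>(a \<delta>\<^sub>s) (b \<delta>\<^sub>t) = tmul s a b \<delta>\<^sub>s\<^sub>t\<close>\<close>

definition tmul :: "'t \<Rightarrow> 'a \<Rightarrow> 'a \<Rightarrow> 'a"
  where "tmul s a b = \<tau> s (\<tau> (inv s) a * b)"

lemma tmul_arg: "s \<in> carrier G \<Longrightarrow> a \<in> D s \<Longrightarrow> \<tau> (inv s) a * b \<in> D (inv s)"
  by (simp add: D_simps \<tau>_inv_closed)

lemma tmul_closed:
  "s \<in> carrier G \<Longrightarrow> t \<in> carrier G \<Longrightarrow> a \<in> D s \<Longrightarrow> b \<in> D t \<Longrightarrow> tmul s a b \<in> D (s \<otimes> t)"
  unfolding tmul_def by (intro \<tau>_in tmul_arg) (simp_all add: D_simps)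

lemma tmul_closed1: "s \<in> carrier G \<Longrightarrow> a \<in> D s \<Longrightarrow> tmul s a b \<in> D s"
  unfolding tmul_def by (intro \<tau>_closed tmul_arg)

lemma tmul_zero [simp]: "s \<in> carrier G \<Longrightarrow> tmul s 0 b = 0" "s \<in> carrier G \<Longrightarrow> tmul s a 0 = 0"
  by (simp_all add: tmul_def)

lemma tmul_diff:
  assumes "s \<in> carrier G" "a \<in> D s" "a' \<in> D s"
  shows "tmul s a b - tmul s a' b' = tmul s a (b - b') + tmul s (a - a') b'"
  using assms by (simp add: tmul_def \<tau>_diff \<tau>_inv_closed tmul_arg ring_distribs)

lemma tmul_cscale:
  assumes "s \<in> carrier G" "a \<in> D s"
  shows "tmul s (cscale c a) (cscale d b) = cscale (c * d) (tmul s a b)"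
  using assms
  by (simp add: tmul_def \<tau>_cscale \<tau>_inv_closed tmul_arg mult_cscale_left mult_cscale_right
      cscale_cscale D_simps mult.commute[of d])

lemma norm_tmul:
  assumes "s \<in> carrier G" "a \<in> D s"
  shows "norm (tmul s a b) \<le> norm a * norm b"
  using assms norm_mult_ineq[of "\<tau> (inv s) a" b] norm_\<tau>[of "inv s" a]
  by (simp add: tmul_def norm_\<tau> tmul_arg)

lemma is_projection_tmul:
  assumes "s \<in> carrier G" "a \<in> D s" "is_projection a" "is_projection b"
  shows "is_projection (tmul s a b)"
  using assms unfolding tmul_def
  by (intro is_projection_\<tau> tmul_arg is_projection_mult) simp_all

text \<open>The difficulty is to move \<open>a' = \<tau> (inv s) a\<close> through
  \<open>\<tau> t\<close>, as \<open>a'\<close> need not lie in \<open>D t\<close>. The product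
  \<open>a' * b\<close> does, and since \<open>b\<close> is idempotent a copy of it stays behind as
  a unit for the other factor. Images of words have projection coefficients, so this case serves
  them.\<close>

lemma tmul_assoc:
  assumes s: "s \<in> carrier G" and t: "t \<in> carrier G" and a: "a \<in> D s" and b: "b \<in> D t"
    and pb: "is_projection b"
  shows "tmul (s \<otimes> t) (tmul s a b) c = tmul s a (tmul t b c)"
proof -
  define a' where "a' = \<tau> (inv s) a"
  have a': "a' \<in> D (inv s)" using s a by (simp add: a'_def \<tau>_inv_closed)
  define x where "x = a' * b"
  have x: "x \<in> D (inv s)" "x \<in> D t" using s t a' b by (simp_all add: x_def D_simps)
  have \<tau>sx: "\<tau> s x \<in> D s" "\<tau> s x \<in> D (s \<otimes> t)"
    using s t x by (auto intro: \<tau>_closed \<tau>_in)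
  have "\<tau> (inv t) (\<tau> (inv s) (\<tau> s x)) = \<tau> (inv t \<otimes> inv s) (\<tau> s x)"
    using s t \<tau>sx by (intro \<tau>_\<tau>) (auto simp: inv_mult_group)
  then have inner: "\<tau> (inv (s \<otimes> t)) (\<tau> s x) = \<tau> (inv t) x"
    using s t x by (simp add: inv_mult_group \<tau>_inv_\<tau>)
  define z where "z = \<tau> (inv t) x * c"
  have "\<tau> (inv t) x \<in> D (inv t \<otimes> inv s)"
    using s t x by (intro \<tau>_in) auto
  then have z: "z \<in> D (inv t)" "z \<in> D (inv (s \<otimes> t))"
    using s t x by (simp_all add: z_def D_simps \<tau>_inv_closed inv_mult_group)
  have "tmul (s \<otimes> t) (tmul s a b) c = \<tau> (s \<otimes> t) z"
    by (simp add: tmul_def inner z_def flip: a'_def x_def)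
  also have "\<dots> = \<tau> s (\<tau> t z)"
    using s t z by (simp add: \<tau>_\<tau>)
  also have "\<tau> t z = a' * \<tau> t (\<tau> (inv t) b * c)"
  proof -
    note bb = projection_simps[OF pb]
    have b': "\<tau> (inv t) b \<in> D (inv t)" using t b by (simp add: \<tau>_inv_closed)
    \<comment> \<open>The copy of \<open>b\<close> is split off here; its image under
      \<open>\<tau> (inv t)\<close> is grouped with \<open>c\<close> and carried back by
      \<open>\<tau> t\<close>.\<close>
    have "x = x * b" by (simp add: x_def bb mult.assoc)
    then have "\<tau> (inv t) x = \<tau> (inv t) x * \<tau> (inv t) b"
      using \<tau>_mult[of "inv t" x b] t x b by simp
    then have "z = \<tau> (inv t) x * (\<tau> (inv t) b * c)" unfolding z_def by (metis mult.assoc)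
    then have "\<tau> t z = x * \<tau> t (\<tau> (inv t) b * c)"
      using t x b b' by (simp add: \<tau>_mult \<tau>_\<tau>_inv \<tau>_inv_closed D_simps)
    also have "\<dots> = a' * (b * \<tau> t (\<tau> (inv t) b * c))" by (simp add: x_def mult.assoc)
    also have "b * \<tau> t (\<tau> (inv t) b * c) = \<tau> t (\<tau> (inv t) b * (\<tau> (inv t) b * c))"
      using t b b' by (simp add: \<tau>_mult \<tau>_\<tau>_inv D_simps)
    also have "\<tau> (inv t) b * (\<tau> (inv t) b * c) = \<tau> (inv t) b * c"
      using t b is_projection_\<tau>[of "inv t" b] pb by (simp add: projection_simps(2))
    finally show ?thesis .
  qed
  finally show ?thesis by (simp add: tmul_def a'_def)
qed

text \<open>The coefficient identity behind the rule for the adjoint of a product of two monomials.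
  Both sides equal \<open>\<tau> (inv t) x\<close>.\<close>

lemma tmul_adj:
  assumes s: "s \<in> carrier G" and t: "t \<in> carrier G" and a: "a \<in> D s" and b: "b \<in> D t"
  shows "\<tau> (inv (s \<otimes> t)) (adj (tmul s a b)) = tmul (inv t) (\<tau> (inv t) (adj b)) (\<tau> (inv s) (adj a))"
proof -
  define x where "x = \<tau> (inv s) (adj a) * adj b"
  have x: "x \<in> D (inv s)" "x \<in> D t"
    using s t a b by (simp_all add: x_def D_simps \<tau>_inv_closed D_adj)
  have \<tau>sx: "\<tau> s x \<in> D s" "\<tau> s x \<in> D (s \<otimes> t)"
    using s t x by (auto intro: \<tau>_closed \<tau>_in)
  have "adj (tmul s a b) = \<tau> s (adj (\<tau> (inv s) a * b))"
    using s a b by (simp add: tmul_def \<tau>_adj tmul_arg)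
  also have "adj (\<tau> (inv s) a * b) = x"
    using s a by (simp add: x_def adj_mult \<tau>_adj mult.commute)
  finally have "\<tau> (inv (s \<otimes> t)) (adj (tmul s a b)) = \<tau> (inv t \<otimes> inv s) (\<tau> s x)"
    using s t by (simp add: inv_mult_group)
  also have "\<dots> = \<tau> (inv t) (\<tau> (inv s) (\<tau> s x))"
    using s t \<tau>sx by (intro \<tau>_\<tau>[symmetric]) (auto simp: inv_mult_group)
  also have "\<dots> = \<tau> (inv t) x" using s x by (simp add: \<tau>_inv_\<tau>)
  also have "\<dots> = tmul (inv t) (\<tau> (inv t) (adj b)) (\<tau> (inv s) (adj a))"
    using t b by (simp add: tmul_def x_def \<tau>_\<tau>_inv D_adj mult.commute)
  finally show ?thesis .
qed

section \<open>The algebraic crossed product as a star-algebra\<close>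

abbreviation CP where "CP \<equiv> algebraic_crossed_product G D \<tau>"

lemma CP_carrier: "f \<in> carrier CP \<longleftrightarrow> finite {t. f t \<noteq> 0} \<and>
    (\<forall>t\<in>carrier G. f t \<in> D t) \<and> (\<forall>t. t \<notin> carrier G \<longrightarrow> f t = 0)"
  by (simp add: algebraic_crossed_product_def)

lemma CP_D: "f \<in> carrier CP \<Longrightarrow> t \<in> carrier G \<Longrightarrow> f t \<in> D t"
  and CP_finite: "f \<in> carrier CP \<Longrightarrow> finite {t. f t \<noteq> 0}"
  and CP_supp: "f \<in> carrier CP \<Longrightarrow> {t. f t \<noteq> 0} \<subseteq> carrier G"
  by (auto simp: CP_carrier)

lemma CP_simps:
  "szero CP = (\<lambda>_. 0)" "sadd CP f g = (\<lambda>t. f t + g t)" "sscale CP c f = (\<lambda>t. cscale c (f t))"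
  "sadj CP f = (\<lambda>t. if t \<in> carrier G then \<tau> t (adj (f (inv t))) else 0)"
  "sdiff CP f g = (\<lambda>t. f t - g t)"
  by (simp_all add: algebraic_crossed_product_def sdiff_def)

text \<open>\<open>A\<close> and \<open>B\<close> may be larger than the supports, so that several
  products can be expanded over common index sets and compared term by term.\<close>

lemma CP_mult:
  assumes "finite A" "A \<subseteq> carrier G" "{t. f t \<noteq> 0} \<subseteq> A"
    and "finite B" "B \<subseteq> carrier G" "{t. g t \<noteq> 0} \<subseteq> B"
  shows "smult CP f g r = (\<Sum>s\<in>A. \<Sum>t\<in>B. if s \<otimes> t = r then tmul s (f s) (g t) else 0)"
proof -
  have "smult CP f g r = (\<Sum>(s, t) | f s \<noteq> 0 \<and> g t \<noteq> 0 \<and> s \<otimes> t = r. tmul s (f s) (g t))"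
    by (simp add: algebraic_crossed_product_def tmul_def)
  also have "\<dots> = (\<Sum>(s, t)\<in>A \<times> B. if s \<otimes> t = r then tmul s (f s) (g t) else 0)"
    using assms by (intro sum.mono_neutral_cong_left) (auto simp: subset_iff split: if_splits)
  finally show ?thesis by (simp add: sum.cartesian_product)
qed

lemma CP_mult_closed:
  assumes f: "f \<in> carrier CP" and g: "g \<in> carrier CP"
  shows "smult CP f g \<in> carrier CP"
proof -
  let ?A = "{t. f t \<noteq> 0}" and ?B = "{t. g t \<noteq> 0}"
  note eq = CP_mult[OF CP_finite[OF f] CP_supp[OF f] order_refl CP_finite[OF g] CP_supp[OF g] order_refl]
  have A: "s \<in> carrier G" "f s \<in> D s" if "s \<in> ?A" for s
    using f that by (auto simp: CP_carrier)
  have B: "s \<in> carrier G" "g s \<in> D s" if "s \<in> ?B" for s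
    using g that by (auto simp: CP_carrier)
  have nz: "\<exists>s\<in>?A. \<exists>t\<in>?B. s \<otimes> t = r" if "smult CP f g r \<noteq> 0" for r
  proof (rule ccontr)
    assume "\<not> ?thesis"
    then have "smult CP f g r = 0" unfolding eq by (intro sum.neutral ballI) auto
    with that show False by simp
  qed
  have "{r. smult CP f g r \<noteq> 0} \<subseteq> (\<lambda>(s, t). s \<otimes> t) ` (?A \<times> ?B)"
    using nz by force
  then have "finite {r. smult CP f g r \<noteq> 0}"
    using CP_finite[OF f] CP_finite[OF g] finite_subset by blast
  moreover have "smult CP f g r \<in> D r" if "r \<in> carrier G" for r
    unfolding eq using that A B
    by (intro cstar_ideal_sum[OF ideal_D]) (auto simp: D_simps intro: tmul_closed)
  moreover have "smult CP f g r = 0" if "r \<notin> carrier G" for r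
    using nz[of r] A(1) B(1) that by auto
  ultimately show ?thesis by (simp add: CP_carrier)
qed

lemma CP_adj_closed:
  assumes f: "f \<in> carrier CP"
  shows "sadj CP f \<in> carrier CP"
proof -
  have "{t. sadj CP f t \<noteq> 0} \<subseteq> (\<lambda>t. inv t) ` {t. f t \<noteq> 0}"
  proof
    fix t assume t: "t \<in> {t. sadj CP f t \<noteq> 0}"
    then have "t \<in> carrier G" "f (inv t) \<noteq> 0" by (auto simp: CP_simps split: if_splits)
    then show "t \<in> (\<lambda>t. inv t) ` {t. f t \<noteq> 0}" by (intro image_eqI[of _ _ "inv t"]) auto
  qed
  then have "finite {t. sadj CP f t \<noteq> 0}"
    using CP_finite[OF f] finite_subset by blast
  then show ?thesis
    using f by (simp add: CP_carrier) (simp add: CP_simps CP_D D_adj \<tau>_closed)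
qed

lemma CP_star_algebra: "star_algebra CP"
proof
  show "szero CP \<in> carrier CP" by (simp add: CP_simps CP_carrier D_simps)
  fix x y x' y' z c
  assume x: "x \<in> carrier CP"
  show "sscale CP c x \<in> carrier CP"
    using x by (auto simp: CP_simps CP_carrier D_simps elim!: finite_subset[rotated])
  show "sadj CP x \<in> carrier CP" using x by (rule CP_adj_closed)
  show "sdiff CP x x = sscale CP 0 x" by (simp add: CP_simps)
  {
    assume y: "y \<in> carrier CP"
    have "finite {t. x t + y t \<noteq> 0}"
      using CP_finite[OF x] CP_finite[OF y]
      by (rule finite_subset[rotated, OF finite_UnI]) auto
    then show "sadd CP x y \<in> carrier CP"
      using x y by (auto simp: CP_simps CP_carrier D_simps)
    show "smult CP x y \<in> carrier CP" using x y by (rule CP_mult_closed)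
    show "sdiff CP y x = sscale CP (- 1) (sdiff CP x y)" by (simp add: CP_simps)
    show "sadd CP (sdiff CP x y) y = x" by (simp add: CP_simps)
    show "sdiff CP x z = sadd CP (sdiff CP x y) (sdiff CP y z)" by (simp add: CP_simps)
  }
  assume x': "x' \<in> carrier CP"
  show "sdiff CP (sscale CP c x) (sscale CP c x') = sscale CP c (sdiff CP x x')"
    by (simp add: CP_simps cscale_diff_right)
  show "sdiff CP (sadj CP x) (sadj CP x') = sadj CP (sdiff CP x x')"
    using x x' by (auto simp: CP_simps adj_diff \<tau>_diff CP_D D_adj)
  show "sdiff CP (sadd CP x y) (sadd CP x' y') = sadd CP (sdiff CP x x') (sdiff CP y y')"
    by (simp add: CP_simps algebra_simps)
  assume y: "y \<in> carrier CP" and y': "y' \<in> carrier CP"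
  let ?A = "{t. x t \<noteq> 0} \<union> {t. x' t \<noteq> 0}" and ?B = "{t. y t \<noteq> 0} \<union> {t. y' t \<noteq> 0}"
  have A: "finite ?A" "?A \<subseteq> carrier G" and B: "finite ?B" "?B \<subseteq> carrier G"
    using x x' y y' by (simp_all add: CP_finite CP_supp)
  note eq = CP_mult[OF A _ B]
  show "sdiff CP (smult CP x y) (smult CP x' y') =
      sadd CP (smult CP x (sdiff CP y y')) (smult CP (sdiff CP x x') y')"
  proof
    fix r
    have "x s \<in> D s" "x' s \<in> D s" "s \<in> carrier G" if "s \<in> ?A" for s
      using x x' that by (auto simp: CP_carrier)
    then show "sdiff CP (smult CP x y) (smult CP x' y') r =
        sadd CP (smult CP x (sdiff CP y y')) (smult CP (sdiff CP x x') y') r"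
      unfolding CP_simps
      by (subst (1 2 3 4) eq)
        (auto simp: tmul_diff simp flip: sum_subtractf sum.distrib intro!: sum.cong)
  qed
qed

sublocale CP: star_algebra CP by (rule CP_star_algebra)

section \<open>The l1 norm of the crossed product\<close>

lemma l1_norm_star_seminorm: "star_seminorm CP l1_norm"
  unfolding star_seminorm_def
proof (intro conjI ballI allI)
  fix x assume x: "x \<in> carrier CP"
  note X = CP_finite[OF x] CP_supp[OF x] order_refl
  show "0 \<le> l1_norm x" by (simp add: l1_norm_def sum_nonneg)
  show "l1_norm (sscale CP c x) = cmod c * l1_norm x" for c
    by (subst (1 2) l1_norm_eq[OF X(1)]) (auto simp: CP_simps norm_cscale sum_distrib_left)
  show "l1_norm (sadj CP x) = l1_norm x"
  proof -
    let ?A = "{t. x t \<noteq> 0}"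
    have A: "t \<in> carrier G" "x t \<in> D t" if "t \<in> ?A" for t using x that by (auto simp: CP_carrier)
    have inj: "inj_on (\<lambda>t. inv t) ?A" using A(1) by (intro inj_onI) (metis inv_inv)
    have "l1_norm (sadj CP x) = (\<Sum>t\<in>(\<lambda>t. inv t) ` ?A. norm (sadj CP x t))"
    proof (rule l1_norm_eq)
      show "{t. sadj CP x t \<noteq> 0} \<subseteq> (\<lambda>t. inv t) ` ?A"
      proof
        fix t assume "t \<in> {t. sadj CP x t \<noteq> 0}"
        then have "t \<in> carrier G" "x (inv t) \<noteq> 0" by (auto simp: CP_simps split: if_splits)
        then show "t \<in> (\<lambda>t. inv t) ` ?A" by (intro image_eqI[of _ _ "inv t"]) auto
      qed
    qed (use X in simp)
    also have "\<dots> = (\<Sum>t\<in>?A. norm (sadj CP x (inv t)))"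
      by (subst sum.reindex[OF inj]) simp
    also have "\<dots> = (\<Sum>t\<in>?A. norm (x t))"
      using A by (intro sum.cong) (simp_all add: CP_simps norm_\<tau> D_adj)
    finally show ?thesis by (simp add: l1_norm_def)
  qed
  fix y assume y: "y \<in> carrier CP"
  note Y = CP_finite[OF y] CP_supp[OF y] order_refl
  show "l1_norm (sadd CP x y) \<le> l1_norm x + l1_norm y"
  proof -
    let ?C = "{t. x t \<noteq> 0} \<union> {t. y t \<noteq> 0}"
    have "finite ?C" using X Y by simp
    then show ?thesis
      by (subst (1 2 3) l1_norm_eq[of ?C])
        (auto simp: CP_simps norm_triangle_ineq sum_mono simp flip: sum.distrib)
  qed
  show "l1_norm (smult CP x y) \<le> l1_norm x * l1_norm y"
  proof -
    let ?A = "{t. x t \<noteq> 0}" and ?B = "{t. y t \<noteq> 0}"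
    \<comment> \<open>Every pair of support elements has exactly one product in \<open>?R\<close>.
      After the summations are interchanged, the sum over \<open>r\<close> therefore
      collapses.\<close>
    let ?R = "(\<lambda>(s, t). s \<otimes> t) ` (?A \<times> ?B)"
    have A: "s \<in> carrier G" "x s \<in> D s" if "s \<in> ?A" for s using x that by (auto simp: CP_carrier)
    note eq = CP_mult[OF X Y]
    have R: "finite ?R" using X Y by simp
    have "{r. smult CP x y r \<noteq> 0} \<subseteq> ?R"
    proof (rule ccontr)
      assume "\<not> ?thesis"
      then obtain r where r: "smult CP x y r \<noteq> 0" "r \<notin> ?R" by blast
      then have "\<And>s t. s \<in> ?A \<Longrightarrow> t \<in> ?B \<Longrightarrow> s \<otimes> t \<noteq> r" by force
      then have "smult CP x y r = 0" unfolding eq by (intro sum.neutral ballI) auto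
      with r show False by simp
    qed
    then have "l1_norm (smult CP x y) = (\<Sum>r\<in>?R. norm (smult CP x y r))"
      by (rule l1_norm_eq[OF R])
    also have "\<dots> \<le> (\<Sum>r\<in>?R. \<Sum>s\<in>?A. \<Sum>t\<in>?B. if s \<otimes> t = r then norm (x s) * norm (y t) else 0)"
      unfolding eq using A
      by (intro sum_mono order_trans[OF norm_sum] order_trans[OF sum_mono[OF norm_sum]])
        (auto intro!: norm_tmul)
    also have "\<dots> = (\<Sum>s\<in>?A. \<Sum>r\<in>?R. \<Sum>t\<in>?B. if s \<otimes> t = r then norm (x s) * norm (y t) else 0)"
      by (rule sum.swap)
    also have "\<dots> = (\<Sum>s\<in>?A. \<Sum>t\<in>?B. \<Sum>r\<in>?R. if s \<otimes> t = r then norm (x s) * norm (y t) else 0)"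
      by (intro sum.cong refl sum.swap)
    also have "\<dots> = (\<Sum>s\<in>?A. \<Sum>t\<in>?B. norm (x s) * norm (y t))"
      by (intro sum.cong refl) (subst sum.delta'[OF R], force)
    also have "\<dots> = l1_norm x * l1_norm y" by (simp add: l1_norm_def sum_product)
    finally show ?thesis .
  qed
qed

section \<open>Monomials and the bound on C*-seminorms\<close>

lemma delta_closed: "t \<in> carrier G \<Longrightarrow> a \<in> D t \<Longrightarrow> delta a t \<in> carrier CP"
  by (auto simp: CP_carrier delta_def D_simps intro: finite_subset[of _ "{t}"])

lemma delta_mult:
  assumes "s \<in> carrier G" "t \<in> carrier G"
  shows "smult CP (delta a s) (delta b t) = delta (tmul s a b) (s \<otimes> t)"
proof
  fix r
  show "smult CP (delta a s) (delta b t) r = delta (tmul s a b) (s \<otimes> t) r"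
    using assms by (subst CP_mult[of "{s}" _ "{t}"]) (auto simp: delta_def)
qed

lemma delta_adj:
  assumes "t \<in> carrier G"
  shows "sadj CP (delta a t) = delta (\<tau> (inv t) (adj a)) (inv t)"
proof
  fix s
  have "inv s = t \<longleftrightarrow> s = inv t" if "s \<in> carrier G" using assms that by auto
  then show "sadj CP (delta a t) s = delta (\<tau> (inv t) (adj a)) (inv t) s"
    using assms by (auto simp: CP_simps delta_def)
qed

text \<open>At the neutral element, \<open>a \<mapsto> q (delta a \<one>)\<close> is a C*-seminorm
  on the whole algebra and \<open>cstar_seminorm_le_norm\<close> applies. In general the adjoint of
  the monomial times the monomial sits at the neutral element with coefficient
  \<open>\<tau> (inv t) (adj a * a)\<close>, and \<open>\<tau>\<close> is isometric.\<close>

lemma cstar_seminorm_delta_le: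
  assumes q: "cstar_seminorm CP q" and t: "t \<in> carrier G" and a: "a \<in> D t"
  shows "q (delta a t) \<le> norm a"
proof -
  have add: "sadd CP (delta a t) (delta b t) = delta (a + b) t"
    and scale: "sscale CP c (delta a t) = delta (cscale c a) t" for a b t c
    by (auto simp: CP_simps delta_def)
  have one: "q (delta a \<one>) \<le> norm a" for a
  proof (rule cstar_seminorm_le_norm[OF cstar_ideal_UNIV, where q = "\<lambda>a. q (delta a \<one>)"])
    fix x y :: 'a and c
    have d: "delta x \<one> \<in> carrier CP" "delta y \<one> \<in> carrier CP"
      by (simp_all add: delta_closed D_one)
    show "0 \<le> q (delta x \<one>)" "q (delta (x + y) \<one>) \<le> q (delta x \<one>) + q (delta y \<one>)"
      "q (delta (cscale c x) \<one>) = cmod c * q (delta x \<one>)"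
      using q d by (simp_all add: cstar_seminorm_def flip: add scale)
    have "q (smult CP (sadj CP (delta x \<one>)) (delta x \<one>)) = (q (delta x \<one>))\<^sup>2"
      using q d by (simp add: cstar_seminorm_def)
    then show "q (delta (adj x * x) \<one>) = (q (delta x \<one>))\<^sup>2"
      by (simp add: delta_adj delta_mult tmul_def \<tau>_one)
  qed simp
  have "smult CP (sadj CP (delta a t)) (delta a t) = delta (\<tau> (inv t) (adj a * a)) \<one>"
    using t a by (simp add: delta_adj delta_mult tmul_def \<tau>_\<tau>_inv D_adj)
  moreover have "q (smult CP (sadj CP (delta a t)) (delta a t)) = (q (delta a t))\<^sup>2"
    using q t a by (simp add: cstar_seminorm_def delta_closed)
  ultimately have "(q (delta a t))\<^sup>2 = q (delta (\<tau> (inv t) (adj a * a)) \<one>)" by simp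
  also have "\<dots> \<le> norm (\<tau> (inv t) (adj a * a))" by (rule one)
  also have "\<dots> = (norm a)\<^sup>2"
    using t a by (simp add: norm_\<tau> D_simps norm_adj_mult)
  finally show ?thesis by (rule power2_le_imp_le) simp
qed

text \<open>This makes the supremum over all C*-seminorms finite and transfers density in the l1
  norm to the maximal seminorm.\<close>

lemma cstar_seminorm_le_l1_norm:
  assumes q: "cstar_seminorm CP q" and f: "f \<in> carrier CP"
  shows "q f \<le> l1_norm f"
proof -
  have "finite A \<Longrightarrow> A \<subseteq> carrier G \<Longrightarrow> (\<lambda>t. if t \<in> A then f t else 0) \<in> carrier CP \<and>
    q (\<lambda>t. if t \<in> A then f t else 0) \<le> (\<Sum>t\<in>A. norm (f t))" for A
  proof (induction A rule: finite_induct)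
    case empty
    have "q (sscale CP 0 (szero CP)) = 0"
      using q CP.zero_closed by (simp add: cstar_seminorm_def)
    then show ?case using CP.zero_closed by (simp add: CP_simps)
  next
    case (insert t A)
    let ?g = "\<lambda>t. if t \<in> A then f t else 0"
    have eq: "(\<lambda>s. if s \<in> insert t A then f s else 0) = sadd CP (delta (f t) t) ?g"
      using insert by (auto simp: CP_simps delta_def)
    have t: "t \<in> carrier G" "delta (f t) t \<in> carrier CP"
      using insert f by (auto intro: delta_closed CP_D)
    have "q (sadd CP (delta (f t) t) ?g) \<le> q (delta (f t) t) + q ?g"
      using q t insert by (simp add: cstar_seminorm_def)
    also have "\<dots> \<le> norm (f t) + (\<Sum>t\<in>A. norm (f t))"
      using insert t f by (intro add_mono cstar_seminorm_delta_le[OF q]) (auto simp: CP_D)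
    finally show ?case
      using insert t CP.add_closed unfolding eq by simp
  qed
  moreover have "(\<lambda>t. if t \<in> {t. f t \<noteq> 0} then f t else 0) = f" by auto
  ultimately show ?thesis
    using CP_finite[OF f] CP_supp[OF f] by (metis l1_norm_def)
qed

end

section \<open>Seminorms on free star-algebras\<close>

definition nc_mono :: "('x \<times> bool) list \<Rightarrow> 'x ncpoly"
  where "nc_mono w = (\<lambda>v. if v = w then 1 else 0)"

definition word_adj :: "('x \<times> bool) list \<Rightarrow> ('x \<times> bool) list"
  where "word_adj w = rev (map inv_letter w)"

lemma word_adj_simps [simp]:
  "word_adj [] = []" "word_adj [a] = [inv_letter a]"
  "word_adj (u @ v) = word_adj v @ word_adj u" "word_adj (word_adj w) = w"
  "word_adj w = [] \<longleftrightarrow> w = []" "fst ` set (word_adj w) = fst ` set w"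
  by (simp_all add: word_adj_def rev_map image_image comp_def)

lemma nc_letter_eq_mono: "nc_letter x = nc_mono [(x, False)]"
  by (simp add: nc_letter_def nc_mono_def)

text \<open>In the convolution only the cut of \<open>w\<close> after \<open>length u\<close>
  letters can contribute.\<close>

lemma nc_mono_mult: "nc_mono u \<odot> nc_mono v = nc_mono (u @ v)"
proof
  fix w
  have "(nc_mono u \<odot> nc_mono v) w =
      (\<Sum>i\<le>length w. if i = length u then if w = u @ v then 1 else 0 else 0)"
    unfolding nc_mult_def
  proof (intro sum.cong refl)
    fix i assume i: "i \<in> {..length w}"
    have iff: "take i w = u \<and> drop i w = v \<longleftrightarrow> i = length u \<and> w = u @ v"
    proof
      assume a: "take i w = u \<and> drop i w = v"
      then have "w = u @ v" using append_take_drop_id[of i w] by simp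
      moreover have "length (take i w) = i" using i by simp
      then have "i = length u" using a by simp
      ultimately show "i = length u \<and> w = u @ v" by simp
    qed simp
    have "nc_mono u (take i w) * nc_mono v (drop i w) =
        (if take i w = u \<and> drop i w = v then 1 else 0)" by (simp add: nc_mono_def)
    also have "\<dots> = (if i = length u then if w = u @ v then 1 else 0 else 0)"
      unfolding iff by simp
    finally show "nc_mono u (take i w) * nc_mono v (drop i w) =
        (if i = length u then if w = u @ v then 1 else 0 else 0)" .
  qed
  then show "(nc_mono u \<odot> nc_mono v) w = nc_mono (u @ v) w"
    by (simp add: nc_mono_def)
qed

lemma nc_adj_mono: "nc_adj (nc_mono w) = nc_mono (word_adj w)"
proof
  fix v
  have "word_adj v = w \<longleftrightarrow> v = word_adj w" by auto
  then show "nc_adj (nc_mono w) v = nc_mono (word_adj w) v"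
    by (simp add: nc_adj_def nc_mono_def flip: word_adj_def)
qed

lemma nc_mult_sum_left:
  "(\<lambda>w. \<Sum>i\<in>I. c i * f i w) \<odot> g = (\<lambda>w. \<Sum>i\<in>I. c i * (f i \<odot> g) w)"
  by (simp add: nc_mult_def sum_distrib_left sum_distrib_right mult.assoc sum.swap[of _ I])

lemma nc_mult_sum_right:
  "f \<odot> (\<lambda>w. \<Sum>i\<in>I. c i * g i w) = (\<lambda>w. \<Sum>i\<in>I. c i * (f \<odot> g i) w)"
  by (simp add: nc_mult_def sum_distrib_left mult.left_commute sum.swap[of _ I])

lemma nc_adj_sum: "nc_adj (\<lambda>w. \<Sum>i\<in>I. c i * f i w) = (\<lambda>w. \<Sum>i\<in>I. cnj (c i) * nc_adj (f i) w)"
  by (simp add: nc_adj_def)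

lemma nc_mult_sums:
  "(\<lambda>w. \<Sum>i\<in>I. c i * nc_mono (u i) w) \<odot> (\<lambda>w. \<Sum>j\<in>J. d j * nc_mono (v j) w) =
    (\<lambda>w. \<Sum>(i, j)\<in>I \<times> J. c i * d j * nc_mono (u i @ v j) w)"
  by (simp add: nc_mult_sum_left nc_mult_sum_right nc_mono_mult sum_distrib_left mult.assoc
      flip: sum.cartesian_product)

lemma nc_expand:
  assumes "finite W" "{w. f w \<noteq> 0} \<subseteq> W"
  shows "f = (\<lambda>v. \<Sum>w\<in>W. f w * nc_mono w v)"
proof
  fix v
  have "(\<Sum>w\<in>W. f w * nc_mono w v) = (\<Sum>w\<in>W. if w = v then f v else 0)"
    by (intro sum.cong) (auto simp: nc_mono_def)
  also have "\<dots> = (if v \<in> W then f v else 0)"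
    using assms(1) by (rule sum.delta)
  also have "\<dots> = f v" using assms(2) by (cases "f v = 0") (simp_all add: subset_iff)
  finally show "f v = (\<Sum>w\<in>W. f w * nc_mono w v)" by (rule sym)
qed

section \<open>Nonempty words and the free star-algebra\<close>

definition nc_words :: "'x set \<Rightarrow> ('x \<times> bool) list set"
  where "nc_words X = {w. w \<noteq> [] \<and> fst ` set w \<subseteq> X}"

lemma nc_words_append: "u \<in> nc_words X \<Longrightarrow> v \<in> nc_words X \<Longrightarrow> u @ v \<in> nc_words X"
  by (auto simp: nc_words_def)

lemma nc_words_adj [simp]: "word_adj w \<in> nc_words X \<longleftrightarrow> w \<in> nc_words X"
  by (simp add: nc_words_def)

lemma free_carrier: "f \<in> carrier (free_star_algebra X) \<longleftrightarrow>
    finite {w. f w \<noteq> 0} \<and> {w. f w \<noteq> 0} \<subseteq> nc_words X"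
  by (auto simp: free_star_algebra_def nc_words_def)

lemma free_simps:
  "szero (free_star_algebra X) = (\<lambda>_. 0)"
  "sadd (free_star_algebra X) f g = (\<lambda>w. f w + g w)"
  "sscale (free_star_algebra X) c f = (\<lambda>w. c * f w)"
  "smult (free_star_algebra X) f g = f \<odot> g"
  "sadj (free_star_algebra X) f = nc_adj f"
  "sdiff (free_star_algebra X) f g = (\<lambda>w. f w - g w)"
  by (simp_all add: free_star_algebra_def sdiff_def)

lemma free_sum_closed:
  assumes "finite I" "\<And>i. i \<in> I \<Longrightarrow> m i \<in> carrier (free_star_algebra X)"
  shows "(\<lambda>w. \<Sum>i\<in>I. c i * m i w) \<in> carrier (free_star_algebra X)"
proof -
  have sub: "{w. (\<Sum>i\<in>I. c i * m i w) \<noteq> 0} \<subseteq> (\<Union>i\<in>I. {w. m i w \<noteq> 0})"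
  proof
    fix w assume w: "w \<in> {w. (\<Sum>i\<in>I. c i * m i w) \<noteq> 0}"
    show "w \<in> (\<Union>i\<in>I. {w. m i w \<noteq> 0})"
    proof (rule ccontr)
      assume "\<not> ?thesis"
      then have "(\<Sum>i\<in>I. c i * m i w) = 0" by (intro sum.neutral) simp
      with w show False by simp
    qed
  qed
  moreover have "finite (\<Union>i\<in>I. {w. m i w \<noteq> 0})" "(\<Union>i\<in>I. {w. m i w \<noteq> 0}) \<subseteq> nc_words X"
    using assms by (auto simp: free_carrier)
  ultimately show ?thesis
    unfolding free_carrier using finite_subset by blast
qed

lemma free_mono_closed: "w \<in> nc_words X \<Longrightarrow> nc_mono w \<in> carrier (free_star_algebra X)"
  by (auto simp: free_carrier nc_mono_def intro: finite_subset[of _ "{w}"])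

lemma free_star_algebra: "star_algebra (free_star_algebra X)"
proof
  let ?F = "free_star_algebra X"
  show "szero ?F \<in> carrier ?F" by (simp add: free_simps free_carrier)
  fix x y x' y' z :: "'a ncpoly" and c
  assume x: "x \<in> carrier ?F"
  note X = x[unfolded free_carrier]
  show "sscale ?F c x \<in> carrier ?F"
    using X by (auto simp: free_simps free_carrier elim!: finite_subset[rotated])
  have "sadj ?F x = (\<lambda>v. \<Sum>w | x w \<noteq> 0. cnj (x w) * nc_mono (word_adj w) v)"
    using X by (subst nc_expand[of "{w. x w \<noteq> 0}" x]) (simp_all add: free_simps nc_adj_sum nc_adj_mono)
  then show "sadj ?F x \<in> carrier ?F"
    using X by (auto intro!: free_sum_closed free_mono_closed)
  show "sdiff ?F x x = sscale ?F 0 x" by (simp add: free_simps)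
  show "sdiff ?F (sscale ?F c x) (sscale ?F c x') = sscale ?F c (sdiff ?F x x')"
    by (simp add: free_simps algebra_simps)
  show "sdiff ?F (sadj ?F x) (sadj ?F x') = sadj ?F (sdiff ?F x x')"
    by (simp add: free_simps nc_adj_def)
  show "sdiff ?F (sadd ?F x y) (sadd ?F x' y') = sadd ?F (sdiff ?F x x') (sdiff ?F y y')"
    by (simp add: free_simps algebra_simps)
  show "sdiff ?F (smult ?F x y) (smult ?F x' y') =
      sadd ?F (smult ?F x (sdiff ?F y y')) (smult ?F (sdiff ?F x x') y')"
    by (simp add: free_simps nc_mult_def algebra_simps flip: sum_subtractf sum.distrib)
  assume y: "y \<in> carrier ?F"
  note Y = y[unfolded free_carrier]
  show "sadd ?F x y \<in> carrier ?F"
  proof -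
    have "{w. x w + y w \<noteq> 0} \<subseteq> {w. x w \<noteq> 0} \<union> {w. y w \<noteq> 0}" by auto
    then show ?thesis
      using X Y unfolding free_carrier free_simps by (meson finite_UnI finite_subset le_supI order_trans)
  qed
  have "x = (\<lambda>v. \<Sum>w | x w \<noteq> 0. x w * nc_mono w v)" "y = (\<lambda>v. \<Sum>w | y w \<noteq> 0. y w * nc_mono w v)"
    using X Y by (auto intro!: nc_expand)
  then have "x \<odot> y = (\<lambda>v. \<Sum>w | x w \<noteq> 0. x w * nc_mono w v) \<odot> (\<lambda>v. \<Sum>w | y w \<noteq> 0. y w * nc_mono w v)"
    by (rule arg_cong2)
  then have "smult ?F x y = (\<lambda>w. \<Sum>(i, j)\<in>{w. x w \<noteq> 0} \<times> {w. y w \<noteq> 0}. x i * y j * nc_mono (i @ j) w)"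
    unfolding nc_mult_sums free_simps .
  moreover have "(\<lambda>w. \<Sum>k\<in>{w. x w \<noteq> 0} \<times> {w. y w \<noteq> 0}.
      (x (fst k) * y (snd k)) * nc_mono (fst k @ snd k) w) \<in> carrier ?F"
    using X Y by (intro free_sum_closed free_mono_closed nc_words_append) auto
  ultimately show "smult ?F x y \<in> carrier ?F" by (simp add: case_prod_unfold)
  show "sdiff ?F y x = sscale ?F (- 1) (sdiff ?F x y)" by (simp add: free_simps)
  show "sadd ?F (sdiff ?F x y) y = x" by (simp add: free_simps)
  show "sdiff ?F x z = sadd ?F (sdiff ?F x y) (sdiff ?F y z)" by (simp add: free_simps)
qed

section \<open>Words modulo the kernel of a C*-seminorm\<close>

locale free_seminorm =
  fixes X :: "'x set" and p :: "'x ncpoly \<Rightarrow> real"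
  assumes cstar: "cstar_seminorm (free_star_algebra X) p"
begin

abbreviation F where "F \<equiv> free_star_algebra X"

sublocale F: star_algebra F by (rule free_star_algebra)

sublocale seminormed_star_algebra F p
  by unfold_locales (use cstar in \<open>simp add: cstar_seminorm_iff\<close>)

lemma cstar_identity: "x \<in> carrier F \<Longrightarrow> p (nc_adj x \<odot> x) = (p x)\<^sup>2"
  using cstar by (simp add: cstar_seminorm_def free_simps)

lemma p_zero: "p (\<lambda>_. 0) = 0"
  using scale[OF F.zero_closed, of 0] by (simp add: free_simps)

lemma p_sum_le:
  assumes "finite I" "\<And>i. i \<in> I \<Longrightarrow> m i \<in> carrier F"
  shows "p (\<lambda>v. \<Sum>i\<in>I. c i * m i v) \<le> (\<Sum>i\<in>I. cmod (c i) * p (m i))"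
  using assms
proof (induction I)
  case (insert i I)
  then have "p (sadd F (sscale F (c i) (m i)) (\<lambda>v. \<Sum>i\<in>I. c i * m i v)) \<le>
      cmod (c i) * p (m i) + (\<Sum>i\<in>I. cmod (c i) * p (m i))"
    using triangle[of "sscale F (c i) (m i)" "\<lambda>v. \<Sum>i\<in>I. c i * m i v"]
      free_sum_closed[of I m X c] scale[of "m i" "c i"] F.scale_closed[of "m i" "c i"] by simp
  with insert show ?case by (simp add: free_simps)
qed (simp add: p_zero)

text \<open>The kernel of \<open>p\<close> is a linear subspace. The lemma is used to rewrite the
  words of a combination one by one without changing its \<open>p\<close>-value.\<close>

lemma p_sum_cong:
  assumes I: "finite I" and m: "\<And>i. i \<in> I \<Longrightarrow> m i \<in> carrier F" "\<And>i. i \<in> I \<Longrightarrow> m' i \<in> carrier F"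
    and d: "\<And>i. i \<in> I \<Longrightarrow> d (m i) (m' i) = 0"
  shows "p (\<lambda>v. \<Sum>i\<in>I. c i * m i v) = p (\<lambda>v. \<Sum>i\<in>I. c i * m' i v)"
proof -
  let ?x = "\<lambda>v. \<Sum>i\<in>I. c i * m i v" and ?y = "\<lambda>v. \<Sum>i\<in>I. c i * m' i v"
  have "sdiff F ?x ?y = (\<lambda>v. \<Sum>i\<in>I. c i * sdiff F (m i) (m' i) v)"
    by (simp add: free_simps sum_subtractf right_diff_distrib)
  then have "d ?x ?y \<le> (\<Sum>i\<in>I. cmod (c i) * d (m i) (m' i))"
    using p_sum_le[of I "\<lambda>i. sdiff F (m i) (m' i)" c] I m by (simp add: F.sdiff_closed)
  also have "\<dots> = 0" using d by simp
  finally have "d ?x ?y \<le> 0" .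
  then show ?thesis
    using abs_diff_le_d[of ?x ?y] free_sum_closed[OF I, of m X c] free_sum_closed[OF I, of m' X c] m
    by simp
qed

text \<open>Equality of words in the quotient by the kernel of \<open>p\<close>. Membership in
  \<open>nc_words X\<close> is included so that the relation is a congruence for concatenation and
  adjoints without side conditions.\<close>

definition sim :: "('x \<times> bool) list \<Rightarrow> ('x \<times> bool) list \<Rightarrow> bool"
  where "sim u v \<longleftrightarrow> u \<in> nc_words X \<and> v \<in> nc_words X \<and> d (nc_mono u) (nc_mono v) = 0"

lemma simD: "sim u v \<Longrightarrow> u \<in> nc_words X" "sim u v \<Longrightarrow> v \<in> nc_words X"
  by (simp_all add: sim_def)

lemma sim_refl: "u \<in> nc_words X \<Longrightarrow> sim u u"
  by (simp add: sim_def d_self free_mono_closed)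

lemma sim_sym: "sim u v \<Longrightarrow> sim v u"
  by (simp add: sim_def d_commute free_mono_closed)

lemma sim_trans [trans]: "sim u v \<Longrightarrow> sim v w \<Longrightarrow> sim u w"
  using d_triangle[of "nc_mono u" "nc_mono v" "nc_mono w"] d_nonneg[of "nc_mono u" "nc_mono w"]
  by (simp add: sim_def free_mono_closed)

lemma sim_append:
  assumes "sim u u'" "sim v v'"
  shows "sim (u @ v) (u' @ v')"
  using assms d_mult[of "nc_mono u" "nc_mono u'" "nc_mono v" "nc_mono v'"]
    d_nonneg[of "nc_mono (u @ v)" "nc_mono (u' @ v')"]
  by (simp add: sim_def free_mono_closed free_simps(4) nc_mono_mult nc_words_append)

lemma sim_adj: "sim u v \<Longrightarrow> sim (word_adj u) (word_adj v)"
  using d_adj[of "nc_mono u" "nc_mono v"]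
  by (simp add: sim_def free_mono_closed free_simps(5) nc_adj_mono)

text \<open>The C*-identity is applied to the adjoint, so that the adjoint stands on the right. For
  monomials with the same group element \<open>t\<close> and projection coefficients
  \<open>q\<close>, \<open>r\<close>, this order gives the coefficient \<open>q * r\<close> at the
  neutral element, with no trace of \<open>t\<close>.\<close>

lemma p_square:
  assumes I: "finite I" and w: "\<And>i. i \<in> I \<Longrightarrow> w i \<in> nc_words X"
  shows "(p (\<lambda>v. \<Sum>i\<in>I. c i * nc_mono (w i) v))\<^sup>2 =
    p (\<lambda>v. \<Sum>(i, j)\<in>I \<times> I. c i * cnj (c j) * nc_mono (w i @ word_adj (w j)) v)"
proof -
  let ?x = "\<lambda>v. \<Sum>i\<in>I. c i * nc_mono (w i) v"
  have x: "?x \<in> carrier F" by (intro free_sum_closed free_mono_closed I w)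
  have adj: "nc_adj ?x = (\<lambda>v. \<Sum>i\<in>I. cnj (c i) * nc_mono (word_adj (w i)) v)"
    by (simp add: nc_adj_sum nc_adj_mono)
  then have "nc_adj (nc_adj ?x) = ?x" by (simp add: nc_adj_sum nc_adj_mono)
  then have "(p ?x)\<^sup>2 = p (?x \<odot> nc_adj ?x)"
    using cstar_identity[of "nc_adj ?x"] norm_adj[OF x] F.adj_closed[OF x] by (simp add: free_simps)
  then show ?thesis unfolding adj nc_mult_sums by simp
qed

text \<open>The square of \<open>p (u - v)\<close> is the \<open>p\<close>-value of the four
  products with signs +, -, -, +. If all four agree with the same \<open>z\<close> modulo the
  kernel, they cancel.\<close>

lemma sim_by_cstar:
  assumes "u \<in> nc_words X" "v \<in> nc_words X"
    and "sim (u @ word_adj u) z" "sim (u @ word_adj v) z" "sim (v @ word_adj u) z" "sim (v @ word_adj v) z"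
  shows "sim u v"
proof -
  define w where "w b = (if b then u else v)" for b
  define c where "c b = (if b then 1 else - 1 :: complex)" for b
  have w: "w b \<in> nc_words X" for b using assms by (simp add: w_def)
  have z: "z \<in> nc_words X" using assms(3) by (rule simD)
  have eq: "sdiff F (nc_mono u) (nc_mono v) = (\<lambda>x. \<Sum>b\<in>UNIV. c b * nc_mono (w b) x)"
    by (simp add: free_simps UNIV_bool c_def w_def)
  have "(p (\<lambda>x. \<Sum>b\<in>UNIV. c b * nc_mono (w b) x))\<^sup>2 =
      p (\<lambda>x. \<Sum>k\<in>UNIV \<times> UNIV. (c (fst k) * cnj (c (snd k))) * nc_mono (w (fst k) @ word_adj (w (snd k))) x)"
    using p_square[of UNIV w c] w by (simp add: case_prod_unfold)
  also have "\<dots> = p (\<lambda>x. \<Sum>k\<in>UNIV \<times> UNIV. (c (fst k) * cnj (c (snd k))) * nc_mono z x)"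
  proof (rule p_sum_cong)
    fix k :: "bool \<times> bool"
    have "sim (w (fst k) @ word_adj (w (snd k))) z" using assms by (simp add: w_def)
    then show "d (nc_mono (w (fst k) @ word_adj (w (snd k)))) (nc_mono z) = 0" by (simp add: sim_def)
  qed (use w z in \<open>auto intro!: free_mono_closed nc_words_append\<close>)
  also have "(\<lambda>x. \<Sum>k\<in>UNIV \<times> UNIV. (c (fst k) * cnj (c (snd k))) * nc_mono z x) = (\<lambda>_. 0)"
    by (auto simp: UNIV_bool c_def simp flip: sum.cartesian_product')
  finally show ?thesis using assms(1,2) eq p_zero by (simp add: sim_def)
qed

text \<open>\<open>v\<close> behaves like a projection, so \<open>p\<close> of \<open>v\<close>
  equals its own square and is 0 or 1; the square of \<open>p\<close> of \<open>u\<close> equals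
  \<open>p\<close> of \<open>v\<close>.\<close>

lemma p_mono_le_one:
  assumes "u \<in> nc_words X" "sim (word_adj u @ u) v" "sim (v @ v) v" "sim (word_adj v) v"
  shows "p (nc_mono u) \<le> 1"
proof -
  have eq: "p (nc_mono a) = p (nc_mono b)" if "sim a b" for a b
    using that abs_diff_le_d[of "nc_mono a" "nc_mono b"] by (simp add: sim_def free_mono_closed)
  have sq: "p (nc_mono (word_adj a @ a)) = (p (nc_mono a))\<^sup>2" if "a \<in> nc_words X" for a
    using cstar_identity[OF free_mono_closed[OF that]] by (simp add: nc_adj_mono nc_mono_mult)
  have v: "v \<in> nc_words X" using assms(2) by (rule simD)
  have "sim (word_adj v @ v) v"
    using sim_append[OF assms(4) sim_refl[OF v]] assms(3) by (rule sim_trans)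
  then have "p (nc_mono v) = (p (nc_mono v))\<^sup>2" using eq sq[OF v] by simp
  then have "p (nc_mono v) = 0 \<or> p (nc_mono v) = 1" by (simp add: power2_eq_square)
  moreover have "(p (nc_mono u))\<^sup>2 = p (nc_mono v)" using eq[OF assms(2)] sq[OF assms(1)] by simp
  ultimately have "(p (nc_mono u))\<^sup>2 \<le> 1\<^sup>2" by auto
  then show ?thesis by (rule power2_le_imp_le) simp
qed

end

section \<open>Homomorphisms from free star-algebras to the crossed product\<close>

definition nc_lift :: "(('x \<times> bool) list \<Rightarrow> 't \<Rightarrow> 'a::cstar_algebra) \<Rightarrow> 'x ncpoly \<Rightarrow> 't \<Rightarrow> 'a"
  where "nc_lift \<psi> f = (\<lambda>t. \<Sum>w | f w \<noteq> 0. cscale (f w) (\<psi> w t))"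

text \<open>The words \<open>w i\<close> may repeat, in which case \<open>nc_lift\<close> sees only
  the accumulated coefficient; interchanging the sums distributes it again.\<close>

lemma nc_lift_sum:
  assumes I: "finite I"
  shows "nc_lift \<psi> (\<lambda>v. \<Sum>i\<in>I. c i * nc_mono (w i) v) = (\<lambda>t. \<Sum>i\<in>I. cscale (c i) (\<psi> (w i) t))"
proof
  fix t
  let ?f = "\<lambda>v. \<Sum>i\<in>I. c i * nc_mono (w i) v"
  have f: "?f v = 0" if "v \<notin> w ` I" for v
    using that by (intro sum.neutral) (auto simp: nc_mono_def)
  have "nc_lift \<psi> ?f t = (\<Sum>v\<in>w ` I. cscale (?f v) (\<psi> v t))"
    unfolding nc_lift_def using I f by (intro sum.mono_neutral_left) auto
  also have "\<dots> = (\<Sum>v\<in>w ` I. \<Sum>i\<in>I. if v = w i then cscale (c i) (\<psi> (w i) t) else 0)"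
    unfolding cscale_sum_left by (intro sum.cong refl) (auto simp: nc_mono_def)
  also have "\<dots> = (\<Sum>i\<in>I. \<Sum>v\<in>w ` I. if v = w i then cscale (c i) (\<psi> (w i) t) else 0)"
    by (rule sum.swap)
  also have "\<dots> = (\<Sum>i\<in>I. cscale (c i) (\<psi> (w i) t))"
    using I by (intro sum.cong refl) simp
  finally show "nc_lift \<psi> ?f t = (\<Sum>i\<in>I. cscale (c i) (\<psi> (w i) t))" .
qed

lemma nc_lift_mono: "nc_lift \<psi> (nc_mono w) = \<psi> w"
  using nc_lift_sum[of "{()}" \<psi> "\<lambda>_. 1" "\<lambda>_. w"] by simp

context comm_partial_action
begin

lemma CP_mult_add:
  assumes f: "f \<in> carrier CP" "f' \<in> carrier CP" and g: "g \<in> carrier CP" "g' \<in> carrier CP"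
  shows "smult CP (\<lambda>t. f t + f' t) g = (\<lambda>r. smult CP f g r + smult CP f' g r)"
    and "smult CP f (\<lambda>t. g t + g' t) = (\<lambda>r. smult CP f g r + smult CP f g' r)"
proof -
  let ?A = "{t. f t \<noteq> 0} \<union> {t. f' t \<noteq> 0}" and ?B = "{t. g t \<noteq> 0} \<union> {t. g' t \<noteq> 0}"
  have A: "finite ?A" "?A \<subseteq> carrier G" and B: "finite ?B" "?B \<subseteq> carrier G"
    using f g by (simp_all add: CP_finite CP_supp)
  have *: "f s \<in> D s" "f' s \<in> D s" "s \<in> carrier G" if "s \<in> ?A" for s
    using f that by (auto simp: CP_carrier)
  have add: "tmul s (f s + f' s) b = tmul s (f s) b + tmul s (f' s) b"
    "tmul s (f s) (b + b') = tmul s (f s) b + tmul s (f s) b'" if "s \<in> ?A" for s b b'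
    using *[OF that]
    by (simp_all add: tmul_def \<tau>_add \<tau>_inv_closed tmul_arg ring_distribs)
  note eq = CP_mult[OF A _ B]
  show "smult CP (\<lambda>t. f t + f' t) g = (\<lambda>r. smult CP f g r + smult CP f' g r)"
    using add(1) by (intro ext, subst (1 2 3) eq) (auto simp flip: sum.distrib intro!: sum.cong)
  show "smult CP f (\<lambda>t. g t + g' t) = (\<lambda>r. smult CP f g r + smult CP f g' r)"
    using add(2) by (intro ext, subst (1 2 3) eq) (auto simp flip: sum.distrib intro!: sum.cong)
qed

lemma CP_mult_cscale:
  assumes f: "f \<in> carrier CP" and g: "g \<in> carrier CP"
  shows "smult CP (\<lambda>t. cscale c (f t)) (\<lambda>t. cscale d (g t)) = (\<lambda>r. cscale (c * d) (smult CP f g r))"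
proof -
  have "f s \<in> D s" "s \<in> carrier G" if "f s \<noteq> 0" for s
    using f that by (auto simp: CP_carrier)
  then show ?thesis
    using CP_finite[OF f] CP_supp[OF f] CP_finite[OF g] CP_supp[OF g]
    by (intro ext, subst (1 2) CP_mult[of "{t. f t \<noteq> 0}" _ "{t. g t \<noteq> 0}"])
      (auto simp: cscale_sum_right tmul_cscale intro!: sum.cong)
qed

lemma CP_sum_closed:
  assumes "finite I" "\<And>i. i \<in> I \<Longrightarrow> f i \<in> carrier CP"
  shows "(\<lambda>t. \<Sum>i\<in>I. cscale (c i) (f i t)) \<in> carrier CP"
  using assms
proof (induction I)
  case empty
  then show ?case using CP.zero_closed by (simp add: CP_simps)
next
  case (insert i I)
  then have "sadd CP (sscale CP (c i) (f i)) (\<lambda>t. \<Sum>i\<in>I. cscale (c i) (f i t)) \<in> carrier CP"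
    by (intro CP.add_closed CP.scale_closed) auto
  with insert show ?case by (simp add: CP_simps)
qed

lemma CP_mult_sums:
  assumes I: "finite I" "\<And>i. i \<in> I \<Longrightarrow> f i \<in> carrier CP"
    and J: "finite J" "\<And>j. j \<in> J \<Longrightarrow> g j \<in> carrier CP"
  shows "smult CP (\<lambda>t. \<Sum>i\<in>I. cscale (c i) (f i t)) (\<lambda>t. \<Sum>j\<in>J. cscale (d j) (g j t)) =
    (\<lambda>r. \<Sum>(i, j)\<in>I \<times> J. cscale (c i * d j) (smult CP (f i) (g j) r))"
proof -
  have z1: "smult CP (\<lambda>_. 0) h = (\<lambda>_. 0)" and z2: "smult CP h (\<lambda>_. 0) = (\<lambda>_. 0)" for h
    by (simp_all add: algebraic_crossed_product_def)
  have right: "smult CP (\<lambda>t. cscale c (h t)) (\<lambda>t. \<Sum>j\<in>J. cscale (d j) (g j t)) =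
      (\<lambda>r. \<Sum>j\<in>J. cscale (c * d j) (smult CP h (g j) r))" if h: "h \<in> carrier CP" for h c
    using J
  proof (induction J)
    case (insert j J)
    have *: "(\<lambda>t. cscale a (k t)) \<in> carrier CP" if "k \<in> carrier CP" for a k
      using CP.scale_closed[OF that, of a] by (simp add: CP_simps)
    have "smult CP (\<lambda>t. cscale c (h t)) (\<lambda>t. cscale (d j) (g j t) + (\<Sum>j\<in>J. cscale (d j) (g j t))) =
      (\<lambda>r. smult CP (\<lambda>t. cscale c (h t)) (\<lambda>t. cscale (d j) (g j t)) r +
        smult CP (\<lambda>t. cscale c (h t)) (\<lambda>t. \<Sum>j\<in>J. cscale (d j) (g j t)) r)"
      using insert h by (intro CP_mult_add(2) CP_sum_closed *) auto
    with insert h show ?case by (simp add: CP_mult_cscale)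
  qed (simp add: z2)
  show ?thesis
    using I
  proof (induction I)
    case (insert i I)
    have *: "(\<lambda>t. cscale a (k t)) \<in> carrier CP" if "k \<in> carrier CP" for a k
      using CP.scale_closed[OF that, of a] by (simp add: CP_simps)
    have "smult CP (\<lambda>t. cscale (c i) (f i t) + (\<Sum>i\<in>I. cscale (c i) (f i t)))
        (\<lambda>t. \<Sum>j\<in>J. cscale (d j) (g j t)) =
      (\<lambda>r. smult CP (\<lambda>t. cscale (c i) (f i t)) (\<lambda>t. \<Sum>j\<in>J. cscale (d j) (g j t)) r +
        smult CP (\<lambda>t. \<Sum>i\<in>I. cscale (c i) (f i t)) (\<lambda>t. \<Sum>j\<in>J. cscale (d j) (g j t)) r)"
      using insert J by (intro CP_mult_add(1) CP_sum_closed *) auto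
    with insert right[of "f i" "c i"] show ?case by (simp flip: sum.cartesian_product)
  qed (simp add: z1)
qed

text \<open>Words form a linear basis, so multiplicativity on words extends bilinearly and
  compatibility with adjoints extends conjugate-linearly.\<close>

lemma nc_lift_star_hom:
  assumes closed: "\<And>w. w \<in> nc_words X \<Longrightarrow> \<psi> w \<in> carrier CP"
    and mult: "\<And>u v. u \<in> nc_words X \<Longrightarrow> v \<in> nc_words X \<Longrightarrow> \<psi> (u @ v) = smult CP (\<psi> u) (\<psi> v)"
    and adj: "\<And>w. w \<in> nc_words X \<Longrightarrow> \<psi> (word_adj w) = sadj CP (\<psi> w)"
  shows "star_hom (free_star_algebra X) CP (nc_lift \<psi>)"
proof -
  let ?F = "free_star_algebra X"
  interpret F: star_algebra ?F by (rule free_star_algebra)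
  \<comment> \<open>\<open>W\<close> also contains the support of a second element \<open>g\<close>,
    so that a sum can be expanded over one index set.\<close>
  have ex: "\<exists>W. finite W \<and> W \<subseteq> nc_words X \<and> f = (\<lambda>v. \<Sum>w\<in>W. f w * nc_mono w v) \<and>
      nc_lift \<psi> f = (\<lambda>t. \<Sum>w\<in>W. cscale (f w) (\<psi> w t)) \<and> {w. f w \<noteq> 0} \<subseteq> W \<and>
      {w. g w \<noteq> 0} \<subseteq> W" if f: "f \<in> carrier ?F" and g: "g \<in> carrier ?F" for f g
  proof -
    let ?W = "{w. f w \<noteq> 0} \<union> {w. g w \<noteq> 0}"
    have W: "finite ?W" "?W \<subseteq> nc_words X" using f g by (auto simp: free_carrier)
    have "f = (\<lambda>v. \<Sum>w\<in>?W. f w * nc_mono w v)" using W(1) by (rule nc_expand) auto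
    moreover have "nc_lift \<psi> f = (\<lambda>t. \<Sum>w\<in>?W. cscale (f w) (\<psi> w t))"
      unfolding nc_lift_def using W by (intro ext sum.mono_neutral_left) auto
    ultimately show ?thesis using W by (intro exI[of _ ?W]) auto
  qed
  show ?thesis
  proof (intro_locales)
    show "star_hom_axioms ?F CP (nc_lift \<psi>)"
    proof
      fix f assume f: "f \<in> carrier ?F"
      obtain W where W: "finite W" "W \<subseteq> nc_words X" and fW: "f = (\<lambda>v. \<Sum>w\<in>W. f w * nc_mono w v)"
        and lW: "nc_lift \<psi> f = (\<lambda>t. \<Sum>w\<in>W. cscale (f w) (\<psi> w t))"
        using ex[OF f f] by blast
      show "nc_lift \<psi> f \<in> carrier CP"
        unfolding lW using W closed by (intro CP_sum_closed) auto
      have "nc_lift \<psi> (\<lambda>v. \<Sum>w\<in>W. (c * f w) * nc_mono w v) =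
          (\<lambda>t. \<Sum>w\<in>W. cscale (c * f w) (\<psi> w t))" for c
        by (rule nc_lift_sum[OF W(1)])
      moreover have "sscale ?F c f = (\<lambda>v. \<Sum>w\<in>W. (c * f w) * nc_mono w v)" for c
        by (subst fW) (simp add: free_simps sum_distrib_left mult.assoc)
      ultimately show "nc_lift \<psi> (sscale ?F c f) = sscale CP c (nc_lift \<psi> f)" for c
        by (simp add: lW CP_simps cscale_sum_right cscale_cscale)
      have "sadj ?F f = (\<lambda>v. \<Sum>w\<in>W. cnj (f w) * nc_mono (word_adj w) v)"
        by (subst fW) (simp add: free_simps nc_adj_sum nc_adj_mono)
      then have "nc_lift \<psi> (sadj ?F f) = (\<lambda>t. \<Sum>w\<in>W. cscale (cnj (f w)) (\<psi> (word_adj w) t))"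
        by (simp add: nc_lift_sum[OF W(1)])
      also have "\<dots> = (\<lambda>t. \<Sum>w\<in>W. cscale (cnj (f w)) (sadj CP (\<psi> w) t))"
        using W adj by (intro ext sum.cong) auto
      also have "\<dots> = sadj CP (nc_lift \<psi> f)"
      proof
        fix t
        show "(\<Sum>w\<in>W. cscale (cnj (f w)) (sadj CP (\<psi> w) t)) = sadj CP (nc_lift \<psi> f) t"
        proof (cases "t \<in> carrier G")
          case True
          have "\<psi> w (inv t) \<in> D (inv t)" if "w \<in> W" for w
            using closed[of w] that W True by (auto simp: CP_carrier)
          then have *: "adj (\<psi> w (inv t)) \<in> D (inv t)" if "w \<in> W" for w
            using that True by (simp add: D_adj)
          \<comment> \<open>\<open>\<tau> t\<close> is additive on \<open>D (inv t)\<close> only.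
            The induction over subsets of \<open>W\<close> keeps all partial sums inside this
            ideal.\<close>
          have "\<tau> t (\<Sum>w\<in>V. cscale (cnj (f w)) (adj (\<psi> w (inv t)))) =
              (\<Sum>w\<in>V. cscale (cnj (f w)) (\<tau> t (adj (\<psi> w (inv t)))))" if "V \<subseteq> W" for V
            using finite_subset[OF that W(1)] that
          proof (induction V)
            case (insert w V)
            then show ?case
              using * True
              by (simp add: \<tau>_add \<tau>_cscale D_simps cstar_ideal_sum[OF ideal_D] subset_iff)
          qed (use True in simp)
          then show ?thesis
            using True by (simp add: lW CP_simps adj_sum adj_cscale)
        qed (simp add: CP_simps)
      qed
      finally show "nc_lift \<psi> (sadj ?F f) = sadj CP (nc_lift \<psi> f)" .
      fix g assume g: "g \<in> carrier ?F"
      obtain V where V: "finite V" "V \<subseteq> nc_words X" and gV: "g = (\<lambda>v. \<Sum>w\<in>V. g w * nc_mono w v)"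
        and lV: "nc_lift \<psi> g = (\<lambda>t. \<Sum>w\<in>V. cscale (g w) (\<psi> w t))"
        and fV: "{w. f w \<noteq> 0} \<subseteq> V" and gV': "{w. g w \<noteq> 0} \<subseteq> V"
        using ex[OF g f] by blast
      have "sadd ?F f g = (\<lambda>v. \<Sum>w\<in>V. (f w + g w) * nc_mono w v)"
        unfolding free_simps
        by (rule nc_expand[OF V(1)], rule order_trans[OF _ Un_least[OF fV gV']]) auto
      moreover have "nc_lift \<psi> f = (\<lambda>t. \<Sum>w\<in>V. cscale (f w) (\<psi> w t))"
        unfolding nc_lift_def using V fV by (intro ext sum.mono_neutral_left) auto
      ultimately show "nc_lift \<psi> (sadd ?F f g) = sadd CP (nc_lift \<psi> f) (nc_lift \<psi> g)"
        by (simp add: nc_lift_sum[OF V(1)] lV CP_simps cscale_add_left sum.distrib)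
      have "smult ?F f g = (\<lambda>w. \<Sum>k\<in>W \<times> V. (f (fst k) * g (snd k)) * nc_mono (fst k @ snd k) w)"
        by (subst fW, subst gV) (simp add: free_simps nc_mult_sums case_prod_unfold)
      then have "nc_lift \<psi> (smult ?F f g) =
          (\<lambda>t. \<Sum>k\<in>W \<times> V. cscale (f (fst k) * g (snd k)) (\<psi> (fst k @ snd k) t))"
        using W V by (simp add: nc_lift_sum)
      also have "\<dots> = (\<lambda>t. \<Sum>k\<in>W \<times> V. cscale (f (fst k) * g (snd k)) (smult CP (\<psi> (fst k)) (\<psi> (snd k)) t))"
        by (intro ext sum.cong) (auto simp: mult[OF subsetD[OF W(2)] subsetD[OF V(2)]])
      also have "\<dots> = smult CP (nc_lift \<psi> f) (nc_lift \<psi> g)"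
        unfolding lW lV using W V closed by (subst CP_mult_sums) (auto simp: case_prod_unfold)
      finally show "nc_lift \<psi> (smult ?F f g) = smult CP (nc_lift \<psi> f) (nc_lift \<psi> g)" .
    qed
  qed
qed

end

section \<open>The Boolean dynamical system of a partial action\<close>

text \<open>By Gelfand duality this is the algebra of compact open subsets of the spectrum, with
  products of projections for intersections.\<close>

definition projection_algebra :: "'a::{cstar_algebra, comm_ring} boolean_ops"
  where "projection_algebra = \<lparr>carrier = {p. is_projection p}, bempty = 0, bcap = (*),
    bcup = (\<lambda>p q. p + q - p * q), bminus = (\<lambda>p q. p - p * q)\<rparr>"

lemma projection_algebra_simps [simp]:
  "carrier projection_algebra = {p. is_projection p}" "bempty projection_algebra = 0"
  "bcap projection_algebra p q = p * q" "bcup projection_algebra p q = p + q - p * q"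
  "bminus projection_algebra p q = p - p * q"
  by (simp_all add: projection_algebra_def)

lemma gen_boolean_algebra_projections: "gen_boolean_algebra projection_algebra" (is "gen_boolean_algebra ?B")
proof
  fix A B C :: 'a
  assume "A \<in> carrier ?B"
  then have A: "is_projection A" by simp
  show "A \<curlywedge>\<^bsub>?B\<^esub> \<emptyset>\<^bsub>?B\<^esub> = \<emptyset>\<^bsub>?B\<^esub>" by simp
  assume "B \<in> carrier ?B"
  then have B: "is_projection B" by simp
  note AA = projection_simps[OF A] and BB = projection_simps[OF B]
  show "A \<curlywedge>\<^bsub>?B\<^esub> B \<in> carrier ?B \<and>
      A \<curlyvee>\<^bsub>?B\<^esub> B \<in> carrier ?B \<and>
      A \<setminus>\<^bsub>?B\<^esub> B \<in> carrier ?B"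
    using A B by (simp add: is_projection_mult is_projection_union is_projection_diff)
  show "A \<curlywedge>\<^bsub>?B\<^esub> B = B \<curlywedge>\<^bsub>?B\<^esub> A \<and>
      A \<curlyvee>\<^bsub>?B\<^esub> B = B \<curlyvee>\<^bsub>?B\<^esub> A"
    by (simp add: algebra_simps)
  show "A \<curlywedge>\<^bsub>?B\<^esub> (A \<curlyvee>\<^bsub>?B\<^esub> B) = A \<and>
      A \<curlyvee>\<^bsub>?B\<^esub> (A \<curlywedge>\<^bsub>?B\<^esub> B) = A"
    "(A \<curlywedge>\<^bsub>?B\<^esub> B) \<curlyvee>\<^bsub>?B\<^esub> (A \<setminus>\<^bsub>?B\<^esub> B) = A"
    "(A \<curlywedge>\<^bsub>?B\<^esub> B) \<curlywedge>\<^bsub>?B\<^esub> (A \<setminus>\<^bsub>?B\<^esub> B) =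
      \<emptyset>\<^bsub>?B\<^esub>"
    by (simp_all add: algebra_simps AA BB)
  assume "C \<in> carrier ?B"
  then have C: "is_projection C" by simp
  note CC = projection_simps[OF C]
  show "(A \<curlywedge>\<^bsub>?B\<^esub> B) \<curlywedge>\<^bsub>?B\<^esub> C =
        A \<curlywedge>\<^bsub>?B\<^esub> (B \<curlywedge>\<^bsub>?B\<^esub> C) \<and>
      (A \<curlyvee>\<^bsub>?B\<^esub> B) \<curlyvee>\<^bsub>?B\<^esub> C =
        A \<curlyvee>\<^bsub>?B\<^esub> (B \<curlyvee>\<^bsub>?B\<^esub> C)"
    "A \<curlywedge>\<^bsub>?B\<^esub> (B \<curlyvee>\<^bsub>?B\<^esub> C) =
      (A \<curlywedge>\<^bsub>?B\<^esub> B) \<curlyvee>\<^bsub>?B\<^esub> (A \<curlywedge>\<^bsub>?B\<^esub> C)"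
    by (simp_all add: algebra_simps AA BB CC)
qed simp

locale boolean_partial_action = comm_partial_action "free_group X" D \<tau>
  for X :: "'g set" and D :: "('g \<times> bool) list \<Rightarrow> 'a::{cstar_algebra, comm_ring} set"
    and \<tau> :: "('g \<times> bool) list \<Rightarrow> 'a \<Rightarrow> 'a" +
  assumes semi_saturated: "semi_saturated X D \<tau>"
    and orthogonal: "orthogonal_partial_action X D"
    and complemented: "\<forall>\<alpha>\<in>X. \<exists>C. cstar_ideal C \<and> ideal_direct_sum (D (free_generator \<alpha>)) C"
begin

section \<open>Letters of the free group and semi-saturation\<close>

abbreviation FG where "FG \<equiv> free_group X"

lemma FG_simps:
  "w \<in> carrier FG \<longleftrightarrow> reduced_word w \<and> fst ` set w \<subseteq> X"
  "u \<otimes>\<^bsub>FG\<^esub> v = foldr push_letter u v" "\<one>\<^bsub>FG\<^esub> = []"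
  by (simp_all add: free_group_def)

lemma Nil_closed [simp]: "[] \<in> carrier FG"
  by (simp add: FG_simps reduced_word_def)

lemma D_Nil: "D [] = UNIV" and \<tau>_Nil: "\<tau> [] x = x"
  using D_one \<tau>_one by (simp_all add: FG_simps)

lemma letter_closed [simp]: "[a] \<in> carrier FG \<longleftrightarrow> fst a \<in> X"
  by (simp add: FG_simps reduced_word_def)

lemma FG_inv: "w \<in> carrier FG \<Longrightarrow> m_inv FG w = rev (map inv_letter w)"
proof (rule inv_equality)
  assume w: "w \<in> carrier FG"
  show "rev (map inv_letter w) \<otimes>\<^bsub>FG\<^esub> w = \<one>\<^bsub>FG\<^esub>" by (simp add: FG_simps foldr_push_inverse)
  show "rev (map inv_letter w) \<in> carrier FG"
    using w reduced_word_inverse[of w] by (simp add: FG_simps image_image)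
qed

lemma letter_inv [simp]: "fst a \<in> X \<Longrightarrow> m_inv FG [a] = [inv_letter a]"
  by (simp add: FG_inv)

lemma Nil_inv [simp]: "m_inv FG [] = []"
  by (simp add: FG_inv)

lemma letter_mult: "[a] \<otimes>\<^bsub>FG\<^esub> t = push_letter a t"
  by (simp add: FG_simps)

lemma Cons_closed:
  assumes "a # t \<in> carrier FG"
  shows "fst a \<in> X" "t \<in> carrier FG" "[a] \<otimes>\<^bsub>FG\<^esub> t = a # t" "[inv_letter a] \<otimes>\<^bsub>FG\<^esub> (a # t) = t"
  using assms
  by (cases t; auto simp: FG_simps reduced_word_Cons push_letter_Nil push_letter_Cons reduced_word_def)+

lemma letter_facts:
  assumes a: "fst a \<in> X"
  shows "x \<in> D [inv_letter a] \<Longrightarrow> \<tau> [a] x \<in> D [a]"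
    and "x \<in> D [a] \<Longrightarrow> \<tau> [inv_letter a] x \<in> D [inv_letter a]"
    and "x \<in> D [inv_letter a] \<Longrightarrow> \<tau> [inv_letter a] (\<tau> [a] x) = x"
    and "x \<in> D [a] \<Longrightarrow> \<tau> [a] (\<tau> [inv_letter a] x) = x"
    and "x \<in> D [inv_letter a] \<Longrightarrow> y \<in> D [inv_letter a] \<Longrightarrow> \<tau> [a] (x * y) = \<tau> [a] x * \<tau> [a] y"
    and "x \<in> D [a] \<Longrightarrow> y \<in> D [a] \<Longrightarrow> \<tau> [inv_letter a] (x * y) = \<tau> [inv_letter a] x * \<tau> [inv_letter a] y"
    and "x \<in> D [inv_letter a] \<Longrightarrow> is_projection x \<Longrightarrow> is_projection (\<tau> [a] x)"
    and "x \<in> D [a] \<Longrightarrow> is_projection x \<Longrightarrow> is_projection (\<tau> [inv_letter a] x)"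
    and "tmul [a] x y = \<tau> [a] (\<tau> [inv_letter a] x * y)"
    and "\<tau> [a] 0 = 0"
    and "x \<in> D [a] \<Longrightarrow> y * x \<in> D [a]" "x \<in> D [a] \<Longrightarrow> x * y \<in> D [a]"
  using a \<tau>_closed[of "[a]" x] \<tau>_closed[of "[inv_letter a]" x] \<tau>_inv_\<tau>[of "[a]" x]
    \<tau>_\<tau>_inv[of "[a]" x] \<tau>_mult[of "[a]" x y] \<tau>_mult[of "[inv_letter a]" x y]
    is_projection_\<tau>[of "[a]" x] is_projection_\<tau>[of "[inv_letter a]" x] \<tau>_zero[of "[a]"]
    D_simps(5,6)[of "[a]" x y]
  by (simp_all add: tmul_def)

text \<open>\<open>D (a # t)\<close> is the domain of the partial map of the inverse word. That
  inverse is the inverse of \<open>t\<close> times the inverse of \<open>a\<close> without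
  cancellation, so by semi-saturation its map first applies that of the inverse of \<open>a\<close>,
  whose domain is \<open>D [a]\<close>.\<close>

lemma D_Cons_subset:
  assumes at: "a # t \<in> carrier FG"
  shows "D (a # t) \<subseteq> D [a]"
proof
  fix x assume x: "x \<in> D (a # t)"
  note c = Cons_closed[OF at]
  let ?s = "m_inv FG t" and ?t = "m_inv FG [a]"
  have st: "?s \<in> carrier FG" "?t \<in> carrier FG" using c by auto
  have eq: "?s \<otimes>\<^bsub>FG\<^esub> ?t = m_inv FG (a # t)"
    using c inv_mult_group[of "[a]" t] by simp
  have "length (?s \<otimes>\<^bsub>FG\<^esub> ?t) = length ?s + length ?t"
    unfolding eq using at c by (simp add: FG_inv)
  then have "partial_map FG D \<tau> ?s \<circ>\<^sub>m partial_map FG D \<tau> ?t = partial_map FG D \<tau> (?s \<otimes>\<^bsub>FG\<^esub> ?t)"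
    using semi_saturated st unfolding semi_saturated_def by blast
  moreover have "partial_map FG D \<tau> (?s \<otimes>\<^bsub>FG\<^esub> ?t) x \<noteq> None"
    unfolding eq using x at by (simp add: partial_map_def)
  ultimately have "partial_map FG D \<tau> ?t x \<noteq> None"
    by (auto simp: map_comp_def split: option.splits dest: fun_cong[of _ _ x])
  then show "x \<in> D [a]"
    using c(1) by (auto simp: partial_map_def split: if_splits)
qed

lemma D_Cons:
  assumes at: "a # t \<in> carrier FG" and x: "x \<in> D (a # t)"
  shows "x \<in> D [a]" "\<tau> [inv_letter a] x \<in> D t"
proof -
  note c = Cons_closed[OF at]
  show xa: "x \<in> D [a]" using D_Cons_subset[OF at] x by blast
  then show "\<tau> [inv_letter a] x \<in> D t"
    using \<tau>_in[of "[inv_letter a]" "a # t" x] at x c by simp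
qed

lemma D_orthogonal:
  "\<alpha> \<in> X \<Longrightarrow> \<beta> \<in> X \<Longrightarrow> \<alpha> \<noteq> \<beta> \<Longrightarrow> x \<in> D [(\<alpha>, True)] \<Longrightarrow> x \<in> D [(\<beta>, True)] \<Longrightarrow> x = 0"
  using orthogonal unfolding orthogonal_partial_action_def by blast

section \<open>The projections onto D_\<alpha> and the maps \<theta>_\<alpha>\<close>

definition compl_ideal :: "'g \<Rightarrow> 'a set"
  where "compl_ideal \<alpha> = (SOME C. cstar_ideal C \<and> ideal_direct_sum (D (free_generator \<alpha>)) C)"

definition pr :: "'g \<Rightarrow> 'a \<Rightarrow> 'a"
  where "pr \<alpha> x = (SOME d. d \<in> D [(\<alpha>, True)] \<and> x - d \<in> compl_ideal \<alpha>)"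

definition \<theta> :: "'g \<Rightarrow> 'a \<Rightarrow> 'a"
  where "\<theta> \<alpha> x = \<tau> [(\<alpha>, False)] (pr \<alpha> x)"

context
  fixes \<alpha> assumes \<alpha>: "\<alpha> \<in> X"
begin

lemma compl_ideal:
  "cstar_ideal (compl_ideal \<alpha>)" "ideal_direct_sum (D [(\<alpha>, True)]) (compl_ideal \<alpha>)"
  using someI_ex[OF complemented[rule_format, OF \<alpha>]] by (simp_all add: compl_ideal_def)

lemma pr: "pr \<alpha> x \<in> D [(\<alpha>, True)]" "x - pr \<alpha> x \<in> compl_ideal \<alpha>"
proof -
  obtain d c where "d \<in> D [(\<alpha>, True)]" "c \<in> compl_ideal \<alpha>" "x = d + c"
    using compl_ideal(2) unfolding ideal_direct_sum_def by blast
  then have "d \<in> D [(\<alpha>, True)] \<and> x - d \<in> compl_ideal \<alpha>" by simp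
  from someI[of "\<lambda>d. d \<in> D [(\<alpha>, True)] \<and> x - d \<in> compl_ideal \<alpha>", OF this]
  show "pr \<alpha> x \<in> D [(\<alpha>, True)]" "x - pr \<alpha> x \<in> compl_ideal \<alpha>" by (simp_all add: pr_def)
qed

lemma D_ideal: "cstar_ideal (D [(\<alpha>, True)])"
  using \<alpha> by (simp add: ideal_D)

lemma pr_eqI: "d \<in> D [(\<alpha>, True)] \<Longrightarrow> x - d \<in> compl_ideal \<alpha> \<Longrightarrow> pr \<alpha> x = d"
proof -
  assume d: "d \<in> D [(\<alpha>, True)]" "x - d \<in> compl_ideal \<alpha>"
  have "(x - d) - (x - pr \<alpha> x) \<in> compl_ideal \<alpha>"
    using cstar_idealD(8)[OF compl_ideal(1) d(2) pr(2)] .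
  moreover have "pr \<alpha> x - d \<in> D [(\<alpha>, True)]"
    using cstar_idealD(8)[OF D_ideal pr(1) d(1)] .
  ultimately have "pr \<alpha> x - d \<in> D [(\<alpha>, True)] \<inter> compl_ideal \<alpha>" by simp
  then have "pr \<alpha> x - d \<in> {0}" using compl_ideal(2) unfolding ideal_direct_sum_def by metis
  then show ?thesis by simp
qed

lemma pr_id: "x \<in> D [(\<alpha>, True)] \<Longrightarrow> pr \<alpha> x = x"
  using cstar_idealD(2)[OF compl_ideal(1)] by (intro pr_eqI) simp_all

lemma pr_add: "pr \<alpha> (x + y) = pr \<alpha> x + pr \<alpha> y"
  using cstar_idealD(3)[OF D_ideal pr(1) pr(1), of x y]
    cstar_idealD(3)[OF compl_ideal(1) pr(2) pr(2), of x y]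
  by (intro pr_eqI) (simp_all add: algebra_simps)

lemma pr_mult: "pr \<alpha> (x * y) = pr \<alpha> x * pr \<alpha> y"
proof (rule pr_eqI)
  show "pr \<alpha> x * pr \<alpha> y \<in> D [(\<alpha>, True)]" by (rule cstar_idealD(5)[OF D_ideal pr(1)])
  have "x * y - pr \<alpha> x * pr \<alpha> y = x * (y - pr \<alpha> y) + (x - pr \<alpha> x) * pr \<alpha> y"
    by (simp add: algebra_simps)
  then show "x * y - pr \<alpha> x * pr \<alpha> y \<in> compl_ideal \<alpha>"
    using cstar_idealD[OF compl_ideal(1)] pr(2) by simp
qed

text \<open>The difference \<open>x - pr \<alpha> x\<close> lies in the complement, which
  annihilates D_\<alpha>. Thus \<open>pr \<alpha>\<close> acts like multiplication by a unit of
  D_\<alpha>, though none need exist in the algebra.\<close>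

lemma pr_mult_D: "y \<in> D [(\<alpha>, True)] \<Longrightarrow> pr \<alpha> x * y = x * y"
  using pr_mult[of x y] pr_id[of y] pr_id[of "x * y"] cstar_idealD(5)[OF D_ideal] by simp

text \<open>Both summands are stable under \<open>adj\<close>, so the adjoint of the component of
  \<open>q\<close> is again its component, and decompositions are unique.\<close>

lemma pr_projection: "is_projection q \<Longrightarrow> is_projection (pr \<alpha> q)"
proof -
  assume q: "is_projection q"
  have "adj (q - pr \<alpha> q) \<in> compl_ideal \<alpha>"
    by (rule ideal_adj[OF gen compl_ideal(1) pr(2)])
  then have "pr \<alpha> q = adj (pr \<alpha> q)"
    using q ideal_adj[OF gen D_ideal pr(1)]
    by (intro pr_eqI) (simp_all add: adj_diff is_projection_def)
  then show ?thesis using pr_mult[of q q] q by (simp add: is_projection_def)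
qed

lemma inv_letter_pos [simp]: "inv_letter (\<alpha>, True) = (\<alpha>, False)" "inv_letter (\<alpha>, False) = (\<alpha>, True)"
  by (simp_all add: inv_letter_def)

lemmas pos_facts = letter_facts[of "(\<alpha>, True)", unfolded fst_conv inv_letter_pos, OF \<alpha>]
lemmas neg_facts = letter_facts[of "(\<alpha>, False)", unfolded fst_conv inv_letter_pos, OF \<alpha>]

lemma \<theta>_projection: "is_projection q \<Longrightarrow> is_projection (\<theta> \<alpha> q)"
  unfolding \<theta>_def by (intro pos_facts pr pr_projection)

lemma \<theta>_D: "\<theta> \<alpha> q \<in> D [(\<alpha>, False)]"
  unfolding \<theta>_def by (intro pos_facts pr)

lemma \<theta>_mult: "\<theta> \<alpha> (x * y) = \<theta> \<alpha> x * \<theta> \<alpha> y"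
  by (simp add: \<theta>_def pr_mult pr pos_facts)

lemma \<theta>_add: "\<theta> \<alpha> (x + y) = \<theta> \<alpha> x + \<theta> \<alpha> y"
  using \<tau>_add[of "[(\<alpha>, False)]" "pr \<alpha> x" "pr \<alpha> y"] \<alpha> by (simp add: \<theta>_def pr_add pr)

lemma \<theta>_diff: "\<theta> \<alpha> (x - y) = \<theta> \<alpha> x - \<theta> \<alpha> y"
  using \<theta>_add[of "x - y" y] by (simp add: algebra_simps)

lemma \<theta>_of_D: "x \<in> D [(\<alpha>, True)] \<Longrightarrow> \<theta> \<alpha> x = \<tau> [(\<alpha>, False)] x"
  by (simp add: \<theta>_def pr_id)

lemma \<theta>_\<tau>: "x \<in> D [(\<alpha>, False)] \<Longrightarrow> \<theta> \<alpha> (\<tau> [(\<alpha>, True)] x) = x"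
  by (simp add: \<theta>_of_D pos_facts)

lemma \<theta>_eq_0_iff: "\<theta> \<alpha> x = 0 \<longleftrightarrow> pr \<alpha> x = 0"
  using pos_facts(4)[OF pr(1), of x] pos_facts(10) neg_facts(10) by (auto simp: \<theta>_def)

text \<open>An element below some \<open>\<theta> \<alpha> B\<close> inherits membership in the
  ideal; conversely \<open>A\<close> equals \<open>\<theta> \<alpha>\<close> of
  \<open>\<tau> [(\<alpha>, True)] A\<close>.\<close>

lemma bds_range_eq: "bds_range projection_algebra \<theta> \<alpha> = {A. is_projection A \<and> A \<in> D [(\<alpha>, False)]}"
proof -
  have "A \<in> D [(\<alpha>, False)]" if "A * \<theta> \<alpha> B = A" for A B
    using neg_facts(11)[OF \<theta>_D, of A B] that by simp
  moreover have "\<exists>B. is_projection B \<and> A * \<theta> \<alpha> B = A"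
    if "is_projection A" "A \<in> D [(\<alpha>, False)]" for A
    using that
    by (intro exI[of _ "\<tau> [(\<alpha>, True)] A"]) (auto simp: \<theta>_\<tau> pos_facts is_projection_def[of A])
  ultimately show ?thesis by (auto simp: bds_range_def bsubset_def)
qed

end

lemma boolean_dynamical_system: "boolean_dynamical_system projection_algebra X \<theta>"
proof -
  interpret gen_boolean_algebra "projection_algebra :: 'a boolean_ops"
    by (rule gen_boolean_algebra_projections)
  show ?thesis
    by unfold_locales (simp_all add: \<theta>_projection \<theta>_mult \<theta>_add \<theta>_diff \<theta>_eq_0_iff pr_id D_simps)
qed

abbreviation labels where "labels \<equiv> bds_labels projection_algebra X \<theta>"

text \<open>The part of \<open>A\<close> outside all \<open>D\<^sub>\<alpha>\<close> has no labels, so it vanishes for regular \<open>A\<close>.\<close>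

lemma regular_decomposition:
  assumes A: "A \<in> bds_regular projection_algebra X \<theta>"
  shows "finite (labels A)" "A = (\<Sum>\<alpha>\<in>labels A. pr \<alpha> A)"
proof -
  have pA: "is_projection A" using A by (simp add: bds_regular_def)
  note AA = projection_simps[OF pA]
  have labX: "\<alpha> \<in> X" if "\<alpha> \<in> labels A" for \<alpha> using that by (simp add: bds_labels_def)
  show fin: "finite (labels A)"
  \<comment> \<open>Regularity tests nonzero elements below \<open>A\<close>. \<open>A\<close> is
    one of them unless it is zero, and zero has no labels.\<close>
  proof (cases "A = 0")
    case True
    then have "labels A = {}" by (auto simp: bds_labels_def \<theta>_eq_0_iff pr_id D_simps)
    then show ?thesis by simp
  next
    case False
    then show ?thesis using A AA by (simp add: bds_regular_def bsubset_def)
  qed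
  define e where "e = (\<Sum>\<alpha>\<in>labels A. pr \<alpha> A)"
  \<comment> \<open>On D_\<alpha> the sum \<open>e\<close> acts like \<open>A\<close>: terms with
    another label die by orthogonality, and if \<alpha> is not a label then \<open>A\<close> itself
    annihilates D_\<alpha>.\<close>
  have ey: "e * y = A * y" if "\<alpha> \<in> X" "y \<in> D [(\<alpha>, True)]" for \<alpha> y
  proof -
    have "pr \<beta> A * y = (if \<beta> = \<alpha> then A * y else 0)" if "\<beta> \<in> labels A" for \<beta>
    proof (cases "\<beta> = \<alpha>")
      case False
      have "pr \<beta> A * y \<in> D [(\<beta>, True)]" "pr \<beta> A * y \<in> D [(\<alpha>, True)]"
        using pr[OF labX[OF that]] pos_facts(11,12) labX[OF that] \<open>\<alpha> \<in> X\<close> \<open>y \<in> D [(\<alpha>, True)]\<close> by blast+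
      with False show ?thesis using D_orthogonal \<open>\<alpha> \<in> X\<close> labX[OF that] by auto
    qed (use pr_mult_D that \<open>\<alpha> \<in> X\<close> \<open>y \<in> D [(\<alpha>, True)]\<close> in simp)
    then have "e * y = (\<Sum>\<beta>\<in>labels A. if \<beta> = \<alpha> then A * y else 0)"
      by (simp add: e_def sum_distrib_right)
    moreover have "A * y = 0" if "\<alpha> \<notin> labels A"
      using that \<open>\<alpha> \<in> X\<close> pr_mult_D[OF \<open>\<alpha> \<in> X\<close> \<open>y \<in> D [(\<alpha>, True)]\<close>, of A]
      by (simp add: bds_labels_def \<theta>_eq_0_iff)
    ultimately show ?thesis using fin by auto
  qed
  have eA: "e * A = e"
  proof -
    have "pr \<alpha> A * A = pr \<alpha> A" if "\<alpha> \<in> labels A" for \<alpha>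
      using pr_mult_D[OF labX[OF that] pr(1)[OF labX[OF that]], of A A]
        pr_projection[OF labX[OF that] pA] by (simp add: is_projection_def mult.commute)
    then show ?thesis by (simp add: e_def sum_distrib_right)
  qed
  have ee: "e * e = e"
  proof -
    have "e * e = (\<Sum>\<alpha>\<in>labels A. e * pr \<alpha> A)" by (simp add: e_def sum_distrib_left)
    also have "\<dots> = (\<Sum>\<alpha>\<in>labels A. A * pr \<alpha> A)"
      by (intro sum.cong refl ey[OF labX pr(1)[OF labX]])
    also have "\<dots> = A * e" by (simp add: e_def sum_distrib_left)
    finally show ?thesis using eA by (simp add: mult.commute)
  qed
  have adje: "adj e = e"
    using pr_projection[OF labX pA] by (simp add: e_def adj_sum is_projection_def)
  define B where "B = A - A * e"
  have pB: "is_projection B"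
    unfolding B_def using pA ee adje by (intro is_projection_diff) (simp_all add: is_projection_def)
  have BA: "B * A = B" by (simp add: B_def algebra_simps AA)
  have "labels B = {}"
  proof -
    have "pr \<alpha> B = 0" if \<alpha>: "\<alpha> \<in> X" for \<alpha>
    proof -
      have "pr \<alpha> B = pr \<alpha> B * pr \<alpha> B" using pr_projection[OF \<alpha> pB] by (simp add: is_projection_def)
      also have "\<dots> = B * pr \<alpha> B" by (rule pr_mult_D[OF \<alpha> pr(1)[OF \<alpha>]])
      also have "\<dots> = A * pr \<alpha> B - A * (e * pr \<alpha> B)" by (simp add: B_def algebra_simps)
      also have "\<dots> = 0" using ey[OF \<alpha> pr(1)[OF \<alpha>]] AA by simp
      finally show ?thesis .
    qed
    then show ?thesis by (auto simp: bds_labels_def \<theta>_eq_0_iff)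
  qed
  then have "B = 0" using A pB BA by (auto simp: bds_regular_def bsubset_def)
  then have "A = e" using eA by (simp add: B_def mult.commute)
  then show "A = (\<Sum>\<alpha>\<in>labels A. pr \<alpha> A)" unfolding e_def .
qed

text \<open>For another generator \<beta>, \<open>pr \<beta> B\<close> lies in both ideals and
  vanishes, so \<alpha> is the only label of each nonzero \<open>B\<close> below \<open>A\<close>.
  The sum in relation (iv) then has a single term.\<close>

lemma regular_D:
  assumes \<alpha>: "\<alpha> \<in> X" and A: "is_projection A" "A \<in> D [(\<alpha>, True)]"
  shows "A \<in> bds_regular projection_algebra X \<theta>" "A \<noteq> 0 \<Longrightarrow> labels A = {\<alpha>}"
proof -
  have lab: "labels B = {\<alpha>}" if B: "B \<in> D [(\<alpha>, True)]" "is_projection B" "B \<noteq> 0" for B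
  proof -
    have "pr \<beta> B = 0" if "\<beta> \<in> X" "\<beta> \<noteq> \<alpha>" for \<beta>
    proof -
      have "pr \<beta> B = pr \<beta> B * pr \<beta> B" using pr_projection[OF that(1) B(2)] by (simp add: is_projection_def)
      also have "\<dots> = B * pr \<beta> B" by (rule pr_mult_D[OF that(1) pr(1)[OF that(1)]])
      finally have "pr \<beta> B \<in> D [(\<alpha>, True)]" using pos_facts(12)[OF \<alpha> B(1)] by metis
      then show ?thesis using D_orthogonal[OF \<alpha> that(1)] pr[OF that(1)] that(2) by blast
    qed
    then have "\<beta> \<in> labels B \<longleftrightarrow> \<beta> = \<alpha>" for \<beta>
      using \<alpha> B by (cases "\<beta> = \<alpha>") (auto simp: bds_labels_def \<theta>_eq_0_iff pr_id)
    then show ?thesis by blast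
  qed
  then show "A \<noteq> 0 \<Longrightarrow> labels A = {\<alpha>}" using A by simp
  have "B \<in> D [(\<alpha>, True)]" if "B * A = B" for B
    using pos_facts(11)[OF \<alpha> A(2), of B] that by simp
  then show "A \<in> bds_regular projection_algebra X \<theta>"
    using A lab by (auto simp: bds_regular_def bsubset_def)
qed

section \<open>Images of words as monomials with projection coefficients\<close>

abbreviation gens where "gens \<equiv> bds_gens projection_algebra X \<theta>"

lemma gens_iff:
  "Proj A \<in> gens \<longleftrightarrow> is_projection A"
  "Isom \<alpha> B \<in> gens \<longleftrightarrow> \<alpha> \<in> X \<and> is_projection B \<and> B \<in> D [(\<alpha>, False)]"
  by (auto simp: bds_gens_def bds_range_eq)

text \<open>A generator or its adjoint is sent to \<open>a \<delta>\<^sub>t\<close>, encoded as the pair \<open>(a, t)\<close>.\<close>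

fun letter_image :: "('g, 'a) bds_gen \<times> bool \<Rightarrow> 'a \<times> ('g \<times> bool) list"
  where
    "letter_image (Proj A, _) = (A, [])"
  | "letter_image (Isom \<alpha> B, False) = (\<tau> [(\<alpha>, True)] B, [(\<alpha>, True)])"
  | "letter_image (Isom \<alpha> B, True) = (B, [(\<alpha>, False)])"

definition pmul :: "'a \<times> ('g \<times> bool) list \<Rightarrow> 'a \<times> ('g \<times> bool) list \<Rightarrow> 'a \<times> ('g \<times> bool) list"
  where "pmul x y = (tmul (snd x) (fst x) (fst y), snd x \<otimes>\<^bsub>FG\<^esub> snd y)"

text \<open>No \<open>adj\<close> on the coefficient: the pairs concerned lie in
  \<open>proj_deltas\<close>, where coefficients are selfadjoint.\<close>

definition padj :: "'a \<times> ('g \<times> bool) list \<Rightarrow> 'a \<times> ('g \<times> bool) list"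
  where "padj x = (\<tau> (m_inv FG (snd x)) (fst x), m_inv FG (snd x))"

text \<open>A pair with coefficient zero keeps its group element, so products of pairs and normal
  words need no case distinction.\<close>

definition proj_deltas :: "('a \<times> ('g \<times> bool) list) set"
  where "proj_deltas = {(a, t). is_projection a \<and> t \<in> carrier FG \<and> a \<in> D t}"

lemma proj_deltasD:
  assumes "x \<in> proj_deltas"
  shows "is_projection (fst x)" "snd x \<in> carrier FG" "fst x \<in> D (snd x)" "adj (fst x) = fst x"
  using assms by (auto simp: proj_deltas_def is_projection_def)

lemma pmul_closed: "x \<in> proj_deltas \<Longrightarrow> y \<in> proj_deltas \<Longrightarrow> pmul x y \<in> proj_deltas"
  using proj_deltasD[of x] proj_deltasD[of y]
  by (auto simp: proj_deltas_def pmul_def is_projection_tmul tmul_closed)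

lemma pmul_assoc:
  "x \<in> proj_deltas \<Longrightarrow> y \<in> proj_deltas \<Longrightarrow> z \<in> proj_deltas \<Longrightarrow> pmul (pmul x y) z = pmul x (pmul y z)"
  using proj_deltasD[of x] proj_deltasD[of y] proj_deltasD[of z]
  by (simp add: pmul_def tmul_assoc m_assoc)

lemma padj_pmul:
  assumes "x \<in> proj_deltas" "y \<in> proj_deltas"
  shows "padj (pmul x y) = pmul (padj y) (padj x)"
  using proj_deltasD[OF assms(1)] proj_deltasD[OF assms(2)] proj_deltasD(4)[OF pmul_closed[OF assms]]
    tmul_adj[of "snd x" "snd y" "fst x" "fst y"]
  by (simp add: padj_def pmul_def inv_mult_group)

lemma letter_image_closed: "fst l \<in> gens \<Longrightarrow> letter_image l \<in> proj_deltas"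
  by (cases l rule: letter_image.cases)
    (auto simp: gens_iff proj_deltas_def D_Nil pos_facts)

lemma letter_image_adj: "fst l \<in> gens \<Longrightarrow> letter_image (inv_letter l) = padj (letter_image l)"
  by (cases l rule: letter_image.cases)
    (auto simp: gens_iff inv_letter_def padj_def \<tau>_Nil pos_facts)

text \<open>The value at the empty word is a placeholder; the polynomials have no constant term and
  \<open>nc_words\<close> excludes it.\<close>

fun word_image :: "(('g, 'a) bds_gen \<times> bool) list \<Rightarrow> 'a \<times> ('g \<times> bool) list"
  where
    "word_image [] = (0, [])"
  | "word_image [l] = letter_image l"
  | "word_image (l # w) = pmul (letter_image l) (word_image w)"

lemma word_image_Cons: "w \<noteq> [] \<Longrightarrow> word_image (l # w) = pmul (letter_image l) (word_image w)"
  by (cases w) auto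

lemma nc_words_induct [consumes 1, case_names single Cons]:
  assumes "w \<in> nc_words Y"
    and "\<And>l. fst l \<in> Y \<Longrightarrow> P [l]"
    and "\<And>l w. fst l \<in> Y \<Longrightarrow> w \<in> nc_words Y \<Longrightarrow> P w \<Longrightarrow> P (l # w)"
  shows "P w"
  using assms(1)
proof (induction w)
  case (Cons l w)
  then show ?case using assms(2,3) by (cases "w = []") (auto simp: nc_words_def)
qed (simp add: nc_words_def)

lemma word_image_closed: "w \<in> nc_words gens \<Longrightarrow> word_image w \<in> proj_deltas"
  by (induction rule: nc_words_induct)
    (auto simp: word_image_Cons nc_words_def letter_image_closed pmul_closed)

lemma word_image_append:
  "u \<in> nc_words gens \<Longrightarrow> v \<in> nc_words gens \<Longrightarrow> word_image (u @ v) = pmul (word_image u) (word_image v)"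
proof (induction rule: nc_words_induct)
  case (single l)
  then show ?case by (simp add: word_image_Cons nc_words_def)
next
  case (Cons l w)
  then show ?case
    by (simp add: word_image_Cons nc_words_def)
      (simp add: pmul_assoc letter_image_closed word_image_closed nc_words_def)
qed

lemma word_image_adj: "w \<in> nc_words gens \<Longrightarrow> word_image (word_adj w) = padj (word_image w)"
proof (induction rule: nc_words_induct)
  case (single l)
  then show ?case by (simp add: letter_image_adj)
next
  case (Cons l w)
  have "word_adj (l # w) = word_adj w @ [inv_letter l]" by (simp add: word_adj_def)
  moreover have "[inv_letter l] \<in> nc_words gens" using Cons by (simp add: nc_words_def)
  moreover have "w \<noteq> []" using Cons by (simp add: nc_words_def)
  ultimately show ?case
    using Cons by (simp add: word_image_append word_image_Cons letter_image_adj padj_pmul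
        letter_image_closed word_image_closed)
qed

definition word_delta :: "(('g, 'a) bds_gen \<times> bool) list \<Rightarrow> ('g \<times> bool) list \<Rightarrow> 'a"
  where "word_delta w = delta (fst (word_image w)) (snd (word_image w))"

abbreviation \<Phi> where "\<Phi> \<equiv> nc_lift word_delta"

lemma star_hom_\<Phi>: "star_hom (free_star_algebra gens) CP \<Phi>"
proof (rule nc_lift_star_hom)
  fix u v assume u: "u \<in> nc_words gens"
  note U = proj_deltasD[OF word_image_closed[OF u]]
  show "word_delta u \<in> carrier CP"
    using U by (simp add: word_delta_def delta_closed)
  show "word_delta (word_adj u) = sadj CP (word_delta u)"
    using U u by (simp add: word_delta_def word_image_adj delta_adj padj_def)
  assume v: "v \<in> nc_words gens"
  note V = proj_deltasD[OF word_image_closed[OF v]]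
  show "word_delta (u @ v) = smult CP (word_delta u) (word_delta v)"
    using U V u v by (simp add: word_delta_def word_image_append delta_mult pmul_def)
qed

sublocale \<Phi>: star_hom "free_star_algebra gens" CP \<Phi>
  by (rule star_hom_\<Phi>)

end

section \<open>Normal words and density of the image\<close>

context boolean_partial_action
begin

text \<open>\<open>letter_gen a q\<close> and \<open>normal_word t q\<close> are words with images \<open>q \<delta>\<^sub>a\<close> and \<open>q \<delta>\<^sub>t\<close>.\<close>

definition letter_gen :: "'g \<times> bool \<Rightarrow> 'a \<Rightarrow> ('g, 'a) bds_gen \<times> bool"
  where "letter_gen a q = (if snd a then (Isom (fst a) (\<tau> [inv_letter a] q), False)
    else (Isom (fst a) q, True))"

fun normal_word :: "('g \<times> bool) list \<Rightarrow> 'a \<Rightarrow> (('g, 'a) bds_gen \<times> bool) list"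
  where
    "normal_word [] q = [(Proj q, False)]"
  | "normal_word (a # t) q = letter_gen a q # normal_word t (\<tau> [inv_letter a] q)"

lemma letter_gen:
  assumes "fst a \<in> X" "is_projection q" "q \<in> D [a]"
  shows "fst (letter_gen a q) \<in> gens" "letter_image (letter_gen a q) = (q, [a])"
proof -
  obtain \<alpha> b where a: "a = (\<alpha>, b)" by (cases a)
  with assms have \<alpha>: "\<alpha> \<in> X" by simp
  show "fst (letter_gen a q) \<in> gens" "letter_image (letter_gen a q) = (q, [a])"
    using assms pos_facts[OF \<alpha>]
    by (cases b; simp add: a letter_gen_def gens_iff inv_letter_pos[OF \<alpha>])+
qed

text \<open>The recursion reflects the factorization of \<open>q \<delta>\<close> at
  \<open>a # t\<close> into \<open>q \<delta>\<close> at \<open>[a]\<close> times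
  \<open>\<tau> [inv_letter a] q \<delta>\<close> at \<open>t\<close>. By \<open>D_Cons\<close> the
  coefficients lie in the required ideals.\<close>

lemma normal_word:
  assumes "t \<in> carrier FG" "is_projection q" "q \<in> D t"
  shows "normal_word t q \<in> nc_words gens" "word_image (normal_word t q) = (q, t)"
proof -
  have "normal_word t q \<in> nc_words gens \<and> word_image (normal_word t q) = (q, t)"
    using assms
  proof (induction t arbitrary: q)
    case Nil
    then show ?case by (simp add: nc_words_def gens_iff)
  next
    case (Cons a t)
    note c = Cons_closed[OF Cons.prems(1)] and d = D_Cons[OF Cons.prems(1,3)]
    let ?q = "\<tau> [inv_letter a] q"
    have q: "is_projection ?q" using letter_facts(8)[OF c(1) d(1) Cons.prems(2)] .
    have IH: "normal_word t ?q \<in> nc_words gens" "word_image (normal_word t ?q) = (?q, t)"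
      using Cons.IH[OF c(2) q d(2)] by simp_all
    have "tmul [a] q ?q = q"
      using q letter_facts(4)[OF c(1) d(1)] by (simp add: letter_facts(9)[OF c(1)] is_projection_def)
    then show ?case
      using IH letter_gen[OF c(1) Cons.prems(2) d(1)] c(3)
      by (auto simp: nc_words_def word_image_Cons pmul_def)
  qed
  then show "normal_word t q \<in> nc_words gens" "word_image (normal_word t q) = (q, t)" by simp_all
qed

text \<open>Each coefficient in \<open>D t\<close> is approximated by a combination of projections
  of the same ideal, and every such projection is the coefficient of the image of a normal word for
  \<open>t\<close>.\<close>

lemma \<Phi>_dense:
  assumes g: "g \<in> carrier CP" and e: "0 < e"
  shows "\<exists>f\<in>carrier (free_star_algebra gens). l1_norm (sdiff CP g (\<Phi> f)) < e"
proof -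
  let ?T = "{t. g t \<noteq> 0}"
  have T: "finite ?T" "t \<in> ?T \<Longrightarrow> t \<in> carrier FG" for t
    using CP_finite[OF g] CP_supp[OF g] by auto
  \<comment> \<open>The summand 1 covers empty support and makes the total error strictly smaller
    than \<open>e\<close>.\<close>
  define \<delta> where "\<delta> = e / (real (card ?T) + 1)"
  have \<delta>: "0 < \<delta>" using e by (simp add: \<delta>_def)
  have "\<exists>Q c. finite Q \<and> Q \<subseteq> {p \<in> D t. is_projection p} \<and>
      norm (g t - (\<Sum>q\<in>Q. cscale (c q) q)) < \<delta>" if t: "t \<in> ?T" for t
  proof -
    obtain y where y: "y \<in> proj_span (D t)" "norm (g t - y) < \<delta>"
      using ideal_approx_proj_span[OF gen ideal_D CP_D[OF g] \<delta>] T(2)[OF t] by blast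
    from proj_span_sumD[OF y(1)] y(2) show ?thesis by blast
  qed
  then have "\<forall>t\<in>?T. \<exists>Q c. finite Q \<and> Q \<subseteq> {p \<in> D t. is_projection p} \<and>
      norm (g t - (\<Sum>q\<in>Q. cscale (c q) q)) < \<delta>" by (rule ballI)
  from bchoice[OF this] obtain Q where "\<forall>t\<in>?T. \<exists>c. finite (Q t) \<and> Q t \<subseteq> {p \<in> D t. is_projection p} \<and>
      norm (g t - (\<Sum>q\<in>Q t. cscale (c q) q)) < \<delta>" ..
  from bchoice[OF this] obtain c where "\<forall>t\<in>?T. finite (Q t) \<and> Q t \<subseteq> {p \<in> D t. is_projection p} \<and>
      norm (g t - (\<Sum>q\<in>Q t. cscale (c t q) q)) < \<delta>" ..
  then have Q: "\<And>t. t \<in> ?T \<Longrightarrow> finite (Q t)"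
    "\<And>t. t \<in> ?T \<Longrightarrow> Q t \<subseteq> {p \<in> D t. is_projection p}"
    "\<And>t. t \<in> ?T \<Longrightarrow> norm (g t - (\<Sum>q\<in>Q t. cscale (c t q) q)) < \<delta>" by blast+
  define f where "f = (\<lambda>v. \<Sum>k\<in>Sigma ?T Q. c (fst k) (snd k) * nc_mono (normal_word (fst k) (snd k)) v)"
  have fin: "finite (Sigma ?T Q)" using T Q by (intro finite_SigmaI) auto
  have k: "fst k \<in> carrier FG" "is_projection (snd k)" "snd k \<in> D (fst k)" if "k \<in> Sigma ?T Q" for k
    using that Q(2)[of "fst k"] T(2)[of "fst k"] by (auto simp: subset_iff)
  have f: "f \<in> carrier (free_star_algebra gens)"
    unfolding f_def using k by (intro free_sum_closed fin free_mono_closed normal_word) auto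
  have \<Phi>f: "\<Phi> f t = (if t \<in> ?T then \<Sum>q\<in>Q t. cscale (c t q) q else 0)" for t
  proof -
    have "\<Phi> f t = (\<Sum>k\<in>Sigma ?T Q. cscale (c (fst k) (snd k)) (delta (snd k) (fst k) t))"
      unfolding f_def nc_lift_sum[OF fin] using k
      by (intro sum.cong refl) (simp add: word_delta_def normal_word)
    also have "\<dots> = (\<Sum>s\<in>?T. \<Sum>q\<in>Q s. cscale (c s q) (delta q s t))"
      using T Q by (subst sum.Sigma) (auto simp: case_prod_unfold)
    also have "\<dots> = (\<Sum>s\<in>?T. if s = t then \<Sum>q\<in>Q t. cscale (c t q) q else 0)"
      by (intro sum.cong) (auto simp: delta_def)
    finally show ?thesis using T(1) by (simp add: sum.delta)
  qed
  have "l1_norm (sdiff CP g (\<Phi> f)) = (\<Sum>t\<in>?T. norm (g t - \<Phi> f t))"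
    using T(1) by (subst l1_norm_eq[of ?T]) (auto simp: CP_simps \<Phi>f)
  also have "\<dots> \<le> (\<Sum>t\<in>?T. \<delta>)"
    using Q(3) by (intro sum_mono) (simp add: \<Phi>f less_imp_le)
  also have "\<dots> < e" using e \<delta> by (simp add: \<delta>_def field_simps)
  finally show ?thesis using f by blast
qed

section \<open>Compatibility of \<Phi> with the relations\<close>

abbreviation relations where "relations \<equiv> bds_relations projection_algebra X \<theta>"

lemma \<Phi>_relations:
  assumes lr: "(l, r) \<in> relations"
  shows "l \<in> carrier (free_star_algebra gens)" "r \<in> carrier (free_star_algebra gens)" "\<Phi> l = \<Phi> r"
proof -
  let ?F = "free_star_algebra gens"
  let ?p = "\<lambda>A. nc_letter (Proj A) :: ('g, 'a) bds_gen ncpoly"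
  let ?s = "\<lambda>\<alpha> B. nc_letter (Isom \<alpha> B) :: ('g, 'a) bds_gen ncpoly"
  note mono_simps = nc_letter_eq_mono nc_mono_mult nc_adj_mono
  have mono: "nc_mono w \<in> carrier ?F" if "w \<in> nc_words gens" for w
    using that by (rule free_mono_closed)
  have \<Phi>m: "\<Phi> (nc_mono w) = delta (fst (word_image w)) (snd (word_image w))" for w
    by (simp add: nc_lift_mono word_delta_def)
  note p_simps = \<tau>_Nil pmul_def letter_mult push_letter_Nil push_letter_Cons FG_simps(2)
    nc_words_def gens_iff inv_letter_def \<Phi>m tmul_def
  have zero: "\<Phi> (\<lambda>_. 0) = (\<lambda>_. 0)" "(\<lambda>_. 0) \<in> carrier ?F"
    using \<Phi>.S.zero_closed by (simp_all add: nc_lift_def free_simps)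
  consider
    (PP) A where "is_projection A" "l = ?p A \<odot> ?p A" "r = ?p A"
    | (adj) A where "is_projection A" "l = nc_adj (?p A)" "r = ?p A"
    | (iso) \<alpha> B where "\<alpha> \<in> X" "B \<in> bds_range projection_algebra \<theta> \<alpha>"
        "l = ?s \<alpha> B \<odot> nc_adj (?s \<alpha> B) \<odot> ?s \<alpha> B" "r = ?s \<alpha> B"
    | (empty) "l = ?p 0" "r = (\<lambda>_. 0)"
    | (cap) A A' where "is_projection A" "is_projection A'" "l = ?p (A * A')" "r = ?p A \<odot> ?p A'"
    | (cup) A A' where "is_projection A" "is_projection A'" "l = ?p (A + A' - A * A')"
        "r = (\<lambda>w. ?p A w + ?p A' w - ?p (A * A') w)"
    | (act) A \<alpha> B where "is_projection A" "\<alpha> \<in> X" "B \<in> bds_range projection_algebra \<theta> \<alpha>"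
        "l = ?p A \<odot> ?s \<alpha> B" "r = ?s \<alpha> B \<odot> ?p (\<theta> \<alpha> A)"
    | (orth) \<alpha> B \<alpha>' B' where "\<alpha> \<in> X" "B \<in> bds_range projection_algebra \<theta> \<alpha>"
        "\<alpha>' \<in> X" "B' \<in> bds_range projection_algebra \<theta> \<alpha>'" "l = nc_adj (?s \<alpha> B) \<odot> ?s \<alpha>' B'"
        "r = (if \<alpha> = \<alpha>' then ?p (B * B') else (\<lambda>_. 0))"
    | (reg) A where "A \<in> bds_regular projection_algebra X \<theta>" "l = ?p A"
        "r = (\<lambda>w. \<Sum>\<alpha>\<in>labels A. (?s \<alpha> (\<theta> \<alpha> A) \<odot> nc_adj (?s \<alpha> (\<theta> \<alpha> A))) w)"
    using lr unfolding bds_relations_def Let_def by (auto simp del: inv_letter_pos)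
  then have "l \<in> carrier ?F \<and> r \<in> carrier ?F \<and> \<Phi> l = \<Phi> r"
  proof cases
    case PP
    then show ?thesis by (auto simp: mono_simps p_simps is_projection_def intro!: mono)
  next
    case adj
    then show ?thesis by (auto simp: mono_simps p_simps intro!: mono)
  next
    case iso
    have B: "is_projection B" "B \<in> D [(\<alpha>, False)]" using iso bds_range_eq by auto
    then show ?thesis
      using iso pos_facts[OF iso(1)]
      by (auto simp: mono_simps p_simps is_projection_def intro!: mono)
  next
    case empty
    then show ?thesis using zero by (auto simp: mono_simps p_simps intro!: mono)
  next
    case cap
    then show ?thesis by (auto simp: mono_simps p_simps is_projection_mult intro!: mono)
  next
    case cup
    have P: "?p B \<in> carrier ?F" if "is_projection B" for B
      using that by (auto simp: mono_simps p_simps intro!: mono)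
    have \<Phi>P: "\<Phi> (?p B) = delta B []" for B by (simp add: mono_simps p_simps)
    note c = P[OF cup(1)] P[OF cup(2)] P[OF is_projection_mult[OF cup(1,2)]]
    have r: "r = sdiff ?F (sadd ?F (?p A) (?p A')) (?p (A * A'))"
      by (simp add: cup free_simps)
    have "\<Phi> r = sdiff CP (sadd CP (delta A []) (delta A' [])) (delta (A * A') [])"
      unfolding r using c \<Phi>.S.add_closed by (simp add: \<Phi>.hom_sdiff \<Phi>.hom_add \<Phi>P)
    also have "\<dots> = delta (A + A' - A * A') []"
      by (auto simp: CP_simps delta_def)
    finally show ?thesis
      using c \<Phi>.S.add_closed \<Phi>.S.sdiff_closed P[OF is_projection_union[OF cup(1,2)]] \<Phi>P
      by (simp add: r) (simp add: cup(3))
  next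
    case act
    have B: "is_projection B" "B \<in> D [(\<alpha>, False)]" using act bds_range_eq by auto
    \<comment> \<open>Only the component of \<open>A\<close> in D_\<alpha> meets
      \<open>\<tau> [(\<alpha>, True)] B\<close>, and pulling that component back is
      \<open>\<theta> \<alpha>\<close>.\<close>
    have "A * \<tau> [(\<alpha>, True)] B = pr \<alpha> A * \<tau> [(\<alpha>, True)] B"
      using pr_mult_D[OF act(2) pos_facts(1)[OF act(2) B(2)]] by simp
    also have "\<dots> = \<tau> [(\<alpha>, True)] (B * \<theta> \<alpha> A)"
      using act B by (simp add: pos_facts \<theta>_D mult.commute) (simp add: \<theta>_def pos_facts pr mult.commute)
    finally show ?thesis
      using act B pos_facts[OF act(2)] \<theta>_projection
      by (auto simp: mono_simps p_simps intro!: mono)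
  next
    case orth
    have B: "is_projection B" "B \<in> D [(\<alpha>, False)]" "is_projection B'" "B' \<in> D [(\<alpha>', False)]"
      using orth bds_range_eq by auto
    have l: "l \<in> carrier ?F"
      using orth B by (auto simp: mono_simps p_simps intro!: mono)
    show ?thesis
    proof (cases "\<alpha> = \<alpha>'")
      case True
      then show ?thesis using l orth B pos_facts[OF orth(1)]
        by (auto simp: mono_simps p_simps is_projection_mult intro!: mono)
    next
      case False
      \<comment> \<open>The image of \<open>l\<close> has as coefficient the image of
        \<open>?x\<close> under the inverse of \<alpha>, and \<open>?x\<close> lies in two
        orthogonal ideals.\<close>
      let ?x = "\<tau> [(\<alpha>, True)] B * \<tau> [(\<alpha>', True)] B'"
      have "?x \<in> D [(\<alpha>, True)]" "?x \<in> D [(\<alpha>', True)]"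
        using B orth pos_facts(1,11,12) by blast+
      then have "?x = 0" using D_orthogonal orth False by blast
      then show ?thesis using False l orth zero pos_facts(10)[OF orth(1)] neg_facts(10)[OF orth(1)]
        by (auto simp: mono_simps p_simps)
    qed
  next
    case reg
    have A: "is_projection A" using reg by (simp add: bds_regular_def)
    have lab: "\<alpha> \<in> X" if "\<alpha> \<in> labels A" for \<alpha> using that by (simp add: bds_labels_def)
    \<comment> \<open>The image of \<open>w \<alpha>\<close> is \<open>pr \<alpha> A\<close> at the
      neutral element, so the relation becomes the decomposition of \<open>A\<close> into its
      components.\<close>
    define w where "w \<alpha> = [(Isom \<alpha> (\<theta> \<alpha> A), False), (Isom \<alpha> (\<theta> \<alpha> A), True)]" for \<alpha>
    have w: "w \<alpha> \<in> nc_words gens" "word_image (w \<alpha>) = (pr \<alpha> A, [])" if "\<alpha> \<in> labels A" for \<alpha>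
    proof -
      note \<alpha> = lab[OF that]
      show "w \<alpha> \<in> nc_words gens"
        using \<alpha> A by (simp add: w_def nc_words_def gens_iff \<theta>_projection \<theta>_D)
      have "\<theta> \<alpha> A * \<theta> \<alpha> A = \<theta> \<alpha> A" using \<theta>_projection[OF \<alpha> A] by (simp add: is_projection_def)
      then show "word_image (w \<alpha>) = (pr \<alpha> A, [])"
        using \<alpha> pos_facts[OF \<alpha>] \<theta>_D[OF \<alpha>, of A] pr[OF \<alpha>]
        by (simp add: w_def pmul_def letter_mult push_letter_Cons inv_letter_def tmul_def)
          (simp add: \<theta>_def)
    qed
    have r: "r = (\<lambda>v. \<Sum>\<alpha>\<in>labels A. 1 * nc_mono (w \<alpha>) v)"
      unfolding reg(3) by (simp add: mono_simps w_def inv_letter_def)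
    note dec = regular_decomposition[OF reg(1)]
    have "\<Phi> r = (\<lambda>t. \<Sum>\<alpha>\<in>labels A. cscale 1 (word_delta (w \<alpha>) t))"
      unfolding r by (rule nc_lift_sum[OF dec(1)])
    also have "\<dots> = (\<lambda>t. \<Sum>\<alpha>\<in>labels A. delta (pr \<alpha> A) [] t)"
      using w by (simp add: word_delta_def)
    also have "\<dots> = delta A []"
      by (subst (3) dec(2)) (auto simp: delta_def)
    also have "\<dots> = \<Phi> l" by (simp add: reg(2) mono_simps p_simps)
    finally have "\<Phi> r = \<Phi> l" .
    moreover have "r \<in> carrier ?F"
      unfolding r using w by (intro free_sum_closed dec(1) mono)
    moreover have "l \<in> carrier ?F"
      using A by (auto simp: reg(2) mono_simps p_simps intro!: mono)
    ultimately show ?thesis by simp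
  qed
  then show "l \<in> carrier ?F" "r \<in> carrier ?F" "\<Phi> l = \<Phi> r" by simp_all
qed

end

section \<open>Seminorms compatible with the relations\<close>

context boolean_partial_action
begin

context
  fixes p :: "('g, 'a) bds_gen ncpoly \<Rightarrow> real"
  assumes cstar_p: "cstar_seminorm (free_star_algebra gens) p"
    and relations_p: "\<And>l r. (l, r) \<in> relations \<Longrightarrow> p (sdiff (free_star_algebra gens) l r) = 0"
begin

interpretation p: free_seminorm gens p
  by unfold_locales (rule cstar_p)

section \<open>The defining relations as congruences of words\<close>

abbreviation P where "P A \<equiv> (Proj A, False) :: ('g, 'a) bds_gen \<times> bool"
abbreviation s where "s \<alpha> B \<equiv> (Isom \<alpha> B, False) :: ('g, 'a) bds_gen \<times> bool"
abbreviation s' where "s' \<alpha> B \<equiv> (Isom \<alpha> B, True) :: ('g, 'a) bds_gen \<times> bool"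

lemma relation_sim:
  assumes "(nc_mono u, nc_mono v) \<in> relations"
  shows "p.sim u v"
proof -
  have "w \<in> nc_words gens" if "nc_mono w \<in> carrier (free_star_algebra gens)" for w
    using that by (auto simp: free_carrier nc_mono_def)
  then show ?thesis
    using \<Phi>_relations(1,2)[OF assms] relations_p[OF assms] by (simp add: p.sim_def)
qed

lemma P_word: "is_projection A \<Longrightarrow> [(Proj A, b)] \<in> nc_words gens"
  by (simp add: nc_words_def gens_iff)

lemma s_word: "\<alpha> \<in> X \<Longrightarrow> is_projection B \<Longrightarrow> B \<in> D [(\<alpha>, False)] \<Longrightarrow> [(Isom \<alpha> B, b)] \<in> nc_words gens"
  by (simp add: nc_words_def gens_iff)

lemma sim_P_adj: "is_projection A \<Longrightarrow> p.sim [(Proj A, True)] [P A]"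
proof (rule relation_sim)
  assume A: "is_projection A"
  have "(nc_adj (nc_letter (Proj A)), nc_letter (Proj A)) \<in> relations"
    unfolding bds_relations_def Let_def
    by (rule UnI1, rule UnI1, rule UnI1, rule UnI1, rule UnI1, rule UnI1, rule UnI1, rule UnI2) (use A in auto)
  then show "(nc_mono [(Proj A, True)], nc_mono [P A]) \<in> relations"
    by (simp add: nc_letter_eq_mono nc_adj_mono inv_letter_def)
qed

lemma sim_P_P: "is_projection A \<Longrightarrow> is_projection B \<Longrightarrow> p.sim [P A, P B] [P (A * B)]"
proof (rule p.sim_sym, rule relation_sim)
  assume AB: "is_projection A" "is_projection B"
  have "(nc_letter (Proj (A * B)), nc_letter (Proj A) \<odot> nc_letter (Proj B)) \<in> relations"
    unfolding bds_relations_def Let_def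
    by (rule UnI1, rule UnI1, rule UnI1, rule UnI1, rule UnI2) (use AB in auto)
  then show "(nc_mono [P (A * B)], nc_mono [P A, P B]) \<in> relations"
    by (simp add: nc_letter_eq_mono nc_mono_mult)
qed

text \<open>The relation has the zero polynomial on one side, which is not a word, so it is recorded
  as a value of \<open>p\<close>.\<close>

lemma p_P_zero: "p (nc_mono [P 0]) = 0"
proof -
  have "(nc_letter (Proj 0), \<lambda>_. 0) \<in> relations"
    unfolding bds_relations_def Let_def
    by (rule UnI1, rule UnI1, rule UnI1, rule UnI1, rule UnI1, rule UnI2) simp
  from relations_p[OF this] show ?thesis by (simp add: free_simps nc_letter_eq_mono)
qed

lemma sim_P_s:
  assumes "is_projection A" "\<alpha> \<in> X" "is_projection B" "B \<in> D [(\<alpha>, False)]"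
  shows "p.sim [P A, s \<alpha> B] [s \<alpha> B, P (\<theta> \<alpha> A)]"
proof (rule relation_sim)
  have B: "B \<in> bds_range projection_algebra \<theta> \<alpha>" using assms by (simp add: bds_range_eq)
  have "(nc_letter (Proj A) \<odot> nc_letter (Isom \<alpha> B), nc_letter (Isom \<alpha> B) \<odot> nc_letter (Proj (\<theta> \<alpha> A)))
      \<in> relations"
    unfolding bds_relations_def Let_def
    by (rule UnI1, rule UnI1, rule UnI2) (use assms(1,2) B in auto)
  then show "(nc_mono [P A, s \<alpha> B], nc_mono [s \<alpha> B, P (\<theta> \<alpha> A)]) \<in> relations"
    by (simp add: nc_letter_eq_mono nc_mono_mult)
qed

lemma sim_s_adj_s:
  assumes "\<alpha> \<in> X" "is_projection B" "B \<in> D [(\<alpha>, False)]" "is_projection C" "C \<in> D [(\<alpha>, False)]"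
  shows "p.sim [s' \<alpha> B, s \<alpha> C] [P (B * C)]"
proof (rule relation_sim)
  have BC: "B \<in> bds_range projection_algebra \<theta> \<alpha>" "C \<in> bds_range projection_algebra \<theta> \<alpha>"
    using assms by (simp_all add: bds_range_eq)
  have "(nc_adj (nc_letter (Isom \<alpha> B)) \<odot> nc_letter (Isom \<alpha> C), nc_letter (Proj (B * C))) \<in> relations"
    unfolding bds_relations_def Let_def
    by (rule UnI1, rule UnI2, rule CollectI, rule exI[of _ \<alpha>], rule exI[of _ B],
        rule exI[of _ \<alpha>], rule exI[of _ C]) (use assms(1) BC in simp)
  then show "(nc_mono [s' \<alpha> B, s \<alpha> C], nc_mono [P (B * C)]) \<in> relations"
    by (simp add: nc_letter_eq_mono nc_mono_mult nc_adj_mono inv_letter_def)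
qed

lemma sim_null:
  assumes "u \<in> nc_words gens" "v \<in> nc_words gens" "p (nc_mono u) = 0" "p (nc_mono v) = 0"
  shows "p.sim u v"
proof -
  have "p (sdiff (free_star_algebra gens) (nc_mono u) (nc_mono v)) \<le> p (nc_mono u) + cmod (-1) * p (nc_mono v)"
    unfolding sdiff_def
    by (metis assms(1,2) free_mono_closed \<Phi>.S.scale_closed p.scale p.triangle)
  then show ?thesis
    using assms p.d_nonneg[of "nc_mono u" "nc_mono v"] by (simp add: p.sim_def free_mono_closed)
qed

text \<open>For nonzero \<open>A\<close> this is relation (iv) with the single label \<alpha>. Zero
  has no labels, so (iv) has an empty sum there; instead \<open>s \<alpha> 0\<close> is null by the
  C*-identity and (iii), and both sides have \<open>p\<close>-value zero.\<close>

lemma sim_P_s_s_adj: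
  assumes "\<alpha> \<in> X" "is_projection A" "A \<in> D [(\<alpha>, True)]"
  shows "p.sim [P A] [s \<alpha> (\<theta> \<alpha> A), s' \<alpha> (\<theta> \<alpha> A)]"
proof (cases "A = 0")
  case True
  have 0: "\<theta> \<alpha> 0 = 0" using assms by (simp add: \<theta>_of_D D_simps neg_facts)
  have w: "[s \<alpha> 0] \<in> nc_words gens" "[s' \<alpha> 0] \<in> nc_words gens"
    using assms by (simp_all add: nc_words_def gens_iff D_simps)
  have "nc_adj (nc_mono [s \<alpha> 0]) \<odot> nc_mono [s \<alpha> 0] = nc_mono [s' \<alpha> 0, s \<alpha> 0]"
    by (simp add: nc_adj_mono nc_mono_mult inv_letter_def)
  then have "(p (nc_mono [s \<alpha> 0]))\<^sup>2 = p (nc_mono [s' \<alpha> 0, s \<alpha> 0])"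
    using p.cstar_identity[OF free_mono_closed[OF w(1)]] by simp
  also have "\<dots> = p (nc_mono [P 0])"
  proof -
    have "p.sim [s' \<alpha> 0, s \<alpha> 0] [P (0 * 0)]"
      using assms by (intro sim_s_adj_s) (simp_all add: D_simps)
    then show ?thesis
      using p.abs_diff_le_d[of "nc_mono [s' \<alpha> 0, s \<alpha> 0]" "nc_mono [P 0]"]
      by (simp add: p.sim_def free_mono_closed)
  qed
  finally have "p (nc_mono [s \<alpha> 0]) = 0" by (simp add: p_P_zero)
  moreover have "nc_mono [s \<alpha> 0] \<odot> nc_mono [s' \<alpha> 0] = nc_mono [s \<alpha> 0, s' \<alpha> 0]"
    by (simp add: nc_mono_mult)
  ultimately have "p (nc_mono [s \<alpha> 0, s' \<alpha> 0]) \<le> 0"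
    using p.submult[OF free_mono_closed[OF w(1)] free_mono_closed[OF w(2)]] by (simp add: free_simps)
  moreover have w2: "[s \<alpha> 0, s' \<alpha> 0] \<in> nc_words gens" using nc_words_append[OF w] by simp
  ultimately have "p (nc_mono [s \<alpha> 0, s' \<alpha> 0]) = 0"
    using p.nonneg[OF free_mono_closed[OF w2]] by simp
  then show ?thesis
    using True 0 w2 p_P_zero P_word[OF is_projection_zero] by (simp add: sim_null)
next
  case False
  note reg = regular_D[OF assms]
  have "(nc_letter (Proj A), \<lambda>w. \<Sum>\<alpha>\<in>labels A.
      (nc_letter (Isom \<alpha> (\<theta> \<alpha> A)) \<odot> nc_adj (nc_letter (Isom \<alpha> (\<theta> \<alpha> A)))) w) \<in> relations"
    unfolding bds_relations_def Let_def
    by (rule UnI2) (use reg(1) in blast)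
  then have "(nc_mono [P A], nc_mono [s \<alpha> (\<theta> \<alpha> A), s' \<alpha> (\<theta> \<alpha> A)]) \<in> relations"
    using reg(2)[OF False] by (simp add: nc_letter_eq_mono nc_mono_mult nc_adj_mono inv_letter_def)
  then show ?thesis by (rule relation_sim)
qed

lemma sim_Cons: "p.sim u v \<Longrightarrow> fst l \<in> gens \<Longrightarrow> p.sim (l # u) (l # v)"
  using p.sim_append[OF p.sim_refl[of "[l]"], of u v] by (simp add: nc_words_def)

lemma sim_append_right: "p.sim u v \<Longrightarrow> w \<in> nc_words gens \<Longrightarrow> p.sim (u @ w) (v @ w)"
  by (rule p.sim_append[OF _ p.sim_refl])

text \<open>Relation (ii) moves a projection across only in the form
  \<open>\<theta> \<alpha> A\<close>, so a general \<open>C\<close> needs another source. By (iii)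
  all four products of the adjoints \<open>?u\<close> and \<open>?v\<close> with their adjoints
  reduce to \<open>P (B * C)\<close>, and \<open>sim_by_cstar\<close> applies.\<close>

lemma sim_s_P:
  assumes \<alpha>: "\<alpha> \<in> X" and B: "is_projection B" "B \<in> D [(\<alpha>, False)]" and C: "is_projection C"
  shows "p.sim [s \<alpha> B, P C] [s \<alpha> (B * C)]"
proof -
  have BC: "is_projection (B * C)" "B * C \<in> D [(\<alpha>, False)]"
    using B C neg_facts(12)[OF \<alpha>] by (auto simp: is_projection_mult)
  note simps = projection_simps[OF B(1)] projection_simps[OF C] projection_simps[OF BC(1)]
  let ?u = "[(Proj C, True), s' \<alpha> B]" and ?v = "[s' \<alpha> (B * C)]"
  have u: "?u \<in> nc_words gens" and v: "?v \<in> nc_words gens"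
    using \<alpha> B C BC by (simp_all add: nc_words_def gens_iff)
  have adj: "word_adj ?u = [s \<alpha> B, P C]" "word_adj ?v = [s \<alpha> (B * C)]"
    by (simp_all add: word_adj_def inv_letter_def)
  have PCBC: "p.sim [P C, P (B * C)] [P (B * C)]"
    using sim_P_P[OF C BC(1)] by (simp add: simps mult.left_commute[of C])
  have "p.sim ?u ?v"
  proof (rule p.sim_by_cstar[OF u v, where z = "[P (B * C)]"], unfold adj)
    have "p.sim ([(Proj C, True)] @ ([s' \<alpha> B, s \<alpha> B] @ [P C])) ([P C] @ ([P (B * B)] @ [P C]))"
      by (intro p.sim_append sim_P_adj C sim_s_adj_s \<alpha> B p.sim_refl P_word)
    also have "p.sim ([P C] @ ([P (B * B)] @ [P C])) ([P C] @ [P (B * C)])"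
      using sim_P_P[OF B(1) C] by (intro p.sim_append p.sim_refl P_word C) (simp add: simps)
    also have "p.sim ([P C] @ [P (B * C)]) [P (B * C)]" using PCBC by simp
    finally show "p.sim (?u @ [s \<alpha> B, P C]) [P (B * C)]" by simp
    have "p.sim ([(Proj C, True)] @ [s' \<alpha> B, s \<alpha> (B * C)]) ([P C] @ [P (B * (B * C))])"
      by (intro p.sim_append sim_P_adj C sim_s_adj_s \<alpha> B BC)
    also have "p.sim ([P C] @ [P (B * (B * C))]) [P (B * C)]" using PCBC by (simp add: simps)
    finally show "p.sim (?u @ [s \<alpha> (B * C)]) [P (B * C)]" by simp
    have "p.sim ([s' \<alpha> (B * C), s \<alpha> B] @ [P C]) ([P (B * C * B)] @ [P C])"
      by (intro p.sim_append sim_s_adj_s \<alpha> B BC p.sim_refl P_word C)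
    also have "B * C * B = B * C" by (simp add: simps mult.commute[of _ B])
    also have "p.sim ([P (B * C)] @ [P C]) [P (B * C * C)]"
      using sim_P_P[OF BC(1) C] by simp
    also have "B * C * C = B * C" by (simp add: simps mult.assoc)
    finally show "p.sim (?v @ [s \<alpha> B, P C]) [P (B * C)]" by simp
    show "p.sim (?v @ [s \<alpha> (B * C)]) [P (B * C)]"
      using sim_s_adj_s[OF \<alpha> BC BC] by (simp add: simps)
  qed
  from p.sim_adj[OF this] show ?thesis unfolding adj .
qed

lemma sim_P_s_adj:
  assumes \<alpha>: "\<alpha> \<in> X" and B: "is_projection B" "B \<in> D [(\<alpha>, False)]" and C: "is_projection C"
  shows "p.sim [P C, s' \<alpha> B] [s' \<alpha> (B * C)]"
proof -
  have "p.sim [P C, s' \<alpha> B] [(Proj C, True), s' \<alpha> B]"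
    using p.sim_append[OF p.sim_sym[OF sim_P_adj[OF C]] p.sim_refl[OF s_word[OF \<alpha> B]]] by simp
  also have "p.sim [(Proj C, True), s' \<alpha> B] [s' \<alpha> (B * C)]"
    using p.sim_adj[OF sim_s_P[OF assms]] by (simp add: word_adj_def inv_letter_def)
  finally show ?thesis .
qed

lemma sim_P_s_\<theta>:
  assumes \<alpha>: "\<alpha> \<in> X" and B: "is_projection B" "B \<in> D [(\<alpha>, False)]" and A: "is_projection A"
  shows "p.sim [P A, s \<alpha> B] [s \<alpha> (B * \<theta> \<alpha> A)]"
  using sim_P_s[OF A \<alpha> B] sim_s_P[OF \<alpha> B \<theta>_projection[OF \<alpha> A]] by (rule p.sim_trans)

lemma sim_s_adj_P_\<theta>:
  assumes \<alpha>: "\<alpha> \<in> X" and B: "is_projection B" "B \<in> D [(\<alpha>, False)]" and A: "is_projection A"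
  shows "p.sim [s' \<alpha> B, P A] [s' \<alpha> (B * \<theta> \<alpha> A)]"
proof -
  have "p.sim [s' \<alpha> B, P A] [s' \<alpha> B, (Proj A, True)]"
    using p.sim_append[OF p.sim_refl[OF s_word[OF \<alpha> B]] p.sim_sym[OF sim_P_adj[OF A]]] by simp
  also have "p.sim [s' \<alpha> B, (Proj A, True)] [s' \<alpha> (B * \<theta> \<alpha> A)]"
    using p.sim_adj[OF sim_P_s_\<theta>[OF assms]] by (simp add: word_adj_def inv_letter_def)
  finally show ?thesis .
qed

text \<open>Each factor can be cut down to \<open>B * C\<close> by moving a projection between the
  two. As \<open>B * C\<close> is \<open>\<theta> \<alpha>\<close> of a projection in D_\<alpha>,
  the product is then the range projection given by \<open>sim_P_s_s_adj\<close>.\<close>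

lemma sim_s_s_adj:
  assumes \<alpha>: "\<alpha> \<in> X" and B: "is_projection B" "B \<in> D [(\<alpha>, False)]"
    and C: "is_projection C" "C \<in> D [(\<alpha>, False)]"
  shows "p.sim [s \<alpha> B, s' \<alpha> C] [P (\<tau> [(\<alpha>, True)] (B * C))]"
proof -
  have BC: "is_projection (B * C)" "B * C \<in> D [(\<alpha>, False)]"
    using B C neg_facts(12)[OF \<alpha>] by (auto simp: is_projection_mult)
  note simps = projection_simps[OF B(1)] projection_simps[OF C(1)] projection_simps[OF BC(1)]
  have "p.sim [s \<alpha> B] [s \<alpha> B, P B]"
    using p.sim_sym[OF sim_s_P[OF \<alpha> B B(1)]] by (simp add: simps)
  from p.sim_append[OF this p.sim_refl[OF s_word[OF \<alpha> C]]]
  have "p.sim [s \<alpha> B, s' \<alpha> C] ([s \<alpha> B] @ [P B, s' \<alpha> C])" by simp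
  also have "p.sim ([s \<alpha> B] @ [P B, s' \<alpha> C]) ([s \<alpha> B] @ [s' \<alpha> (B * C)])"
    using sim_P_s_adj[OF \<alpha> C B(1)]
    by (intro p.sim_append p.sim_refl s_word \<alpha> B) (simp add: mult.commute)
  also have "p.sim ([s \<alpha> B] @ [s' \<alpha> (B * C)]) ([s \<alpha> B] @ [P (B * C), s' \<alpha> (B * C)])"
    using p.sim_sym[OF sim_P_s_adj[OF \<alpha> BC BC(1)]]
    by (intro p.sim_append p.sim_refl s_word \<alpha> B) (simp add: simps)
  also have "p.sim ([s \<alpha> B] @ [P (B * C), s' \<alpha> (B * C)]) ([s \<alpha> (B * C)] @ [s' \<alpha> (B * C)])"
    using p.sim_append[OF sim_s_P[OF \<alpha> B BC(1)] p.sim_refl[OF s_word[OF \<alpha> BC]]] by (simp add: simps)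
  also have "p.sim ([s \<alpha> (B * C)] @ [s' \<alpha> (B * C)]) [P (\<tau> [(\<alpha>, True)] (B * C))]"
  proof -
    have "is_projection (\<tau> [(\<alpha>, True)] (B * C))" "\<tau> [(\<alpha>, True)] (B * C) \<in> D [(\<alpha>, True)]"
      using pos_facts(1,7)[OF \<alpha> BC(2)] BC(1) by blast+
    from p.sim_sym[OF sim_P_s_s_adj[OF \<alpha> this]] show ?thesis
      by (simp add: \<theta>_\<tau>[OF \<alpha> BC(2)])
  qed
  finally show ?thesis .
qed

section \<open>Reduction of words to normal form\<close>

lemma \<theta>_mult_\<tau>:
  assumes "\<alpha> \<in> X" "x \<in> D [(\<alpha>, True)]"
  shows "\<tau> [(\<alpha>, False)] (x * A) = \<tau> [(\<alpha>, False)] x * \<theta> \<alpha> A"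
proof -
  have "x * A = x * pr \<alpha> A" using pr_mult_D[OF assms, of A] by (simp add: mult.commute)
  then show ?thesis using assms by (simp add: pos_facts pr \<theta>_def)
qed

text \<open>Treats a generator and its inverse alike. For a positive letter the left rule combines
  (ii) with \<open>sim_s_P\<close> and the right rule is \<open>sim_s_P\<close>; negative letters
  use the adjoint congruences.\<close>

lemma sim_letter_P:
  assumes a: "fst a \<in> X" and q: "is_projection q" "q \<in> D [a]" and A: "is_projection A"
  shows "p.sim [P A, letter_gen a q] [letter_gen a (A * q)]"
    and "p.sim [letter_gen a q, P A] [letter_gen a (tmul [a] q A)]"
proof -
  obtain \<alpha> b where ab: "a = (\<alpha>, b)" by (cases a)
  with a have \<alpha>: "\<alpha> \<in> X" by simp
  note inv = inv_letter_pos[OF \<alpha>]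
  have "p.sim [P A, letter_gen a q] [letter_gen a (A * q)] \<and>
      p.sim [letter_gen a q, P A] [letter_gen a (tmul [a] q A)]"
  proof (cases b)
    case True
    define B where "B = \<tau> [(\<alpha>, False)] q"
    have B: "is_projection B" "B \<in> D [(\<alpha>, False)]" "\<tau> [(\<alpha>, True)] B = q"
      using q pos_facts[OF \<alpha>] by (auto simp: B_def ab True)
    have "\<tau> [(\<alpha>, False)] (A * q) = B * \<theta> \<alpha> A"
      using \<theta>_mult_\<tau>[OF \<alpha>, of q A] q by (simp add: B_def ab True mult.commute)
    moreover have "\<tau> [(\<alpha>, False)] (tmul [a] q A) = B * A"
      using neg_facts(12)[OF \<alpha> B(2), of A] by (simp add: ab True pos_facts[OF \<alpha>] flip: B_def)
    ultimately show ?thesis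
      using sim_P_s_\<theta>[OF \<alpha> B(1,2) A] sim_s_P[OF \<alpha> B(1,2) A]
      by (simp add: letter_gen_def ab True inv flip: B_def)
  next
    case False
    have q': "q \<in> D [(\<alpha>, False)]" using q by (simp add: ab False)
    have "tmul [a] q A = q * \<theta> \<alpha> A"
      using \<theta>_mult_\<tau>[OF \<alpha> pos_facts(1)[OF \<alpha> q'], of A] q' by (simp add: ab False neg_facts[OF \<alpha>] pos_facts(3)[OF \<alpha>])
    then show ?thesis
      using sim_P_s_adj[OF \<alpha> q(1) q' A] sim_s_adj_P_\<theta>[OF \<alpha> q(1) q' A]
      by (simp add: letter_gen_def ab False mult.commute)
  qed
  then show "p.sim [P A, letter_gen a q] [letter_gen a (A * q)]"
    "p.sim [letter_gen a q, P A] [letter_gen a (tmul [a] q A)]" by simp_all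
qed

text \<open>Cancellation of adjacent letters: a positive letter followed by its inverse uses (iv)
  through \<open>sim_s_s_adj\<close>, the opposite order uses (iii).\<close>

lemma sim_letter_inv:
  assumes a: "fst a \<in> X" and q: "is_projection q" "q \<in> D [a]"
    and r: "is_projection r" "r \<in> D [inv_letter a]"
  shows "p.sim [letter_gen a q, letter_gen (inv_letter a) r] [P (tmul [a] q r)]"
proof -
  obtain \<alpha> b where ab: "a = (\<alpha>, b)" by (cases a)
  with a have \<alpha>: "\<alpha> \<in> X" by simp
  note inv = inv_letter_pos[OF \<alpha>]
  show ?thesis
  proof (cases b)
    case True
    have q': "q \<in> D [(\<alpha>, True)]" and r': "r \<in> D [(\<alpha>, False)]" using q r by (auto simp: ab True inv)
    show ?thesis
      using sim_s_s_adj[OF \<alpha> pos_facts(8)[OF \<alpha> q' q(1)] pos_facts(2)[OF \<alpha> q'] r(1) r']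
      by (simp add: letter_gen_def ab True inv pos_facts(9)[OF \<alpha>])
  next
    case False
    have q': "q \<in> D [(\<alpha>, False)]" and r': "r \<in> D [(\<alpha>, True)]" using q r by (auto simp: ab False inv)
    have "tmul [a] q r = q * \<tau> [(\<alpha>, False)] r"
      using q' r' pos_facts[OF \<alpha>] by (simp add: ab False neg_facts(9)[OF \<alpha>])
    then show ?thesis
      using sim_s_adj_s[OF \<alpha> q(1) q' pos_facts(8)[OF \<alpha> r' r(1)] pos_facts(2)[OF \<alpha> r']]
      by (simp add: letter_gen_def ab False inv)
  qed
qed

lemma tmul_letter_self: "fst a \<in> X \<Longrightarrow> is_projection q \<Longrightarrow> q \<in> D [a] \<Longrightarrow> tmul [a] q (\<tau> [inv_letter a] q) = q"
  using letter_facts(8)[of a q] letter_facts(4)[of a q] by (simp add: letter_facts(9) is_projection_def)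

text \<open>Splits off the right support of a letter, so that a change of its coefficient can be
  passed on to the next letter.\<close>

lemma sim_letter_absorb:
  assumes "fst a \<in> X" "is_projection q" "q \<in> D [a]"
  shows "p.sim [letter_gen a q] [letter_gen a q, P (\<tau> [inv_letter a] q)]"
  using p.sim_sym[OF sim_letter_P(2)[OF assms letter_facts(8)[OF assms(1,3,2)]]] assms
  by (simp add: tmul_letter_self)

text \<open>\<open>A\<close> cuts the first letter; the right support \<open>?Aq\<close> of the
  shortened letter is split off and travels through the rest by induction. There it multiplies
  \<open>?q\<close>, and the product is \<open>?Aq\<close>, the tail coefficient prescribed for
  \<open>A * q\<close>.\<close>

lemma sim_P_normal_word:
  assumes "t \<in> carrier FG" "is_projection q" "q \<in> D t" "is_projection A"
  shows "p.sim (P A # normal_word t q) (normal_word t (A * q))"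
  using assms
proof (induction t arbitrary: q A)
  case Nil
  then show ?case by (simp add: sim_P_P)
next
  case (Cons a t)
  note c = Cons_closed[OF Cons.prems(1)] and d = D_Cons[OF Cons.prems(1,3)]
  have Aq: "is_projection (A * q)" "A * q \<in> D [a]"
    using Cons.prems d letter_facts(11)[OF c(1)] by (auto simp: is_projection_mult)
  let ?q = "\<tau> [inv_letter a] q" and ?Aq = "\<tau> [inv_letter a] (A * q)"
  have q: "is_projection ?q" "is_projection ?Aq"
    using letter_facts(8)[OF c(1)] d(1) Aq Cons.prems(2) by auto
  have w: "normal_word t ?q \<in> nc_words gens" using normal_word(1)[OF c(2) q(1) d(2)] .
  have "?Aq * ?q = \<tau> [inv_letter a] (A * q * q)"
    using letter_facts(6)[OF c(1) Aq(2) d(1)] by simp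
  then have mult: "?Aq * ?q = ?Aq" using Cons.prems(2) by (simp add: is_projection_def mult.assoc)
  have "p.sim ([P A, letter_gen a q] @ normal_word t ?q) ([letter_gen a (A * q)] @ normal_word t ?q)"
    using sim_letter_P(1)[OF c(1) Cons.prems(2) d(1) Cons.prems(4)] w by (rule sim_append_right)
  also have "p.sim ([letter_gen a (A * q)] @ normal_word t ?q) ([letter_gen a (A * q), P ?Aq] @ normal_word t ?q)"
    using sim_letter_absorb[OF c(1) Aq] w by (rule sim_append_right)
  also have "[letter_gen a (A * q), P ?Aq] @ normal_word t ?q = letter_gen a (A * q) # P ?Aq # normal_word t ?q"
    by simp
  also have "p.sim \<dots> (letter_gen a (A * q) # normal_word t (?Aq * ?q))"
    using Cons.IH[OF c(2) q(1) d(2) q(2)] letter_gen(1)[OF c(1) Aq] by (rule sim_Cons)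
  finally show ?case by (simp add: mult)
qed

text \<open>Follows the multiplication of reduced words. If \<open>t\<close> starts with the inverse
  of \<open>a\<close>, two letters merge into a projection, which the tail absorbs. Otherwise the
  coefficients on both sides of the junction are cut down to their common part.\<close>

lemma sim_letter_normal_word:
  assumes a: "fst a \<in> X" and r: "is_projection r" "r \<in> D [a]"
    and t: "t \<in> carrier FG" and q: "is_projection q" "q \<in> D t"
  shows "p.sim (letter_gen a r # normal_word t q) (normal_word (push_letter a t) (tmul [a] r q))"
proof -
  define r' where "r' = tmul [a] r q"
  have r': "is_projection r'" "r' \<in> D [a]"
    using a r q by (auto simp: r'_def is_projection_tmul tmul_closed1)
  \<comment> \<open>The coefficient of the product seen between the letter and the word;
    \<open>\<tau> [a]\<close> carries it to \<open>r'\<close>.\<close>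
  define z where "z = \<tau> [inv_letter a] r * q"
  have \<tau>r: "is_projection (\<tau> [inv_letter a] r)" "\<tau> [inv_letter a] r \<in> D [inv_letter a]"
    using letter_facts(2,8)[OF a r(2)] r(1) by auto
  have z: "is_projection z" "z \<in> D [inv_letter a]" "z \<in> D t" "\<tau> [a] z = r'"
    using \<tau>r q letter_facts(12)[of "inv_letter a"] a t
    by (auto simp: z_def is_projection_mult r'_def letter_facts(9) D_simps)
  show ?thesis
  proof (cases "\<exists>t'. t = inv_letter a # t'")
    case True
    then obtain t' where t': "t = inv_letter a # t'" by blast
    have c: "t' \<in> carrier FG" using Cons_closed[of "inv_letter a" t'] t t' by simp
    have d: "q \<in> D [inv_letter a]" "\<tau> [a] q \<in> D t'" using D_Cons[of "inv_letter a" t' q] t t' q by simp_all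
    have \<tau>q: "is_projection (\<tau> [a] q)" using letter_facts(7)[OF a d(1) q(1)] .
    have "r' * \<tau> [a] q = \<tau> [a] (z * q)" using letter_facts(5)[OF a z(2) d(1)] z(4) by simp
    then have mult: "r' * \<tau> [a] q = r'" using q(1) z(4) by (simp add: z_def is_projection_def mult.assoc)
    have "p.sim ([letter_gen a r, letter_gen (inv_letter a) q] @ normal_word t' (\<tau> [a] q))
        ([P r'] @ normal_word t' (\<tau> [a] q))"
      using sim_letter_inv[OF a r q(1) d(1)] normal_word(1)[OF c \<tau>q d(2)]
      unfolding r'_def by (rule sim_append_right)
    also have "p.sim ([P r'] @ normal_word t' (\<tau> [a] q)) (normal_word t' (r' * \<tau> [a] q))"
      using sim_P_normal_word[OF c \<tau>q d(2) r'(1)] by simp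
    finally show ?thesis by (simp add: t' mult push_letter_Cons flip: r'_def)
  next
    case False
    then have push: "push_letter a t = a # t"
      by (cases t) (auto simp: push_letter_Nil push_letter_Cons)
    have \<tau>r': "\<tau> [inv_letter a] r' = z" using letter_facts(3)[OF a z(2)] z(4) by simp
    have wq: "normal_word t q \<in> nc_words gens" and wz: "normal_word t z \<in> nc_words gens"
      using normal_word(1) t q z by blast+
    have g: "fst (letter_gen a r) \<in> gens" using letter_gen(1)[OF a r] .
    have "p.sim ([letter_gen a r] @ normal_word t q)
        ([letter_gen a r, P (\<tau> [inv_letter a] r)] @ normal_word t q)"
      using sim_letter_absorb[OF a r] wq by (rule sim_append_right)
    also have "\<dots> = letter_gen a r # P (\<tau> [inv_letter a] r) # normal_word t q" by simp
    also have "p.sim \<dots> (letter_gen a r # normal_word t z)"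
      unfolding z_def using sim_P_normal_word[OF t q \<tau>r(1)] g by (rule sim_Cons)
    \<comment> \<open>The absorption rule read backwards: the word emits the projection
      \<open>z\<close>, which then cuts the letter in front.\<close>
    also have "p.sim (letter_gen a r # normal_word t z) (letter_gen a r # P z # normal_word t z)"
      using p.sim_sym[OF sim_P_normal_word[OF t z(1,3,1)]] g z(1)
      by (intro sim_Cons) (simp_all add: is_projection_def)
    also have "letter_gen a r # P z # normal_word t z = [letter_gen a r, P z] @ normal_word t z" by simp
    also have "p.sim \<dots> ([letter_gen a r'] @ normal_word t z)"
    proof (rule sim_append_right[OF _ wz])
      have "tmul [a] r z = r'"
        using z(4) \<tau>r by (simp add: letter_facts(9)[OF a] z_def projection_simps(2))
      then show "p.sim [letter_gen a r, P z] [letter_gen a r']"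
        using sim_letter_P(2)[OF a r z(1)] by simp
    qed
    finally show ?thesis by (simp add: push \<tau>r' flip: r'_def)
  qed
qed

abbreviation nf where "nf x \<equiv> normal_word (snd x) (fst x)"

lemma gens_letter_cases:
  assumes "fst l \<in> gens"
  obtains (Proj) A b where "l = (Proj A, b)" "is_projection A"
    | (Isom) a q where "l = letter_gen a q" "fst a \<in> X" "is_projection q" "q \<in> D [a]"
proof (cases l rule: letter_image.cases)
  case (1 A b)
  then show thesis using assms by (intro Proj) (simp_all add: gens_iff)
next
  case (2 \<alpha> B)
  then have \<alpha>: "\<alpha> \<in> X" and B: "is_projection B" "B \<in> D [(\<alpha>, False)]"
    using assms by (auto simp: gens_iff)
  have "l = letter_gen (\<alpha>, True) (\<tau> [(\<alpha>, True)] B)"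
    using 2 pos_facts(3)[OF \<alpha> B(2)] by (simp add: letter_gen_def inv_letter_pos[OF \<alpha>])
  then show thesis using \<alpha> B pos_facts(1,7)[OF \<alpha> B(2)] by (intro Isom[of "(\<alpha>, True)" "\<tau> [(\<alpha>, True)] B"]) simp_all
next
  case (3 \<alpha> B)
  then show thesis using assms
    by (intro Isom[of "(\<alpha>, False)" B]) (auto simp: gens_iff letter_gen_def)
qed

text \<open>The core of the reduction: words with equal images are congruent modulo the kernel of
  \<open>p\<close>. Each letter is multiplied onto the normal form of the remaining word.\<close>

lemma sim_nf: "w \<in> nc_words gens \<Longrightarrow> p.sim w (nf (word_image w))"
proof (induction rule: nc_words_induct)
  case (single l)
  then show ?case
  proof (cases l rule: gens_letter_cases)
    case (Proj A b)
    then show ?thesis using sim_P_adj[of A] p.sim_refl[OF P_word, of A] by (cases b) simp_all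
  next
    case (Isom a q)
    then show ?thesis
      using sim_letter_absorb[of a q] letter_gen(2)[of a q] by simp
  qed
next
  case (Cons l w)
  define x where "x = word_image w"
  have x: "is_projection (fst x)" "snd x \<in> carrier FG" "fst x \<in> D (snd x)"
    using proj_deltasD[OF word_image_closed[OF Cons(2)]] by (simp_all add: x_def)
  have nf: "nf x \<in> nc_words gens" using normal_word(1)[OF x(2,1,3)] .
  have "w \<noteq> []" using Cons(2) by (simp add: nc_words_def)
  then have img: "word_image (l # w) = pmul (letter_image l) x" by (simp add: word_image_Cons x_def)
  have "p.sim (l # w) (l # nf x)" using Cons.IH Cons(1) unfolding x_def by (rule sim_Cons)
  also have "p.sim (l # nf x) (nf (pmul (letter_image l) x))"
    using Cons(1)
  proof (cases l rule: gens_letter_cases)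
    case (Proj A b)
    have "p.sim [l] [P A]" using Proj sim_P_adj[of A] p.sim_refl[OF P_word, of A] by (cases b) simp_all
    from sim_append_right[OF this nf] have "p.sim (l # nf x) (P A # nf x)" by simp
    also have "p.sim (P A # nf x) (normal_word (snd x) (A * fst x))"
      using sim_P_normal_word[OF x(2,1,3)] Proj by simp
    finally show ?thesis
      using Proj by (simp add: pmul_def tmul_def \<tau>_Nil FG_simps(2))
  next
    case (Isom a q)
    then show ?thesis
      using sim_letter_normal_word[OF Isom(2-4) x(2,1,3)] letter_gen(2)[OF Isom(2-4)]
      by (simp add: pmul_def letter_mult)
  qed
  finally show ?case unfolding img .
qed

text \<open>The image of the left-hand word is \<open>q * r\<close> at the neutral element, whose
  normal word is a single projection.\<close>

lemma sim_normal_word_adj: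
  assumes t: "t \<in> carrier FG" and q: "is_projection q" "q \<in> D t" and r: "is_projection r" "r \<in> D t"
  shows "p.sim (normal_word t q @ word_adj (normal_word t r)) [P (q * r)]"
proof -
  note Q = normal_word[OF t q] and R = normal_word[OF t r]
  have "\<tau> t (\<tau> (m_inv FG t) q * \<tau> (m_inv FG t) r) = q * r"
    using t q r by (simp add: \<tau>_mult \<tau>_inv_closed \<tau>_\<tau>_inv)
  then have "word_image (normal_word t q @ word_adj (normal_word t r)) = (q * r, [])"
    using Q R t by (simp add: word_image_append word_image_adj padj_def pmul_def tmul_def)
      (simp add: FG_simps)
  then show ?thesis
    using sim_nf[of "normal_word t q @ word_adj (normal_word t r)"] Q R nc_words_append by fastforce
qed

text \<open>The \<open>p\<close>-norm of a combination of words with the same \<open>t\<close> does not depend on \<open>t\<close>.\<close>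

lemma p_normal_words:
  assumes I: "finite I" and t: "t \<in> carrier FG"
    and q: "\<And>i. i \<in> I \<Longrightarrow> is_projection (q i)" "\<And>i. i \<in> I \<Longrightarrow> q i \<in> D t"
  shows "(p (\<lambda>v. \<Sum>i\<in>I. c i * nc_mono (normal_word t (q i)) v))\<^sup>2 =
    p (\<lambda>v. \<Sum>k\<in>I \<times> I. (c (fst k) * cnj (c (snd k))) * nc_mono [P (q (fst k) * q (snd k))] v)"
proof -
  have w: "normal_word t (q i) \<in> nc_words gens" if "i \<in> I" for i
    using normal_word(1)[OF t q(1)[OF that] q(2)[OF that]] .
  have "(p (\<lambda>v. \<Sum>i\<in>I. c i * nc_mono (normal_word t (q i)) v))\<^sup>2 =
    p (\<lambda>v. \<Sum>k\<in>I \<times> I. (c (fst k) * cnj (c (snd k))) *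
      nc_mono (normal_word t (q (fst k)) @ word_adj (normal_word t (q (snd k)))) v)"
    using p.p_square[of I "\<lambda>i. normal_word t (q i)" c, OF I w] by (simp add: case_prod_unfold)
  also have "\<dots> = p (\<lambda>v. \<Sum>k\<in>I \<times> I. (c (fst k) * cnj (c (snd k))) * nc_mono [P (q (fst k) * q (snd k))] v)"
  proof (rule p.p_sum_cong)
    fix k assume k: "k \<in> I \<times> I"
    have sim: "p.sim (normal_word t (q (fst k)) @ word_adj (normal_word t (q (snd k)))) [P (q (fst k) * q (snd k))]"
      using k q by (intro sim_normal_word_adj t) auto
    then show "nc_mono (normal_word t (q (fst k)) @ word_adj (normal_word t (q (snd k)))) \<in> carrier p.F"
      "nc_mono [P (q (fst k) * q (snd k))] \<in> carrier p.F"
      "p.d (nc_mono (normal_word t (q (fst k)) @ word_adj (normal_word t (q (snd k)))))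
        (nc_mono [P (q (fst k) * q (snd k))]) = 0"
      by (auto simp: p.sim_def intro: free_mono_closed)
  qed (use I in simp)
  finally show ?thesis .
qed

section \<open>Estimates for combinations of normal words\<close>

lemma P_closed: "is_projection A \<Longrightarrow> nc_mono [P A] \<in> carrier p.F"
  by (intro free_mono_closed P_word)

text \<open>Finite additivity, by iterating the union relation of (i). Disjointness turns the
  intersection term into \<open>P 0\<close>, which is null for \<open>p\<close> but is not the zero
  polynomial.\<close>

lemma p_orthogonal_union:
  assumes R: "orthogonal_projections R"
  shows "p.d (nc_mono [P (\<Sum>R)]) (\<lambda>v. \<Sum>r\<in>R. 1 * nc_mono [P r] v) = 0"
proof -
  have "finite R" using R by (simp add: orthogonal_projections_def)
  then show ?thesis
    using R
  proof (induction R)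
    case empty
    have "sdiff p.F (nc_mono [P 0]) (\<lambda>_. 0) = nc_mono [P 0]" by (simp add: free_simps)
    then show ?case by (simp add: p_P_zero)
  next
    case (insert r R)
    let ?e = "\<Sum>R" and ?S = "\<lambda>R v. \<Sum>r\<in>R. 1 * nc_mono [P r] v"
    have oR: "orthogonal_projections R"
      using insert.prems by (rule orthogonal_projections_subset) blast
    have e: "is_projection ?e" using is_projection_sum[OF oR] .
    have r: "is_projection r" using insert.prems by (simp add: orthogonal_projections_def)
    have re: "r * ?e = 0"
      using insert.prems insert.hyps
      by (auto simp: sum_distrib_left orthogonal_projections_def intro!: sum.neutral)
    have u: "is_projection (r + ?e)" using is_projection_sum[OF insert.prems] insert.hyps by simp
    have cS: "?S R' \<in> carrier p.F" if "orthogonal_projections R'" for R'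
      using that by (intro free_sum_closed P_closed) (auto simp: orthogonal_projections_def)
    note SR = cS[OF oR] cS[OF insert.prems]
    \<comment> \<open>\<open>?x\<close> is the right-hand side of the union relation.
      \<open>?y\<close> replaces the sum by the combination from the induction hypothesis and the
      null term by zero, which gives the combination over \<open>insert r R\<close>.\<close>
    let ?x = "sdiff p.F (sadd p.F (nc_mono [P r]) (nc_mono [P ?e])) (nc_mono [P 0])"
    let ?y = "sdiff p.F (sadd p.F (nc_mono [P r]) (?S R)) (\<lambda>_. 0)"
    have zc: "(\<lambda>_. 0) \<in> carrier p.F" using \<Phi>.S.zero_closed by (simp add: free_simps)
    have xc: "?x \<in> carrier p.F" "?y \<in> carrier p.F"
      using SR r e zc by (auto intro!: \<Phi>.S.sdiff_closed \<Phi>.S.add_closed P_closed)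
    have "(nc_letter (Proj (r + ?e - r * ?e)),
        \<lambda>w. nc_letter (Proj r) w + nc_letter (Proj ?e) w - nc_letter (Proj (r * ?e)) w) \<in> relations"
      unfolding bds_relations_def Let_def
      by (rule UnI1, rule UnI1, rule UnI1, rule UnI2) (use r e in auto)
    from relations_p[OF this] have 1: "p.d (nc_mono [P (r + ?e)]) ?x = 0"
      by (simp add: re nc_letter_eq_mono free_simps)
    have "sdiff p.F ?x ?y = sdiff p.F (sdiff p.F (nc_mono [P ?e]) (?S R)) (nc_mono [P 0])"
      by (simp add: free_simps algebra_simps)
    then have "p.d ?x ?y \<le> p.d (nc_mono [P ?e]) (?S R) + cmod (-1) * p (nc_mono [P 0])"
      using p.triangle[of "sdiff p.F (nc_mono [P ?e]) (?S R)" "sscale p.F (-1) (nc_mono [P 0])"]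
        p.scale[of "nc_mono [P 0]" "-1"] SR e
      by (simp add: sdiff_def[of _ "sdiff _ _ _"] \<Phi>.S.scale_closed P_closed \<Phi>.S.sdiff_closed)
    then have 2: "p.d ?x ?y \<le> 0" using insert.IH[OF oR] by (simp add: p_P_zero)
    have "?y = ?S (insert r R)" using insert.hyps by (simp add: free_simps)
    then have "p.d (nc_mono [P (r + ?e)]) (?S (insert r R)) \<le> 0"
      using p.d_triangle[OF P_closed[OF u] xc] 1 2 by simp
    then show ?case
      using p.d_nonneg[OF P_closed[OF u] SR(2)] insert.hyps by simp
  qed
qed

lemma p_P_le_one:
  assumes "is_projection A"
  shows "p (nc_mono [P A]) \<le> 1"
proof (rule p.p_mono_le_one[where v = "[P A]"])
  have PA: "p.sim [P A, P A] [P A]" using sim_P_P[OF assms assms] assms by (simp add: is_projection_def)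
  then show "p.sim ([P A] @ [P A]) [P A]" by simp
  show "[P A] \<in> nc_words gens" using assms by (rule P_word)
  have "p.sim ([(Proj A, True)] @ [P A]) ([P A] @ [P A])"
    by (intro p.sim_append sim_P_adj p.sim_refl P_word assms)
  then show "p.sim (word_adj [P A] @ [P A]) [P A]"
    using PA p.sim_trans by (simp add: inv_letter_def)
  show "p.sim (word_adj [P A]) [P A]"
    using sim_P_adj[OF assms] by (simp add: inv_letter_def)
qed

text \<open>An instance of \<open>cstar_seminorm_le_sup\<close>. Its C*-hypothesis is
  \<open>p_normal_words\<close> at the empty group word, where off-diagonal terms are null by
  orthogonality, and its normalization is additivity together with
  \<open>p_P_le_one\<close>.\<close>

lemma p_orthogonal_sum_le:
  assumes R: "orthogonal_projections R" and M: "0 \<le> M" "\<And>r. r \<in> R \<Longrightarrow> cmod (d r) \<le> M"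
  shows "p (\<lambda>v. \<Sum>r\<in>R. d r * nc_mono [P r] v) \<le> M"
proof (rule cstar_seminorm_le_sup[where n = "\<lambda>d. p (\<lambda>v. \<Sum>r\<in>R. d r * nc_mono [P r] v)" and R = R])
  have fin: "finite R" and pR: "\<And>r. r \<in> R \<Longrightarrow> is_projection r"
    and oR: "\<And>r s. r \<in> R \<Longrightarrow> s \<in> R \<Longrightarrow> r \<noteq> s \<Longrightarrow> r * s = 0"
    using R by (auto simp: orthogonal_projections_def)
  have closed: "(\<lambda>v. \<Sum>r\<in>R. d r * nc_mono [P r] v) \<in> carrier p.F" for d
    using pR by (intro free_sum_closed fin P_closed)
  show "0 \<le> p (\<lambda>v. \<Sum>r\<in>R. d r * nc_mono [P r] v)" for d
    by (rule p.nonneg[OF closed])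
  show "p (\<lambda>v. \<Sum>r\<in>R. (c r + d r) * nc_mono [P r] v) \<le>
      p (\<lambda>v. \<Sum>r\<in>R. c r * nc_mono [P r] v) + p (\<lambda>v. \<Sum>r\<in>R. d r * nc_mono [P r] v)" for c d
    using p.triangle[OF closed closed, of c d] by (simp add: free_simps distrib_right sum.distrib)
  show "p (\<lambda>v. \<Sum>r\<in>R. (a * c r) * nc_mono [P r] v) = cmod a * p (\<lambda>v. \<Sum>r\<in>R. c r * nc_mono [P r] v)" for a c
    using p.scale[OF closed, of a c] by (simp add: free_simps sum_distrib_left mult.assoc)
  show "p (\<lambda>v. \<Sum>r\<in>R. 1 * nc_mono [P r] v) \<le> 1"
    using p_orthogonal_union[OF R] p_P_le_one[OF is_projection_sum[OF R]]
      p.abs_diff_le_d[OF P_closed[OF is_projection_sum[OF R]] closed[of "\<lambda>_. 1"]] by simp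
  show "(p (\<lambda>v. \<Sum>r\<in>R. c r * nc_mono [P r] v))\<^sup>2 =
      p (\<lambda>v. \<Sum>r\<in>R. complex_of_real ((cmod (c r))\<^sup>2) * nc_mono [P r] v)" for c
  proof -
    \<comment> \<open>Replaces the null words \<open>P 0\<close> off the diagonal by the literal
      zero, so that the double sum reduces to its diagonal.\<close>
    define m where "m k = (if fst k = snd k then nc_mono [P (fst k)] else (\<lambda>_. 0))" for k :: "'a \<times> 'a"
    have zc: "(\<lambda>_. 0) \<in> carrier p.F" using \<Phi>.S.zero_closed by (simp add: free_simps)
    have "(p (\<lambda>v. \<Sum>r\<in>R. c r * nc_mono [P r] v))\<^sup>2 =
        p (\<lambda>v. \<Sum>k\<in>R \<times> R. (c (fst k) * cnj (c (snd k))) * nc_mono [P (fst k * snd k)] v)"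
      using p_normal_words[of R "[]" "\<lambda>r. r" c] fin pR by (simp add: D_Nil)
    also have "\<dots> = p (\<lambda>v. \<Sum>k\<in>R \<times> R. (c (fst k) * cnj (c (snd k))) * m k v)"
    proof (rule p.p_sum_cong)
      fix k assume "k \<in> R \<times> R"
      then have k: "fst k \<in> R" "snd k \<in> R" by auto
      show "nc_mono [P (fst k * snd k)] \<in> carrier p.F" "m k \<in> carrier p.F"
        using k pR zc by (auto simp: m_def intro!: P_closed is_projection_mult)
      show "p.d (nc_mono [P (fst k * snd k)]) (m k) = 0"
      proof (cases "fst k = snd k")
        case True
        then show ?thesis using pR[OF k(1)] pR[OF k(2)]
          by (simp add: m_def is_projection_def p.d_self P_closed)
      next
        case False
        then show ?thesis using oR[OF k] by (simp add: m_def free_simps p_P_zero)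
      qed
    qed (use fin in simp)
    also have "(\<lambda>v. \<Sum>k\<in>R \<times> R. (c (fst k) * cnj (c (snd k))) * m k v) =
        (\<lambda>v. \<Sum>r\<in>R. complex_of_real ((cmod (c r))\<^sup>2) * nc_mono [P r] v)"
    proof
      fix v
      have "(\<Sum>k\<in>R \<times> R. (c (fst k) * cnj (c (snd k))) * m k v) =
          (\<Sum>r\<in>R. \<Sum>s\<in>R. (c r * cnj (c s)) * m (r, s) v)"
        by (simp add: sum.cartesian_product case_prod_unfold)
      also have "\<dots> = (\<Sum>r\<in>R. \<Sum>s\<in>R. if s = r then complex_of_real ((cmod (c r))\<^sup>2) * nc_mono [P r] v else 0)"
        by (intro sum.cong refl) (simp add: m_def complex_norm_square del: of_real_power)
      finally show "(\<Sum>k\<in>R \<times> R. (c (fst k) * cnj (c (snd k))) * m k v) =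
          (\<Sum>r\<in>R. complex_of_real ((cmod (c r))\<^sup>2) * nc_mono [P r] v)"
        using fin by simp
    qed
    finally show ?thesis .
  qed
  show "p (\<lambda>v. \<Sum>r\<in>R. c r * nc_mono [P r] v) = p (\<lambda>v. \<Sum>r\<in>R. d r * nc_mono [P r] v)"
    if "\<And>r. r \<in> R \<Longrightarrow> c r = d r" for c d
    using that by simp
qed (use M in auto)

text \<open>After refinement the coefficient of an atom \<open>r\<close> is read off from
  \<open>r * x\<close>. Since \<open>norm r = 1\<close>, it is at most \<open>norm x\<close>, and
  the orthogonal estimate applies.\<close>

lemma p_projections_le:
  assumes I: "finite I" and q: "\<And>i. i \<in> I \<Longrightarrow> is_projection (q i)"
  shows "p (\<lambda>v. \<Sum>i\<in>I. c i * nc_mono [P (q i)] v) \<le> norm (\<Sum>i\<in>I. cscale (c i) (q i))"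
proof -
  obtain R where R: "orthogonal_projections R" "0 \<notin> R"
    and "\<And>x. x \<in> q ` I \<Longrightarrow> x = \<Sum>{r \<in> R. r * x = r}"
    by (rule projections_refine[of "q ` I"]) (use I q in auto)
  then have qR: "\<And>i. i \<in> I \<Longrightarrow> q i = \<Sum>{r \<in> R. r * q i = r}" by blast
  have fin: "finite R" using R by (simp add: orthogonal_projections_def)
  define d where "d r = (\<Sum>i | i \<in> I \<and> r * q i = r. c i)" for r
  define x where "x = (\<Sum>i\<in>I. cscale (c i) (q i))"
  have x: "x = (\<Sum>r\<in>R. cscale (d r) r)"
    unfolding x_def d_def using I fin qR by (rule sum_cscale_refine)
  have "cmod (d r) \<le> norm x" if "r \<in> R" for r
  proof -
    have nr: "norm r = 1"
      using that R by (intro norm_projection) (auto simp: orthogonal_projections_def)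
    have "r * x = cscale (d r) r"
      unfolding x using R(1) that by (rule orthogonal_projections_mult_sum)
    then show ?thesis using norm_mult_ineq[of r x] nr by (simp add: norm_cscale)
  qed
  then have le: "p (\<lambda>v. \<Sum>r\<in>R. d r * nc_mono [P r] v) \<le> norm x"
    using R by (intro p_orthogonal_sum_le) auto
  define m where "m i = (\<lambda>v. \<Sum>r | r \<in> R \<and> r * q i = r. 1 * nc_mono [P r] v)" for i
  have "p (\<lambda>v. \<Sum>i\<in>I. c i * nc_mono [P (q i)] v) = p (\<lambda>v. \<Sum>i\<in>I. c i * m i v)"
  proof (rule p.p_sum_cong[OF I])
    fix i assume i: "i \<in> I"
    have Ri: "orthogonal_projections {r \<in> R. r * q i = r}"
      using R(1) by (rule orthogonal_projections_subset) blast
    show "nc_mono [P (q i)] \<in> carrier p.F" using q[OF i] by (rule P_closed)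
    show "m i \<in> carrier p.F"
      unfolding m_def using Ri by (intro free_sum_closed P_closed) (auto simp: orthogonal_projections_def)
    show "p.d (nc_mono [P (q i)]) (m i) = 0"
      using p_orthogonal_union[OF Ri] by (simp add: m_def flip: qR[OF i])
  qed
  also have "(\<lambda>v. \<Sum>i\<in>I. c i * m i v) = (\<lambda>v. \<Sum>r\<in>R. d r * nc_mono [P r] v)"
  proof
    fix v
    have "(\<Sum>i\<in>I. c i * m i v) = (\<Sum>i\<in>I. \<Sum>r | r \<in> R \<and> r * q i = r. c i * nc_mono [P r] v)"
      by (simp add: m_def sum_distrib_left)
    also have "\<dots> = (\<Sum>r\<in>R. \<Sum>i | i \<in> I \<and> r * q i = r. c i * nc_mono [P r] v)"
      using I fin by (rule sum.swap_restrict)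
    finally show "(\<Sum>i\<in>I. c i * m i v) = (\<Sum>r\<in>R. d r * nc_mono [P r] v)"
      by (simp add: d_def sum_distrib_right)
  qed
  finally show ?thesis using le by (simp add: x_def)
qed

text \<open>The right-hand side in \<open>p_normal_words\<close> does not mention \<open>t\<close>,
  so the case of the empty group word decides.\<close>

lemma p_normal_words_le:
  assumes I: "finite I" and t: "t \<in> carrier FG"
    and q: "\<And>i. i \<in> I \<Longrightarrow> is_projection (q i)" "\<And>i. i \<in> I \<Longrightarrow> q i \<in> D t"
  shows "p (\<lambda>v. \<Sum>i\<in>I. c i * nc_mono (normal_word t (q i)) v) \<le> norm (\<Sum>i\<in>I. cscale (c i) (q i))"
proof -
  have "(p (\<lambda>v. \<Sum>i\<in>I. c i * nc_mono (normal_word t (q i)) v))\<^sup>2 =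
      (p (\<lambda>v. \<Sum>i\<in>I. c i * nc_mono (normal_word [] (q i)) v))\<^sup>2"
    using p_normal_words[OF I t q, where c = c] p_normal_words[OF I Nil_closed q(1), where c = c] by (simp add: D_Nil)
  moreover have "0 \<le> p (\<lambda>v. \<Sum>i\<in>I. c i * nc_mono [P (q i)] v)"
    by (intro p.nonneg free_sum_closed I P_closed q(1))
  ultimately have "(p (\<lambda>v. \<Sum>i\<in>I. c i * nc_mono (normal_word t (q i)) v))\<^sup>2 \<le>
      (norm (\<Sum>i\<in>I. cscale (c i) (q i)))\<^sup>2"
    using p_projections_le[OF I q(1), where c = c] by (simp add: power_mono)
  then show ?thesis by (rule power2_le_imp_le) simp
qed

text \<open>The words of \<open>f\<close> are replaced by normal words and grouped by group element.
  The group at \<open>s\<close> is bounded by the norm of its coefficient, which is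
  \<open>\<Phi> f s\<close>; adding up gives the l1 norm.\<close>

lemma p_le_l1_norm:
  assumes f: "f \<in> carrier p.F"
  shows "p f \<le> l1_norm (\<Phi> f)"
proof -
  define W where "W = {w. f w \<noteq> 0}"
  have W: "finite W" "W \<subseteq> nc_words gens" using f by (auto simp: free_carrier W_def)
  define t where "t w = snd (word_image w)" for w
  define q where "q w = fst (word_image w)" for w
  have tq: "t w \<in> carrier FG" "is_projection (q w)" "q w \<in> D (t w)" if "w \<in> W" for w
    using proj_deltasD[OF word_image_closed[OF subsetD[OF W(2) that]]] by (simp_all add: t_def q_def)
  define g where "g s = (\<lambda>v. \<Sum>w | w \<in> W \<and> t w = s. f w * nc_mono (normal_word s (q w)) v)" for s
  have nw: "normal_word (t w) (q w) \<in> nc_words gens" if "w \<in> W" for w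
    using normal_word(1) tq[OF that] by blast
  have gc: "g s \<in> carrier p.F" for s
    unfolding g_def using nw W(1) by (intro free_sum_closed free_mono_closed) auto
  have "f = (\<lambda>v. \<Sum>w\<in>W. f w * nc_mono w v)"
    using W(1) by (rule nc_expand) (simp add: W_def)
  then have "p f = p (\<lambda>v. \<Sum>w\<in>W. f w * nc_mono w v)" by (rule arg_cong)
  also have "\<dots> = p (\<lambda>v. \<Sum>w\<in>W. f w * nc_mono (normal_word (t w) (q w)) v)"
  proof (rule p.p_sum_cong[OF W(1)])
    fix w assume "w \<in> W"
    then have "p.sim w (normal_word (t w) (q w))"
      using sim_nf W(2) unfolding t_def q_def by blast
    then show "nc_mono w \<in> carrier p.F" "nc_mono (normal_word (t w) (q w)) \<in> carrier p.F"
      "p.d (nc_mono w) (nc_mono (normal_word (t w) (q w))) = 0"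
      by (auto simp: p.sim_def intro: free_mono_closed)
  qed
  also have "(\<lambda>v. \<Sum>w\<in>W. f w * nc_mono (normal_word (t w) (q w)) v) = (\<lambda>v. \<Sum>s\<in>t ` W. 1 * g s v)"
  proof
    fix v
    have "(\<Sum>s\<in>t ` W. g s v) =
        (\<Sum>s\<in>t ` W. \<Sum>w | w \<in> W \<and> t w = s. f w * nc_mono (normal_word (t w) (q w)) v)"
      unfolding g_def by (intro sum.cong refl) auto
    also have "\<dots> = (\<Sum>w\<in>W. f w * nc_mono (normal_word (t w) (q w)) v)"
      using W(1) by (intro sum.group) auto
    finally show "(\<Sum>w\<in>W. f w * nc_mono (normal_word (t w) (q w)) v) = (\<Sum>s\<in>t ` W. 1 * g s v)" by simp
  qed
  also have "p \<dots> \<le> (\<Sum>s\<in>t ` W. cmod 1 * p (g s))"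
    using W(1) gc by (intro p.p_sum_le) auto
  also have "\<dots> \<le> (\<Sum>s\<in>t ` W. norm (\<Phi> f s))"
  proof (rule sum_mono)
    fix s assume s: "s \<in> t ` W"
    then have sc: "s \<in> carrier FG" using tq by auto
    have "p (g s) \<le> norm (\<Sum>w | w \<in> W \<and> t w = s. cscale (f w) (q w))"
      unfolding g_def using W(1) tq by (intro p_normal_words_le sc) auto
    also have "(\<Sum>w | w \<in> W \<and> t w = s. cscale (f w) (q w)) = (\<Sum>w\<in>W. cscale (f w) (word_delta w s))"
      using W(1) by (intro sum.mono_neutral_cong_left) (auto simp: word_delta_def delta_def t_def q_def)
    also have "\<dots> = \<Phi> f s" by (simp add: nc_lift_def W_def)
    finally show "cmod 1 * p (g s) \<le> norm (\<Phi> f s)" by simp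
  qed
  also have "\<dots> = l1_norm (\<Phi> f)"
  proof (rule l1_norm_eq[symmetric])
    show "{s. \<Phi> f s \<noteq> 0} \<subseteq> t ` W"
    proof
      fix s assume s: "s \<in> {s. \<Phi> f s \<noteq> 0}"
      show "s \<in> t ` W"
      proof (rule ccontr)
        assume "s \<notin> t ` W"
        then have "\<Phi> f s = 0"
          unfolding nc_lift_def by (intro sum.neutral) (auto simp: word_delta_def delta_def t_def W_def)
        with s show False by simp
      qed
    qed
  qed (use W(1) in simp)
  finally show ?thesis .
qed

end

text \<open>The two suprema run over the same set of real numbers: compatible C*-seminorms extend
  along \<Phi>, and C*-seminorms of the crossed product pull back, both without changing the value
  concerned.\<close>

lemma maximal_cstar_seminorm_\<Phi>:
  assumes f: "f \<in> carrier (free_star_algebra gens)"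
  shows "maximal_cstar_seminorm (free_star_algebra gens) relations f =
    maximal_cstar_seminorm CP {} (\<Phi> f)"
proof -
  let ?F = "free_star_algebra gens"
  have "(\<lambda>p. p f) ` {p. cstar_seminorm ?F p \<and> (\<forall>(l, r)\<in>relations. p (sdiff ?F l r) = 0)} =
      (\<lambda>q. q (\<Phi> f)) ` {q. cstar_seminorm CP q}"
  proof (intro equalityI subsetI)
    fix y assume "y \<in> (\<lambda>p. p f) ` {p. cstar_seminorm ?F p \<and> (\<forall>(l, r)\<in>relations. p (sdiff ?F l r) = 0)}"
    then obtain p where p: "cstar_seminorm ?F p" "\<And>l r. (l, r) \<in> relations \<Longrightarrow> p (sdiff ?F l r) = 0"
      and y: "y = p f" by auto
    obtain q where "cstar_seminorm CP q" "\<And>x. x \<in> carrier ?F \<Longrightarrow> q (\<Phi> x) = p x"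
      using \<Phi>.cstar_seminorm_extend[OF p(1) l1_norm_star_seminorm p_le_l1_norm[OF p] \<Phi>_dense] by blast
    then show "y \<in> (\<lambda>q. q (\<Phi> f)) ` {q. cstar_seminorm CP q}" using y f by (intro image_eqI[of _ _ q]) simp_all
  next
    fix y assume "y \<in> (\<lambda>q. q (\<Phi> f)) ` {q. cstar_seminorm CP q}"
    then obtain q where q: "cstar_seminorm CP q" and y: "y = q (\<Phi> f)" by auto
    have "q (\<Phi> (sdiff ?F l r)) = 0" if "(l, r) \<in> relations" for l r
    proof -
      note lr = \<Phi>_relations[OF that]
      \<comment> \<open>Both sides of a relation have the same image, so the difference is a zero
        multiple and homogeneity gives the value 0.\<close>
      have "\<Phi> (sdiff ?F l r) = sscale CP 0 (\<Phi> r)"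
        using lr by (simp add: \<Phi>.hom_sdiff CP.sdiff_self \<Phi>.hom_closed)
      then show ?thesis
        using q lr \<Phi>.hom_closed[of r] by (simp add: cstar_seminorm_def)
    qed
    then show "y \<in> (\<lambda>p. p f) ` {p. cstar_seminorm ?F p \<and> (\<forall>(l, r)\<in>relations. p (sdiff ?F l r) = 0)}"
      using \<Phi>.cstar_seminorm_pullback[OF q] y by (intro image_eqI[of _ _ "\<lambda>x. q (\<Phi> x)"]) auto
  qed
  then show ?thesis by (simp add: maximal_cstar_seminorm_def)
qed

text \<open>The l1 norm mediates: it dominates every C*-seminorm, so the maximal one is finite, and
  density of the image in the l1 norm is density for the maximal seminorm.\<close>

theorem crossed_product_isomorphic:
  "cstar_isomorphic (crossed_product FG D \<tau>) (bds_cstar projection_algebra X \<theta>)"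
  unfolding crossed_product_def bds_cstar_def universal_cstar_def
proof (rule \<Phi>.completion_isomorphic)
  let ?M = "maximal_cstar_seminorm CP {}"
  have M: "?M = (\<lambda>x. SUP q\<in>{q. cstar_seminorm CP q}. q x)"
    by (simp add: maximal_cstar_seminorm_def fun_eq_iff)
  have bdd: "bdd_above ((\<lambda>q. q x) ` {q. cstar_seminorm CP q})" if "x \<in> carrier CP" for x
    using cstar_seminorm_le_l1_norm that by (intro bdd_aboveI[of _ "l1_norm x"]) auto
  have ne: "{q. cstar_seminorm CP q} \<noteq> {}" using cstar_seminorm_zero by blast
  show "star_seminorm CP ?M"
    unfolding M using CP_star_algebra ne _ bdd
    by (rule star_seminorm_SUP) (simp add: cstar_seminorm_iff)
  show "maximal_cstar_seminorm (free_star_algebra gens) relations x = ?M (\<Phi> x)"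
    if "x \<in> carrier (free_star_algebra gens)" for x
    using that by (rule maximal_cstar_seminorm_\<Phi>)
  fix y e assume y: "y \<in> carrier CP" and e: "0 < (e::real)"
  obtain f where f: "f \<in> carrier (free_star_algebra gens)" "l1_norm (sdiff CP y (\<Phi> f)) < e"
    using \<Phi>_dense[OF y e] by blast
  have "?M (sdiff CP y (\<Phi> f)) \<le> l1_norm (sdiff CP y (\<Phi> f))"
    unfolding M using ne cstar_seminorm_le_l1_norm CP.sdiff_closed[OF y \<Phi>.hom_closed[OF f(1)]]
    by (intro cSUP_least) auto
  with f show "\<exists>x\<in>carrier (free_star_algebra gens). ?M (sdiff CP y (\<Phi> x)) < e"
    by (intro bexI[of _ f]) simp_all
qed

end

theorem corollary5p5:
  fixes X :: "'g set"
    and D :: "('g \<times> bool) list \<Rightarrow> 'a::{cstar_algebra, comm_ring} set"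
    and \<tau> :: "('g \<times> bool) list \<Rightarrow> 'a \<Rightarrow> 'a"
  assumes "cstar_subalgebra hull {p::'a. is_projection p} = UNIV"
    and "partial_action (free_group X) D \<tau>"
    and "semi_saturated X D \<tau>"
    and "orthogonal_partial_action X D"
    and "\<forall>\<alpha>\<in>X. \<exists>C. cstar_ideal C \<and> ideal_direct_sum (D (free_generator \<alpha>)) C"
  shows "\<exists>(\<B> :: 'a boolean_ops) (L :: 'g set) (\<theta> :: 'g \<Rightarrow> 'a \<Rightarrow> 'a).
    boolean_dynamical_system \<B> L \<theta> \<and>
    cstar_isomorphic (crossed_product (free_group X) D \<tau>) (bds_cstar \<B> L \<theta>)"
proof -
  interpret partial_action "free_group X" D \<tau> by (rule assms(2))
  interpret boolean_partial_action X D \<tau>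
    by unfold_locales (use assms in \<open>simp_all add: generated_by_projections_def\<close>)
  show ?thesis
    using boolean_dynamical_system crossed_product_isomorphic by blast
qed

end
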